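(* Let $0<p<\infty$, let $\omega\in B_\infty$ and let $Z$ be a sequence in $\mathbb{D}$. Then $Z\in\mathcal{Z}(A^p_\omega)$ if and only if there exists a (real-valued) harmonic function $h$ on $\mathbb{D}$ such that $$\int_{\mathbb{D}}\exp\left(p\,k_Z(z)-h(z)\right)\omega(z)\,dA(z)<\infty.$$
   Context: $\mathbb{D}=\{z\in\mathbb{C}:|z|<1\}$, $\mathcal{H}(\mathbb{D})$ is the space of analytic functions in $\mathbb{D}$, and $dA(z)=\frac{dx\,dy}{\pi}$. A weight is a function $\omega:\mathbb{D}\to[0,\infty)$ integrable over $\mathbb{D}$ (with respect to $dA$). $A^p_\omega$ consists of $f\in\mathcal{H}(\mathbb{D})$ with $\|f\|_{A^p_\omega}^p=\int_{\mathbb{D}}|f|^p\omega\,dA<\infty$. Carleson squares are the sets $S(z)=\{re^{i\theta}\in\mathbb{D}:|z|<r<1,\ |\arg(ze^{-i\theta})|<\frac{1-|z|}{2}\}$, $z\in\mathbb{D}\setminus\{0\}$; $|S|$ denotes Euclidean area. For $1<q<\infty$, $\omega\in B_q$ means that the weight $\omega$ is strictly positive almost everywhere and $$\sup_S\left(\frac1{|S|^2}\int_S\omega(z)(1-|z|^2)^{2q}\,dA(z)\right)\left(\frac1{|S|^2}\int_S\omega(z)^{-\frac1{q-1}}\,dA(z)\right)^{q-1}<\infty,$$ the supremum being over all Carleson squares $S$. $B_\infty=\bigcup_{q>1}B_q$. For $f\not\equiv0$, $\mathcal{Z}(f)$ is the sequence of all zeros of $f$ in $\mathbb{D}$ counted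 with multiplicities. $\mathcal{Z}(A^p_\omega)$ is the set of all sequences $Z$ such that $Z=\mathcal{Z}(f)$ for some nonzero $f\in A^p_\omega$. For a sequence $Z\subset\mathbb{D}$, $k_Z(z)=\frac{|z|^2}{2}\sum_{a\in Z}\frac{(1-|a|^2)^2}{|1-\overline az|^2}$, $z\in\mathbb{D}$. *)

theory Defs
  imports "HOL-Complex_Analysis.Complex_Analysis"
begin

abbreviation unit_disc :: "complex set" ("\<bbbD>") where
  "\<bbbD> \<equiv> ball 0 1"

definition dA :: "complex measure" where
  "dA = scale_measure (ennreal (1 / pi)) (lebesgue_on \<bbbD>)"

text \<open>
  Functions on the disc are represented by total functions on \<open>complex\<close>; their values outside
  the disc are irrelevant.
\<close>

definition weight :: "(complex \<Rightarrow> real) \<Rightarrow> bool" where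
  "weight \<omega> \<longleftrightarrow> (\<forall>z\<in>\<bbbD>. 0 \<le> \<omega> z) \<and> integrable dA \<omega>"

definition weighted_Bergman :: "real \<Rightarrow> (complex \<Rightarrow> real) \<Rightarrow> (complex \<Rightarrow> complex) set" where
  "weighted_Bergman p \<omega> =
     {f. f holomorphic_on \<bbbD> \<and> (\<integral>\<^sup>+z. ennreal (cmod (f z) powr p * \<omega> z) \<partial>dA) < \<infinity>}"

definition Carleson_square :: "complex \<Rightarrow> complex set" where
  "Carleson_square z = {of_real r * cis \<theta> | r \<theta>.
     cmod z < r \<and> r < 1 \<and> \<bar>Arg (z * cis (-\<theta>))\<bar> < (1 - cmod z) / 2}"

text \<open>
  The second average in the \<open>B\<^sub>q\<close> condition may be infinite, so the condition is stated in the
  extended nonnegative reals, for which the library has no real powers. Only exponents \<open>s > 0\<close>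
  are used.
\<close>

definition ennreal_powr :: "ennreal \<Rightarrow> real \<Rightarrow> ennreal" where
  "ennreal_powr x s = (if x = \<infinity> then \<infinity> else ennreal (enn2real x powr s))"

text \<open>
  Where \<open>\<omega> z = 0\<close> the library has \<open>\<omega> z powr (- 1 / (q - 1)) = 0\<close> rather than \<open>\<infinity>\<close>; this is
  harmless because \<open>\<omega>\<close> is required to be positive almost everywhere.
\<close>

definition B_class :: "real \<Rightarrow> (complex \<Rightarrow> real) set" where
  "B_class q = {\<omega>. weight \<omega> \<and> (AE z in dA. 0 < \<omega> z) \<and>
     (SUP S \<in> Carleson_square ` (\<bbbD> - {0}).
        (\<integral>\<^sup>+z\<in>S. ennreal (\<omega> z * (1 - (cmod z)\<^sup>2) powr (2 * q)) \<partial>dA)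
            / ennreal ((measure lebesgue S)\<^sup>2)
        * ennreal_powr
            ((\<integral>\<^sup>+z\<in>S. ennreal (\<omega> z powr (- 1 / (q - 1))) \<partial>dA)
               / ennreal ((measure lebesgue S)\<^sup>2)) (q - 1)) < \<infinity>}"

definition B_infinity :: "(complex \<Rightarrow> real) set" where
  "B_infinity = (\<Union>q\<in>{1<..}. B_class q)"

text \<open>
  A finite or infinite sequence is a pair of its length and its terms; terms with index beyond
  the length are ignored. Terms may be repeated.
\<close>

type_synonym cseq = "enat \<times> (nat \<Rightarrow> complex)"

definition seq_index :: "cseq \<Rightarrow> nat set" where
  "seq_index Z = {i. enat i < fst Z}"

definition seq_in :: "cseq \<Rightarrow> complex set \<Rightarrow> bool" where
  "seq_in Z A \<longleftrightarrow> (\<forall>i\<in>seq_index Z. snd Z i \<in> A)"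

text \<open>
  \<open>Z = \<Z>(f)\<close> is independent of the order of the terms: every point of the disc occurs in \<open>Z\<close>
  exactly as often as its order as a zero of \<open>f\<close>. The order \<open>zorder f z\<close> is \<open>0\<close> when \<open>f z \<noteq> 0\<close>.
\<close>

definition is_zero_sequence_of :: "cseq \<Rightarrow> (complex \<Rightarrow> complex) \<Rightarrow> bool" where
  "is_zero_sequence_of Z f \<longleftrightarrow> seq_in Z \<bbbD> \<and>
     (\<forall>z\<in>\<bbbD>. finite {i\<in>seq_index Z. snd Z i = z} \<and>
             int (card {i\<in>seq_index Z. snd Z i = z}) = zorder f z)"

definition zero_sequences :: "real \<Rightarrow> (complex \<Rightarrow> real) \<Rightarrow> cseq set" where
  "zero_sequences p \<omega> =
     {Z. \<exists>f\<in>weighted_Bergman p \<omega>. (\<exists>z\<in>\<bbbD>. f z \<noteq> 0) \<and> is_zero_sequence_of Z f}"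

text \<open>The series may diverge, so \<open>k\<^sub>Z\<close> takes values in the extended nonnegative reals.\<close>

definition k_fun :: "cseq \<Rightarrow> complex \<Rightarrow> ennreal" where
  "k_fun Z z = ennreal ((cmod z)\<^sup>2 / 2) *
     (\<Sum>\<^sub>\<infinity>i\<in>seq_index Z.
        ennreal ((1 - (cmod (snd Z i))\<^sup>2)\<^sup>2 / (cmod (1 - cnj (snd Z i) * z))\<^sup>2))"

definition ereal_exp :: "ereal \<Rightarrow> ennreal" where
  "ereal_exp x = (if x = \<infinity> then \<infinity> else if x = -\<infinity> then 0 else ennreal (exp (real_of_ereal x)))"

text \<open>
  Twice continuously differentiable with vanishing Laplacian; \<open>uxx\<close>, \<open>uxy\<close>, \<open>uyx\<close>, \<open>uyy\<close> are
  the second partial derivatives.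
\<close>

definition harmonic_on :: "(complex \<Rightarrow> real) \<Rightarrow> complex set \<Rightarrow> bool" (infix "harmonic'_on" 50) where
  "u harmonic_on A \<longleftrightarrow> open A \<and> (\<exists>ux uy uxx uxy uyx uyy.
     (\<forall>z\<in>A. (u has_derivative (\<lambda>v. ux z * Re v + uy z * Im v)) (at z) \<and>
            (ux has_derivative (\<lambda>v. uxx z * Re v + uxy z * Im v)) (at z) \<and>
            (uy has_derivative (\<lambda>v. uyx z * Re v + uyy z * Im v)) (at z)) \<and>
     continuous_on A uxx \<and> continuous_on A uxy \<and> continuous_on A uyx \<and> continuous_on A uyy \<and>
     (\<forall>z\<in>A. uxx z + uyy z = 0))"

end

theory Submission
  imports Defs
begin

text \<open>
  Write \<open>\<phi>\<^sub>a z = (a - z) / (1 - cnj a z)\<close> and \<open>x\<^sub>a = 1 - |\<phi>\<^sub>a|\<^sup>2\<close>, and let \<open>k\<^sub>a\<close> be the term of \<open>a\<close> in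
  \<open>k\<^sub>Z\<close>. Since \<open>(1 - |a|\<^sup>2) Re ((1 + cnj a z) / (1 - cnj a z)) = 2 k\<^sub>a + x\<^sub>a\<close>, the function
  \<open>F\<^sub>a = \<phi>\<^sub>a exp ((1 - |a|\<^sup>2) / 2 \<sqdot> (1 + cnj a z) / (1 - cnj a z))\<close> satisfies
  \<open>|F\<^sub>a| = |\<phi>\<^sub>a| exp (k\<^sub>a + x\<^sub>a / 2) \<le> exp k\<^sub>a\<close>, and the product \<open>F\<close> of the \<open>F\<^sub>a\<close>, suitably rotated,
  converges as soon as \<open>\<Sum> (1 - |a|\<^sup>2)\<^sup>2 < \<infinity>\<close>. If \<open>h = Re H\<close> makes the integral finite, then
  \<open>F exp (- H / p)\<close> lies in the weighted Bergman space and has zero sequence \<open>Z\<close>.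

  Conversely, let \<open>f\<close> in the space have zero sequence \<open>Z\<close>. Jensen's formula and conformal invariance
  give \<open>(|f| \<Prod> exp (- x\<^sub>a / 2) / |\<phi>\<^sub>a|)\<^sup>s \<le> B(|f|\<^sup>s)\<close> for every \<open>s > 0\<close>, where \<open>B\<close> is the Berezin
  transform. With \<open>f = F exp g\<close> the left-hand side is \<open>(exp k\<^sub>Z |exp g|)\<^sup>s\<close>, so for \<open>s = p / q\<close> and
  \<open>h = - p Re g\<close> it suffices that \<open>B\<close> is bounded on the weighted \<open>L\<^sup>q\<close> space. This is the theorem of
  Bekolle and Bonami for one particular kernel: the condition \<open>B\<^sub>q\<close> makes the masses of
  \<open>\<omega> (1 - |z|\<^sup>2)\<^sup>2\<^sup>q\<close> and \<open>\<omega>\<^sup>-\<^sup>1\<^sup>/\<^sup>(\<^sup>q\<^sup>-\<^sup>1\<^sup>)\<close> on Carleson squares comparable with those on the top halves,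
  hence geometrically decaying towards the circle, and then powers of \<open>1 - |z|\<close> serve as test
  functions.
\<close>

section \<open>Harmonic functions as real parts\<close>

text \<open>Zero sequences of such spaces may violate the Blaschke condition. The exponential in
  \<open>F\<^sub>a\<close> cancels the first-order term of \<open>ln |\<phi>\<^sub>a|\<close> in
  \<open>1 - |a|^2\<close>, as in a Weierstrass factor of genus one, and averaging Jensen's formula
  over all radii with respect to area produces the same correction \<open>x\<^sub>a / 2\<close>.
  This match is the origin of \<open>k\<^sub>Z\<close>. Since \<open>q\<close> is merely known to
  exist, \<open>s = p / q\<close> can be arbitrarily small. The zeros are therefore reflected before
  powers are taken: every real power of the modulus of a zero-free function on a disc is again the
  modulus of a holomorphic function. The form of \<open>B_class q\<close> comes from testing
  \<open>B\<close> on \<open>\<omega> powr (- 1 / (q - 1))\<close> restricted to a Carleson square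
  \<open>S\<close> of side \<open>t\<close>, where the kernel is at least of order
  \<open>t powr (- 4)\<close>, hence of \<open>1 / |S|^2\<close>. The difficulty is the converse:
  the kernel contains all dyadic scales, and bounds of equal size at the single scales cannot be
  added up. The small power \<open>e\<close> gained from the geometric decay makes the sums over the
  scales converge.\<close>

lemma mixed_difference_quotient:
  fixes u :: "complex \<Rightarrow> real"
  assumes e0: "e0 > 0"
    and du: "\<And>w. cmod (w - z) < e0 \<Longrightarrow> (u has_derivative (\<lambda>v. ux w * Re v + uy w * Im v)) (at w)"
    and dux: "(ux has_derivative (\<lambda>v. a * Re v + b * Im v)) (at z)"
  shows "((\<lambda>t::real. (u (z + Complex t t) - u (z + Complex t 0) - u (z + Complex 0 t) + u z) / t\<^sup>2) \<longlongrightarrow> b) (at_right 0)"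
proof (rule tendstoI)
  fix e :: real assume e: "e > 0"
  \<comment> \<open>Two remainders will be added, each at a point within \<open>2 t\<close> of
    \<open>z\<close>; with \<open>e / 6\<close> they sum to at most
    \<open>2 / 3 * e * t < e * t\<close>.\<close>
  have "\<exists>\<delta>>0. \<forall>y. cmod (y - z) < \<delta> \<longrightarrow>
      norm (ux y - ux z - (a * Re (y - z) + b * Im (y - z))) \<le> (e/6) * cmod (y - z)"
    using dux e unfolding has_derivative_at_alt by (metis zero_less_divide_iff zero_less_numeral)
  then obtain d where d: "d > 0" and D: "\<And>y. cmod (y - z) < d \<Longrightarrow>
      \<bar>ux y - ux z - (a * Re (y - z) + b * Im (y - z))\<bar> \<le> (e/6) * cmod (y - z)"
    by (metis real_norm_def)
  have small: "cmod (Complex s r) \<le> 2 * t" if "0 \<le> s" "s \<le> t" "0 \<le> r" "r \<le> t" for s r t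
    using complex_Re_le_cmod cmod_le[of "Complex s r"] that by simp
  show "\<forall>\<^sub>F t in at_right 0. dist ((u (z + Complex t t) - u (z + Complex t 0) - u (z + Complex 0 t) + u z) / t\<^sup>2) b < e"
  proof (rule eventually_at_rightI[of 0 "min d e0 / 3"])
    show "0 < min d e0 / 3" using d e0 by simp
    fix t :: real assume t: "t \<in> {0<..<min d e0 / 3}"
    \<comment> \<open>The numerator is \<open>g t - g 0\<close>. The mean value theorem in the
      horizontal direction reduces it to one difference of \<open>ux\<close> across a vertical
      segment, where differentiability of \<open>ux\<close> at the single point \<open>z\<close> is
      enough.\<close>
    define g where "g s = u (z + Complex s t) - u (z + Complex s 0)" for s
    define g' where "g' s = ux (z + Complex s t) - ux (z + Complex s 0)" for s
    have cder: "((\<lambda>s. z + Complex s r) has_derivative (\<lambda>h. Complex h 0)) (at s)" for s r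
    proof -
      have "(\<lambda>s. z + Complex s r) = (\<lambda>s. z + (of_real s + \<i> * of_real r))"
        by (auto simp: complex_eq_iff)
      moreover have "(\<lambda>h. Complex h 0) = (\<lambda>h. of_real h)" by (auto simp: complex_eq_iff)
      ultimately show ?thesis by (auto intro!: derivative_eq_intros)
    qed
    have uder: "((\<lambda>s. u (z + Complex s r)) has_real_derivative ux (z + Complex s r)) (at s)"
      if "0 \<le> s" "s \<le> t" "0 \<le> r" "r \<le> t" for s r
    proof -
      have "cmod (z + Complex s r - z) < e0" using small[OF that] t by auto
      from diff_chain_at[OF cder du[OF this]] show ?thesis
        by (simp add: o_def has_field_derivative_def)
    qed
    have "\<exists>s. 0 < s \<and> s < t \<and> g t - g 0 = (t - 0) * g' s"
      using t unfolding g_def g'_def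
      by (intro MVT2) (auto intro!: DERIV_diff uder)
    then obtain s where s: "0 < s" "s < t" and gs: "g t - g 0 = t * g' s" by auto
    have n1: "cmod (Complex s t) \<le> 2 * t" "cmod (Complex s 0) \<le> 2 * t" using small s by auto
    have "\<bar>ux (z + Complex s t) - ux z - (a * s + b * t)\<bar> \<le> (e/6) * cmod (Complex s t)"
      using D[of "z + Complex s t"] n1 t by auto
    moreover have "\<bar>ux (z + Complex s 0) - ux z - (a * s)\<bar> \<le> (e/6) * cmod (Complex s 0)"
      using D[of "z + Complex s 0"] n1 t by auto
    moreover have "(e/6) * cmod (Complex s t) \<le> (e/6) * (2*t)" "(e/6) * cmod (Complex s 0) \<le> (e/6) * (2*t)"
      using n1 e by (intro mult_left_mono; simp)+
    ultimately have "\<bar>g' s - b * t\<bar> \<le> e * (2/3) * t"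
      unfolding g'_def by linarith
    also have "\<dots> < e * t" using e t by simp
    finally have "\<bar>g' s / t - b\<bar> < e"
      using t by (simp add: abs_less_iff field_simps)
    moreover have "(u (z + Complex t t) - u (z + Complex t 0) - u (z + Complex 0 t) + u z) / t\<^sup>2 = g' s / t"
    proof -
      have "Complex 0 0 = 0" by (simp add: complex_eq_iff)
      then have "u (z + Complex t t) - u (z + Complex t 0) - u (z + Complex 0 t) + u z = t * g' s"
        using gs by (simp add: g_def)
      then show ?thesis using t by (simp add: power2_eq_square)
    qed
    ultimately show "dist ((u (z + Complex t t) - u (z + Complex t 0) - u (z + Complex 0 t) + u z) / t\<^sup>2) b < e"
      by (simp add: dist_real_def)
  qed
qed

text \<open>Interchanging the coordinates leaves the mixed second difference unchanged, so both
  mixed partials are limits of the same quotient. \<open>harmonic_on\<close> does not list this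
  equality, but the Cauchy-Riemann equations in the next lemma rest on it.\<close>

lemma symmetric_mixed_partials:
  fixes u :: "complex \<Rightarrow> real"
  assumes "open A" "z \<in> A"
    and du: "\<And>w. w \<in> A \<Longrightarrow> (u has_derivative (\<lambda>v. ux w * Re v + uy w * Im v)) (at w)"
    and dux: "(ux has_derivative (\<lambda>v. a * Re v + b * Im v)) (at z)"
    and duy: "(uy has_derivative (\<lambda>v. c * Re v + d * Im v)) (at z)"
  shows "b = c"
proof -
  obtain e where e: "e > 0" "ball z e \<subseteq> A" using assms(1,2) openE by blast
  define J where "J w = Complex (Im w) (Re w)" for w
  have J: "bounded_linear J"
    by (rule bounded_linear_intro[where K=1]) (auto simp: J_def complex_eq_iff cmod_def algebra_simps)
  have Jd: "(J has_derivative J) (at w)" for w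
    using J bounded_linear_imp_has_derivative by blast
  have JJ [simp]: "J (J w) = w" "Re (J w) = Im w" "Im (J w) = Re w" for w by (auto simp: J_def)
  have Jn: "cmod (J w) = cmod w" for w by (simp add: J_def cmod_def add.commute)
  have Jdiff: "J w - v = J (w - J v)" for w v by (simp add: J_def complex_eq_iff)
  have 1: "((\<lambda>t::real. (u (z + Complex t t) - u (z + Complex t 0) - u (z + Complex 0 t) + u z) / t\<^sup>2) \<longlongrightarrow> b) (at_right 0)"
  proof (rule mixed_difference_quotient[OF e(1) du dux])
    show "w \<in> A" if "cmod (w - z) < e" for w
      using that e(2) by (auto simp: dist_norm norm_minus_commute)
  qed
  have 2: "((\<lambda>t::real. ((u \<circ> J) (J z + Complex t t) - (u \<circ> J) (J z + Complex t 0) - (u \<circ> J) (J z + Complex 0 t) + (u \<circ> J) (J z)) / t\<^sup>2) \<longlongrightarrow> c) (at_right 0)"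
  proof (rule mixed_difference_quotient[OF e(1)])
    fix w assume "cmod (w - J z) < e"
    then have "J w \<in> A" using e Jdiff[of w z] Jn[of "w - J z"] by (auto simp: dist_norm norm_minus_commute subset_iff)
    from diff_chain_at[OF Jd du[OF this]]
    show "(u \<circ> J has_derivative (\<lambda>v. (uy \<circ> J) w * Re v + (ux \<circ> J) w * Im v)) (at w)"
      by (simp add: o_def add.commute)
  next
    have "(uy has_derivative (\<lambda>v. c * Re v + d * Im v)) (at (J (J z)))" using duy by simp
    from diff_chain_at[OF Jd this]
    show "(uy \<circ> J has_derivative (\<lambda>v. d * Re v + c * Im v)) (at (J z))"
      by (simp add: o_def add.commute)
  qed
  have "J (J z + Complex t r) = z + Complex r t" for t r by (simp add: J_def complex_eq_iff)
  with 2 have "((\<lambda>t::real. (u (z + Complex t t) - u (z + Complex t 0) - u (z + Complex 0 t) + u z) / t\<^sup>2) \<longlongrightarrow> c) (at_right 0)"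
    by (simp add: algebra_simps)
  with 1 show ?thesis using tendsto_unique trivial_limit_at_right_real by blast
qed

text \<open>\<open>ux - \<i> uy\<close> satisfies the Cauchy-Riemann equations, by the vanishing
  Laplacian and the symmetry of the mixed partials; the real part of a primitive has the same
  gradient as \<open>h\<close>.\<close>

lemma harmonic_on_imp_Re_holomorphic:
  assumes "h harmonic_on A" "convex A"
  obtains H where "H holomorphic_on A" "\<And>z. z \<in> A \<Longrightarrow> h z = Re (H z)"
proof (cases "A = {}")
  case True then show ?thesis using that[of "\<lambda>_. 0"] by auto
next
  case False
  from assms(1) obtain ux uy uxx uxy uyx uyy where A: "open A"
    and D: "\<And>z. z \<in> A \<Longrightarrow> (h has_derivative (\<lambda>v. ux z * Re v + uy z * Im v)) (at z)"
      "\<And>z. z \<in> A \<Longrightarrow> (ux has_derivative (\<lambda>v. uxx z * Re v + uxy z * Im v)) (at z)"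
      "\<And>z. z \<in> A \<Longrightarrow> (uy has_derivative (\<lambda>v. uyx z * Re v + uyy z * Im v)) (at z)"
    and L: "\<And>z. z \<in> A \<Longrightarrow> uxx z + uyy z = 0"
    unfolding harmonic_on_def by blast
  define G where "G z = Complex (ux z) (- uy z)" for z
  have "(G has_field_derivative Complex (uxx z) (- uyx z)) (at z)" if z: "z \<in> A" for z
  proof -
    have sym: "uxy z = uyx z" by (rule symmetric_mixed_partials[OF A z D(1) D(2)[OF z] D(3)[OF z]])
    have "uyy z = - uxx z" using L[OF z] by simp
    have G: "G = (\<lambda>z. of_real (ux z) - \<i> * of_real (uy z))" by (auto simp: G_def complex_eq_iff)
    have "(G has_derivative (\<lambda>v. of_real (uxx z * Re v + uxy z * Im v) - \<i> * of_real (uyx z * Re v + uyy z * Im v))) (at z)"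
      unfolding G by (intro derivative_intros D z)
    also have "(\<lambda>v. of_real (uxx z * Re v + uxy z * Im v) - \<i> * of_real (uyx z * Re v + uyy z * Im v)) = (*) (Complex (uxx z) (- uyx z))"
      using sym \<open>uyy z = - uxx z\<close> by (auto simp: fun_eq_iff complex_eq_iff algebra_simps)
    finally show ?thesis by (simp add: has_field_derivative_def)
  qed
  then have "G holomorphic_on A" using A by (meson holomorphic_on_open)
  from holomorphic_convex_primitive'[OF \<open>convex A\<close> A this] A
  obtain F where F: "\<And>z. z \<in> A \<Longrightarrow> (F has_field_derivative G z) (at z)"
    by (metis at_within_open)
  have "\<exists>c. \<forall>z\<in>A. h z - Re (F z) = c"
  proof (rule has_derivative_zero_constant[OF \<open>convex A\<close>])
    fix z assume z: "z \<in> A"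
    have "(F has_derivative (*) (G z)) (at z)" using F[OF z] by (simp add: has_field_derivative_def)
    from has_derivative_diff[OF D(1)[OF z] has_derivative_Re[OF this]]
    have "((\<lambda>z. h z - Re (F z)) has_derivative (\<lambda>v. 0)) (at z)"
      by (simp add: G_def)
    then show "((\<lambda>z. h z - Re (F z)) has_derivative (\<lambda>v. 0)) (at z within A)"
      by (rule has_derivative_at_withinI)
  qed
  then obtain c where c: "\<And>z. z \<in> A \<Longrightarrow> h z - Re (F z) = c" by blast
  show ?thesis
  proof (rule that[of "\<lambda>z. F z + of_real c"])
    have "F holomorphic_on A" using F A by (meson holomorphic_on_open)
    then show "(\<lambda>z. F z + of_real c) holomorphic_on A" by (intro holomorphic_intros)
    show "h z = Re (F z + of_real c)" if "z \<in> A" for z using c[OF that] by simp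
  qed
qed

lemma Re_holomorphic_harmonic_on:
  assumes "H holomorphic_on A" "open A"
  shows "(\<lambda>z. Re (H z)) harmonic_on A"
proof -
  have H1: "deriv H holomorphic_on A" using assms holomorphic_deriv by blast
  have H2: "deriv (deriv H) holomorphic_on A" using H1 assms holomorphic_deriv by blast
  have c: "continuous_on A (deriv (deriv H))" using H2 holomorphic_on_imp_continuous_on by blast
  have d: "(f has_derivative (*) (deriv f z)) (at z)" if "f holomorphic_on A" "z \<in> A" for f z
    using holomorphic_derivI[OF that(1) \<open>open A\<close> that(2)] by (simp add: has_field_derivative_def)
  show ?thesis
    unfolding harmonic_on_def
  proof (rule conjI[OF assms(2)], rule exI[of _ "\<lambda>z. Re (deriv H z)"], rule exI[of _ "\<lambda>z. - Im (deriv H z)"],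
      rule exI[of _ "\<lambda>z. Re (deriv (deriv H) z)"], rule exI[of _ "\<lambda>z. - Im (deriv (deriv H) z)"],
      rule exI[of _ "\<lambda>z. - Im (deriv (deriv H) z)"], rule exI[of _ "\<lambda>z. - Re (deriv (deriv H) z)"],
      intro conjI ballI)
    fix z assume z: "z \<in> A"
    show "((\<lambda>z. Re (H z)) has_derivative (\<lambda>v. Re (deriv H z) * Re v + - Im (deriv H z) * Im v)) (at z)"
      using has_derivative_Re[OF d[OF assms(1) z]] by simp
    show "((\<lambda>z. Re (deriv H z)) has_derivative
        (\<lambda>v. Re (deriv (deriv H) z) * Re v + - Im (deriv (deriv H) z) * Im v)) (at z)"
      using has_derivative_Re[OF d[OF H1 z]] by simp
    have "(\<lambda>v. - (Re (deriv (deriv H) z) * Im v + Im (deriv (deriv H) z) * Re v)) =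
        (\<lambda>v. - Im (deriv (deriv H) z) * Re v + - Re (deriv (deriv H) z) * Im v)"
      by (auto simp: algebra_simps)
    then show "((\<lambda>z. - Im (deriv H z)) has_derivative
        (\<lambda>v. - Im (deriv (deriv H) z) * Re v + - Re (deriv (deriv H) z) * Im v)) (at z)"
      using has_derivative_minus[OF has_derivative_Im[OF d[OF H1 z]]] by simp
  qed (use assms c in \<open>auto intro!: continuous_intros\<close>)
qed

section \<open>A canonical product in the disc\<close>

text \<open>The involutive automorphism of the disc that exchanges \<open>0\<close> and
  \<open>a\<close>.\<close>

definition disc_involution :: "complex \<Rightarrow> complex \<Rightarrow> complex" where
  "disc_involution a z = (a - z) / (1 - cnj a * z)"

definition k_term :: "complex \<Rightarrow> complex \<Rightarrow> real" where
  "k_term a z = (cmod z)\<^sup>2 / 2 * ((1 - (cmod a)\<^sup>2)\<^sup>2 / (cmod (1 - cnj a * z))\<^sup>2)"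

text \<open>The unimodular constant \<open>cnj (sgn a)\<close> makes the factor positive at the
  origin for nonzero \<open>a\<close>; this rotation is what lets the factors tend to
  \<open>1\<close>.\<close>

definition zero_factor :: "complex \<Rightarrow> complex \<Rightarrow> complex" where
  "zero_factor a z = (if a = 0 then 1 else cnj (sgn a)) * disc_involution a z *
     exp (of_real ((1 - (cmod a)\<^sup>2) / 2) * ((1 + cnj a * z) / (1 - cnj a * z)))"

lemma one_minus_cnj_mult_nonzero:
  assumes "cmod a < 1" "cmod z < 1"
  shows "1 - cnj a * z \<noteq> 0"
proof
  assume "1 - cnj a * z = 0"
  then have "cmod (cnj a * z) = 1" by simp
  moreover have "cmod (cnj a * z) < 1" using assms mult_strict_mono[of "cmod a" 1 "cmod z" 1]
    by (simp add: norm_mult)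
  ultimately show False by simp
qed

lemma cmod_one_minus_cnj_mult_sq_le:
  assumes "cmod a < 1" "cmod z < 1"
  shows "(cmod (1 - cnj a * z))\<^sup>2 \<le> 4"
proof -
  have "cmod (1 - cnj a * z) \<le> 1 + cmod (cnj a * z)" using norm_triangle_ineq4[of 1 "cnj a * z"] by simp
  also have "cmod (cnj a * z) \<le> 1" using assms by (simp add: norm_mult mult_le_one)
  finally have "(cmod (1 - cnj a * z))\<^sup>2 \<le> 2\<^sup>2" by (intro power_mono) auto
  then show ?thesis by simp
qed

lemma cmod_one_minus_cnj_mult_sq:
  "(cmod (1 - cnj a * z))\<^sup>2 = (cmod (a - z))\<^sup>2 + (1 - (cmod a)\<^sup>2) * (1 - (cmod z)\<^sup>2)"
  unfolding cmod_power2 by (simp add: power2_eq_square algebra_simps)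

lemma one_minus_disc_involution_sq:
  assumes "cmod a < 1" "cmod z < 1"
  shows "1 - (cmod (disc_involution a z))\<^sup>2 =
    (1 - (cmod a)\<^sup>2) * (1 - (cmod z)\<^sup>2) / (cmod (1 - cnj a * z))\<^sup>2"
  using one_minus_cnj_mult_nonzero[OF assms] cmod_one_minus_cnj_mult_sq[of a z]
  by (simp add: disc_involution_def norm_divide power_divide field_simps)

lemma cmod_sq_less_1: "cmod z < 1 \<Longrightarrow> (cmod z)\<^sup>2 < 1"
  by (simp add: abs_square_less_1)

lemma cmod_disc_involution_less_1:
  assumes "cmod a < 1" "cmod z < 1"
  shows "cmod (disc_involution a z) < 1"
proof -
  have "0 < (1 - (cmod a)\<^sup>2) * (1 - (cmod z)\<^sup>2) / (cmod (1 - cnj a * z))\<^sup>2"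
    using assms one_minus_cnj_mult_nonzero[OF assms] cmod_sq_less_1 by (intro divide_pos_pos mult_pos_pos) auto
  then have "(cmod (disc_involution a z))\<^sup>2 < 1" using one_minus_disc_involution_sq[OF assms] by simp
  then show ?thesis by (simp add: abs_square_less_1)
qed

lemma disc_involution_eq_0_iff:
  assumes "cmod a < 1" "cmod z < 1"
  shows "disc_involution a z = 0 \<longleftrightarrow> a = z"
  using one_minus_cnj_mult_nonzero[OF assms] by (auto simp: disc_involution_def)

lemma cmod_zero_factor:
  assumes "cmod a < 1" "cmod z < 1"
  shows "cmod (zero_factor a z) = cmod (disc_involution a z) *
    exp (k_term a z + (1 - (cmod (disc_involution a z))\<^sup>2) / 2)"
proof -
  let ?w = "1 - cnj a * z"
  have nz: "?w \<noteq> 0" by (rule one_minus_cnj_mult_nonzero[OF assms])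
  have "Re ((1 + cnj a * z) / ?w) = (1 - (cmod a)\<^sup>2 * (cmod z)\<^sup>2) / (cmod ?w)\<^sup>2"
    using nz unfolding Re_divide cmod_power2 by (simp add: power2_eq_square algebra_simps)
  \<comment> \<open>With \<open>A = |a|^2\<close>, \<open>B = |z|^2\<close> and
    \<open>W = |1 - cnj a z|^2\<close>, the split \<open>1 - A B = B (1 - A) + (1 - B)\<close>
    separates \<open>k_term a z\<close> from half of
    \<open>1 - |disc_involution a z|^2\<close>.\<close>
  moreover have "(1 - A) / 2 * ((1 - A * B) / W) = B / 2 * ((1 - A)\<^sup>2 / W) + ((1 - A) * (1 - B) / W) / 2" for A B W :: real
    by (simp add: field_split_simps power2_eq_square)
  ultimately have "(1 - (cmod a)\<^sup>2) / 2 * Re ((1 + cnj a * z) / ?w) =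
      k_term a z + (1 - (cmod (disc_involution a z))\<^sup>2) / 2"
    unfolding k_term_def one_minus_disc_involution_sq[OF assms] by metis
  moreover have "Re (of_real c * w) = c * Re w" for c w by simp
  ultimately have "Re (of_real ((1 - (cmod a)\<^sup>2) / 2) * ((1 + cnj a * z) / ?w)) =
      k_term a z + (1 - (cmod (disc_involution a z))\<^sup>2) / 2" by metis
  then show ?thesis unfolding zero_factor_def norm_mult norm_exp_eq_Re by (simp add: norm_sgn)
qed

lemma cmod_zero_factor_le:
  assumes "cmod a < 1" "cmod z < 1"
  shows "cmod (zero_factor a z) \<le> exp (k_term a z)"
proof -
  let ?y = "cmod (disc_involution a z)"
  have "?y * exp ((1 - ?y\<^sup>2) / 2) \<le> 1"
  proof (cases "?y = 0")
    case False
    then have "?y > 0" by simp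
    then have "2 * ln ?y = ln (?y\<^sup>2)" by (simp add: ln_realpow)
    also have "\<dots> \<le> ?y\<^sup>2 - 1" using \<open>?y > 0\<close> by (intro ln_le_minus_one) auto
    finally have "2 * ln ?y \<le> ?y\<^sup>2 - 1" .
    then have "ln ?y + (1 - ?y\<^sup>2) / 2 \<le> 0" by argo
    then have "exp (ln ?y + (1 - ?y\<^sup>2) / 2) \<le> 1" by simp
    then show ?thesis using \<open>?y > 0\<close> by (simp add: exp_add)
  qed auto
  then have "?y * exp ((1 - ?y\<^sup>2) / 2) * exp (k_term a z) \<le> 1 * exp (k_term a z)"
    by (intro mult_right_mono) auto
  then show ?thesis by (simp add: cmod_zero_factor[OF assms] exp_add mult_ac)
qed

lemma holomorphic_zero_factor:
  assumes "cmod a < 1"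
  shows "zero_factor a holomorphic_on \<bbbD>"
proof -
  have nz: "1 - cnj a * z \<noteq> 0" if "z \<in> \<bbbD>" for z
    using one_minus_cnj_mult_nonzero[OF assms, of z] that by simp
  show ?thesis unfolding zero_factor_def disc_involution_def
    by (intro holomorphic_intros nz)
qed

lemma zero_factor_eq_0_iff:
  assumes "cmod a < 1" "cmod z < 1"
  shows "zero_factor a z = 0 \<longleftrightarrow> z = a"
  using disc_involution_eq_0_iff[OF assms] by (auto simp: zero_factor_def sgn_zero_iff)

lemma zorder_zero_factor:
  assumes "cmod a < 1"
  shows "zorder (zero_factor a) a = 1"
proof -
  have nz: "1 - cnj a * z \<noteq> 0" if "z \<in> \<bbbD>" for z
    using one_minus_cnj_mult_nonzero[OF assms, of z] that by simp
  have alg: "c * ((a - w) / d) * e = - (c / d * e) * (w - a) powi 1" for c d e w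
    by (cases "d = 0") (simp_all add: field_simps)
  show ?thesis
  proof (rule zorder_eqI[where S = \<bbbD> and g = "\<lambda>z. - ((if a = 0 then 1 else cnj (sgn a)) / (1 - cnj a * z) *
       exp (of_real ((1 - (cmod a)\<^sup>2) / 2) * ((1 + cnj a * z) / (1 - cnj a * z))))"])
    show "(\<lambda>z. - ((if a = 0 then 1 else cnj (sgn a)) / (1 - cnj a * z) *
       exp (of_real ((1 - (cmod a)\<^sup>2) / 2) * ((1 + cnj a * z) / (1 - cnj a * z))))) holomorphic_on \<bbbD>"
      by (intro holomorphic_intros nz)
  next
    show "- ((if a = 0 then 1 else cnj (sgn a)) / (1 - cnj a * a) *
       exp (of_real ((1 - (cmod a)\<^sup>2) / 2) * ((1 + cnj a * a) / (1 - cnj a * a)))) \<noteq> 0"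
      using nz[of a] assms by (auto simp: sgn_zero_iff)
  next
    fix w assume "w \<in> \<bbbD>" "w \<noteq> a"
    show "zero_factor a w = - ((if a = 0 then 1 else cnj (sgn a)) / (1 - cnj a * w) *
       exp (of_real ((1 - (cmod a)\<^sup>2) / 2) * ((1 + cnj a * w) / (1 - cnj a * w)))) * (w - a) powi 1"
      unfolding zero_factor_def disc_involution_def by (rule alg)
  qed (use assms in auto)
qed

text \<open>With \<open>u = (1 - |a|^2) / (1 - cnj a z)\<close> one has
  \<open>1 - u = cnj a (a - z) / (1 - cnj a z)\<close>, so the factor is the genus-one Weierstrass
  factor \<open>(1 - u) exp u\<close> up to a positive constant. Its distance from \<open>1\<close>
  is of second order in \<open>1 - |a|^2\<close>, which is why
  \<open>\<Sum> (1 - |a|^2)^2 < \<infinity>\<close> is enough.\<close>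

lemma zero_factor_eq_weierstrass_factor:
  assumes "cmod a < 1" "cmod z < 1" "a \<noteq> 0"
  shows "zero_factor a z = weierstrass_factor 1 (of_real (1 - (cmod a)\<^sup>2) / (1 - cnj a * z)) *
    of_real (exp (- (1 - (cmod a)\<^sup>2) / 2) / cmod a)"
proof -
  let ?w = "1 - cnj a * z" and ?t = "complex_of_real (1 - (cmod a)\<^sup>2)"
  have nz: "?w \<noteq> 0" by (rule one_minus_cnj_mult_nonzero[OF assms(1,2)])
  have aa: "complex_of_real ((cmod a)\<^sup>2) = a * cnj a" by (simp only: complex_norm_square)
  have 1: "?t / 2 * ((1 + cnj a * z) / ?w) = ?t / ?w + - ?t / 2"
    using nz by (simp add: field_simps)
  have 2: "1 - ?t / ?w = cnj a * (a - z) / ?w"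
    using nz aa by (simp add: field_simps)
  have "zero_factor a z = cnj a / cmod a * ((a - z) / ?w) * exp (?t / 2 * ((1 + cnj a * z) / ?w))"
    using assms(3) by (simp add: zero_factor_def disc_involution_def sgn_eq)
  also have "\<dots> = (1 - ?t / ?w) * exp (?t / ?w) * (exp (- ?t / 2) / cmod a)"
    unfolding 1 2 exp_add by (simp add: mult_ac)
  also have "exp (- ?t / 2) = of_real (exp (- (1 - (cmod a)\<^sup>2) / 2))"
    by (simp only: exp_of_real[symmetric] of_real_divide of_real_minus of_real_numeral)
  finally show ?thesis by (simp add: weierstrass_factor_def field_simps)
qed

text \<open>With \<open>t = 1 - r^2\<close> the expansion of
  \<open>- ln r = - ln (1 - t) / 2\<close> begins with \<open>t / 2\<close>, which
  \<open>exp (- t / 2)\<close> cancels; hence the constant, too, is \<open>1\<close> up to second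
  order.\<close>

lemma normalising_constant_bound:
  fixes r :: real
  assumes "1/2 \<le> r\<^sup>2" "0 < r" "r < 1"
  shows "\<bar>exp (- (1 - r\<^sup>2) / 2) / r - 1\<bar> \<le> 2 * (1 - r\<^sup>2)\<^sup>2"
proof -
  define t where "t = 1 - r\<^sup>2"
  have t: "0 \<le> t" "t \<le> 1/2" using assms by (auto simp: t_def abs_square_le_1)
  define y where "y = - t / 2 - ln r"
  have "ln (r\<^sup>2) = ln (1 - t)" by (simp add: t_def)
  then have lr: "ln r = ln (1 - t) / 2" using assms by (simp add: ln_realpow)
  have "ln (1 - t) \<le> - t" using ln_le_minus_one[of "1 - t"] t by simp
  then have y0: "0 \<le> y" by (simp add: y_def lr)
  have "- t - 2 * t\<^sup>2 \<le> ln (1 - t)" using ln_one_minus_pos_lower_bound[OF t] by simp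
  then have y1: "y \<le> t\<^sup>2" by (simp add: y_def lr)
  have "t\<^sup>2 \<le> (1/2)\<^sup>2" using t by (intro power_mono) auto
  then have y2: "y \<le> 1" using y1 by (simp add: power2_eq_square)
  have "exp (- t / 2) / r = exp y" using assms by (simp add: y_def exp_diff)
  moreover have "exp y \<le> 1 + y + y\<^sup>2" using exp_bound[OF y0 y2] .
  moreover have "y\<^sup>2 \<le> y" using y0 y2 by (simp add: power2_eq_square mult_left_le)
  moreover have "1 \<le> exp y" using y0 by simp
  ultimately have "\<bar>exp (- t / 2) / r - 1\<bar> \<le> 2 * y" by simp
  also have "\<dots> \<le> 2 * t\<^sup>2" using y1 by simp
  finally show ?thesis by (simp add: t_def)
qed

text \<open>The last hypothesis gives \<open>|u| \<le> 1/2\<close> for the Weierstrass argument and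
  \<open>|a|^2 \<ge> 1/2\<close>. The constant collects \<open>3 |u|^2\<close> from the Weierstrass
  factor, doubled because the normalising constant is at most \<open>2\<close>, and
  \<open>2 t^2\<close> from the normalising constant itself.\<close>

lemma zero_factor_bound:
  assumes "cmod a < 1" "cmod z \<le> r" "r < 1" "1 - (cmod a)\<^sup>2 \<le> (1 - r) / 2"
  shows "cmod (zero_factor a z - 1) \<le> (6 / (1 - r)\<^sup>2 + 2) * (1 - (cmod a)\<^sup>2)\<^sup>2"
proof -
  define t where "t = 1 - (cmod a)\<^sup>2"
  have r0: "0 \<le> r" using assms(2) norm_ge_zero[of z] by linarith
  have t: "0 \<le> t" "t \<le> 1/2" "t \<le> (1 - r)/2" using assms r0 by (auto simp: t_def abs_square_le_1)
  have a0: "a \<noteq> 0" using t by (auto simp: t_def)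
  define u where "u = of_real t / (1 - cnj a * z)"
  define c where "c = exp (- t / 2) / cmod a"
  have "1 - r \<le> 1 - cmod (cnj a * z)"
    using mult_mono[of "cmod a" 1 "cmod z" r] assms r0 by (simp add: norm_mult)
  also have "\<dots> \<le> cmod (1 - cnj a * z)" using norm_triangle_ineq2[of 1 "cnj a * z"] by simp
  finally have d: "1 - r \<le> cmod (1 - cnj a * z)" .
  have "cmod u = t / cmod (1 - cnj a * z)" using t by (simp add: u_def norm_divide)
  also have "\<dots> \<le> t / (1 - r)" using d t assms by (intro divide_left_mono mult_pos_pos) auto
  finally have u: "cmod u \<le> t / (1 - r)" .
  also have "t / (1 - r) \<le> 1/2" using t assms by (simp add: field_simps)
  finally have u2: "cmod u \<le> 1/2" .
  have W: "cmod (weierstrass_factor 1 u - 1) \<le> 3 * (t / (1 - r))\<^sup>2"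
  proof -
    have "cmod (weierstrass_factor 1 u - 1) \<le> 3 * cmod u ^ 2"
      using weierstrass_factor_bound[OF u2, of 1] by (simp add: numeral_2_eq_2)
    also have "\<dots> \<le> 3 * (t / (1 - r))\<^sup>2" using u by (intro mult_left_mono power_mono) auto
    finally show ?thesis .
  qed
  have c1: "\<bar>c - 1\<bar> \<le> 2 * t\<^sup>2"
    unfolding c_def t_def using a0 assms t by (intro normalising_constant_bound) (auto simp: t_def)
  have "t\<^sup>2 \<le> (1/2)\<^sup>2" using t by (intro power_mono) auto
  with c1 have c2: "\<bar>c\<bar> \<le> 2" by (simp add: power2_eq_square)
  have "zero_factor a z - 1 = (weierstrass_factor 1 u - 1) * of_real c + of_real (c - 1)"
    using zero_factor_eq_weierstrass_factor[OF assms(1) _ a0, of z] assms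
    by (simp add: u_def c_def t_def algebra_simps)
  then have "cmod (zero_factor a z - 1) \<le> cmod ((weierstrass_factor 1 u - 1) * of_real c) + cmod (of_real (c - 1))"
    using norm_triangle_ineq by metis
  also have "\<dots> = cmod (weierstrass_factor 1 u - 1) * \<bar>c\<bar> + \<bar>c - 1\<bar>"
    by (simp only: norm_mult norm_of_real)
  also have "\<dots> \<le> (3 * (t / (1 - r))\<^sup>2) * 2 + 2 * t\<^sup>2"
    using W c1 c2 by (intro add_mono mult_mono) auto
  finally show ?thesis by (simp add: t_def power_divide algebra_simps)
qed

section \<open>Convergence and zeros of the product\<close>

locale zero_product =
  fixes a :: "nat \<Rightarrow> complex" and I :: "nat set"
  assumes a_in: "\<And>n. n \<in> I \<Longrightarrow> cmod (a n) < 1"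
    and summable_a: "summable (\<lambda>n. if n \<in> I then (1 - (cmod (a n))\<^sup>2)\<^sup>2 else 0)"
begin

text \<open>Indices outside \<open>I\<close> contribute the factor \<open>1\<close>, so that finite
  and infinite sequences are both covered by one product over all natural numbers.\<close>

definition factor :: "nat \<Rightarrow> complex \<Rightarrow> complex" where
  "factor n z = (if n \<in> I then zero_factor (a n) z else 1)"

definition F :: "complex \<Rightarrow> complex" where
  "F z = (\<Prod>n. factor n z)"

lemma holomorphic_factor: "factor n holomorphic_on \<bbbD>"
  using holomorphic_zero_factor[OF a_in] by (cases "n \<in> I") (auto simp: factor_def[abs_def])

lemma eventually_factor_bound:
  assumes "r < 1"
  shows "eventually (\<lambda>n. \<forall>z\<in>cball 0 r. norm (norm (factor n z - 1)) \<le>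
    (6 / (1 - r)\<^sup>2 + 2) * (if n \<in> I then (1 - (cmod (a n))\<^sup>2)\<^sup>2 else 0)) sequentially"
proof -
  have "eventually (\<lambda>n. (if n \<in> I then (1 - (cmod (a n))\<^sup>2)\<^sup>2 else 0) < ((1 - r) / 2)\<^sup>2) sequentially"
    by (rule order_tendstoD(2)[OF summable_LIMSEQ_zero[OF summable_a]]) (use assms in simp)
  then show ?thesis
  proof eventually_elim
    case (elim n)
    show ?case
    proof (cases "n \<in> I")
      case True
      then have "(1 - (cmod (a n))\<^sup>2)\<^sup>2 < ((1 - r) / 2)\<^sup>2" using elim by simp
      then have "1 - (cmod (a n))\<^sup>2 < (1 - r) / 2" by (rule power_less_imp_less_base) (use assms in auto)
      then show ?thesis using zero_factor_bound[OF a_in[OF True] _ assms] True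
        by (auto simp: factor_def)
    qed (auto simp: factor_def)
  qed
qed

lemma has_prod: 
  assumes "cmod z < 1"
  shows "(\<lambda>n. factor n z) has_prod F z"
proof -
  have "abs_convergent_prod (\<lambda>n. factor n z)"
    unfolding abs_convergent_prod_conv_summable
  proof (rule summable_comparison_test_ev)
    show "eventually (\<lambda>n. norm (norm (factor n z - 1)) \<le>
      (6 / (1 - cmod z)\<^sup>2 + 2) * (if n \<in> I then (1 - (cmod (a n))\<^sup>2)\<^sup>2 else 0)) sequentially"
      using eventually_factor_bound[OF assms] by eventually_elim auto
  qed (intro summable_mult summable_a)
  then have "convergent_prod (\<lambda>n. factor n z)" using abs_convergent_prod_imp_convergent_prod by blast
  then show ?thesis unfolding F_def by auto
qed

lemma LIMSEQ_prod:
  assumes "cmod z < 1"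
  shows "(\<lambda>N. \<Prod>n<N. factor n z) \<longlonglongrightarrow> F z"
proof -
  have "(\<lambda>N. \<Prod>n<Suc N. factor n z) \<longlonglongrightarrow> F z"
    using has_prod_imp_tendsto[OF has_prod[OF assms]] unfolding lessThan_Suc_atMost .
  then show ?thesis by (rule LIMSEQ_imp_Suc)
qed

lemma eq_0_iff:
  assumes "cmod z < 1"
  shows "F z = 0 \<longleftrightarrow> (\<exists>n\<in>I. a n = z)"
  using has_prod_eq_0_iff[OF has_prod[OF assms]] zero_factor_eq_0_iff[OF a_in assms]
  by (auto simp: factor_def image_iff split: if_splits)

lemma uniform_limit:
  assumes "0 \<le> r" "r < 1"
  shows "uniform_limit (cball 0 r) (\<lambda>N z. \<Prod>n<N. factor n z) F sequentially"
proof -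
  have "uniformly_convergent_on (cball 0 r) (\<lambda>N z. \<Prod>n<N. factor n z)"
  proof (rule uniformly_convergent_on_prod')
    show "continuous_on (cball 0 r) (factor n)" for n
      by (rule continuous_on_subset[OF holomorphic_on_imp_continuous_on[OF holomorphic_factor]]) (use assms in auto)
    show "uniformly_convergent_on (cball 0 r) (\<lambda>N z. \<Sum>n<N. norm (factor n z - 1))"
      by (rule Weierstrass_m_test'_ev[OF eventually_factor_bound[OF assms(2)]])
        (intro summable_mult summable_a)
  qed auto
  then obtain g where g: "uniform_limit (cball 0 r) (\<lambda>N z. \<Prod>n<N. factor n z) g sequentially"
    by (auto simp: uniformly_convergent_on_def)
  also have "?this \<longleftrightarrow> uniform_limit (cball 0 r) (\<lambda>N z. \<Prod>n<N. factor n z) F sequentially"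
  proof (intro uniform_limit_cong)
    fix z :: complex assume z: "z \<in> cball 0 r"
    have "(\<lambda>N. \<Prod>n<N. factor n z) \<longlonglongrightarrow> g z" by (rule tendsto_uniform_limitI[OF g z])
    moreover have "(\<lambda>N. \<Prod>n<N. factor n z) \<longlonglongrightarrow> F z" by (rule LIMSEQ_prod) (use z assms in simp)
    ultimately show "g z = F z" by (rule LIMSEQ_unique)
  qed auto
  finally show ?thesis .
qed

lemma holomorphic: "F holomorphic_on \<bbbD>"
proof (rule holomorphic_uniform_sequence)
  fix z :: complex assume z: "z \<in> \<bbbD>"
  define d where "d = (1 - cmod z) / 2"
  have d: "d > 0" "cmod z + d < 1" using z by (auto simp: d_def field_simps)
  have "cball z d \<subseteq> cball 0 (cmod z + d)"
    by (subst cball_subset_cball_iff) (use d in auto)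
  then show "\<exists>d>0. cball z d \<subseteq> \<bbbD> \<and> uniform_limit (cball z d) (\<lambda>N z. \<Prod>n<N. factor n z) F sequentially"
    using uniform_limit_on_subset[OF uniform_limit[of "cmod z + d"]] d by (intro exI[of _ d]) fastforce
qed (auto intro!: holomorphic_intros holomorphic_factor)

text \<open>Each occurrence of \<open>z\<close> adds the same positive number
  \<open>(1 - |z|^2)^2\<close> to a convergent series.\<close>

lemma finite_occs:
  assumes "cmod z < 1"
  shows "finite {n\<in>I. a n = z}"
proof -
  have e: "eventually (\<lambda>n. (if n \<in> I then (1 - (cmod (a n))\<^sup>2)\<^sup>2 else 0) < (1 - (cmod z)\<^sup>2)\<^sup>2) sequentially"
    by (rule order_tendstoD(2)[OF summable_LIMSEQ_zero[OF summable_a]]) (use cmod_sq_less_1[OF assms] in simp)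
  then obtain N where N: "\<And>n. n \<ge> N \<Longrightarrow> (if n \<in> I then (1 - (cmod (a n))\<^sup>2)\<^sup>2 else 0) < (1 - (cmod z)\<^sup>2)\<^sup>2"
    by (auto simp: eventually_sequentially)
  have "n < N" if "n \<in> I" "a n = z" for n using N[of n] that by (cases "n < N") auto
  then have "{n\<in>I. a n = z} \<subseteq> {..<N}" by auto
  then show ?thesis using finite_subset by blast
qed

text \<open>Used to split off the finitely many factors that vanish at a given point.\<close>

lemma tail: "zero_product (\<lambda>n. a (n + N)) {n. n + N \<in> I}"
proof
  show "cmod (a (n + N)) < 1" if "n \<in> {n. n + N \<in> I}" for n using a_in that by auto
  show "summable (\<lambda>n. if n \<in> {n. n + N \<in> I} then (1 - (cmod (a (n + N)))\<^sup>2)\<^sup>2 else 0)"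
    using summable_ignore_initial_segment[OF summable_a, of N] by simp
qed

lemma not_identically_zero: "\<exists>z\<in>\<bbbD>. F z \<noteq> 0"
proof -
  have "uncountable (\<bbbD> - a ` I)" by (intro uncountable_minus_countable) (auto simp: uncountable_ball)
  then obtain z where "z \<in> \<bbbD> - a ` I" using uncountable_infinite not_finite_existsD
    by (metis all_not_in_conv countable_empty)
  then show ?thesis using eq_0_iff by (intro bexI[of _ z]) auto
qed

text \<open>Beyond some \<open>N\<close> no term equals \<open>z\<close>, so the tail product is
  nonzero at \<open>z\<close>. Orders add up over the remaining finite product, in which each factor
  has order \<open>1\<close> or \<open>0\<close> at \<open>z\<close>.\<close>

lemma zorder:
  assumes z: "cmod z < 1"
  shows "zorder F z = int (card {n\<in>I. a n = z})"
proof -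
  obtain N where N: "{n\<in>I. a n = z} \<subseteq> {..<N}"
    using finite_nat_bounded[OF finite_occs[OF z]] by blast
  interpret T: zero_product "\<lambda>n. a (n + N)" "{n. n + N \<in> I}" by (rule tail)
  have F_eq: "F w = (\<Prod>n<N. factor n w) * T.F w" if "cmod w < 1" for w
  proof (rule has_prod_unique2[OF has_prod[OF that]])
    have "(\<lambda>n. factor n w) has_prod ((\<Prod>n<N. factor n w) * (\<Prod>n. factor (n + N) w))"
      using has_prod[OF that] by (intro has_prod_ignore_initial_segment') (simp add: has_prod_iff)
    then show "(\<lambda>n. factor n w) has_prod ((\<Prod>n<N. factor n w) * T.F w)"
      by (simp add: T.F_def T.factor_def factor_def)
  qed
  have zD: "z \<in> \<bbbD>" using z by simp
  have ana: "f analytic_on {z}" if "f holomorphic_on \<bbbD>" for f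
    using that zD by (metis analytic_at open_ball)
  have ev1: "eventually (\<lambda>w. w \<in> \<bbbD>) (at z)" using zD by (intro eventually_at_in_open') auto
  have ev0: "eventually (\<lambda>w. F w \<noteq> 0 \<and> w \<in> \<bbbD>) (at z)"
  proof -
    obtain w where "w \<in> \<bbbD>" "F w \<noteq> 0" using not_identically_zero by blast
    then show ?thesis by (intro non_zero_neighbour_alt[where \<beta> = w] holomorphic zD) auto
  qed
  then have ev: "eventually (\<lambda>w. (\<Prod>n<N. factor n w) * T.F w \<noteq> 0) (at z)"
    by eventually_elim (use F_eq in auto)
  have ev2: "eventually (\<lambda>w. (\<Prod>n<N. factor n w) \<noteq> 0) (at z)"
    using ev by eventually_elim auto
  have ns: "eventually (\<lambda>w. F w = (\<Prod>n<N. factor n w) * T.F w) (nhds z)"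
    using eventually_nhds_in_open[of \<bbbD> z] zD F_eq by (auto elim!: eventually_mono)
  have "zorder F z = zorder (\<lambda>w. (\<Prod>n<N. factor n w) * T.F w) z"
    using ns by (intro zorder_cong) (auto simp: eventually_at_filter elim: eventually_mono)
  also have "\<dots> = zorder (\<lambda>w. (\<Prod>n<N. factor n w)) z + zorder T.F z"
    by (intro zorder_times_analytic ana T.holomorphic ev) (auto intro!: holomorphic_intros holomorphic_factor)
  also have "zorder (\<lambda>w. (\<Prod>n<N. factor n w)) z = (\<Sum>n<N. zorder (factor n) z)"
    by (intro zorder_prod_analytic ana holomorphic_factor ev2)
  also have "zorder T.F z = 0"
  proof (rule zorder_eq_0I[OF ana[OF T.holomorphic]])
    show "T.F z \<noteq> 0" using T.eq_0_iff[OF z] N by force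
  qed
  also have "(\<Sum>n<N. zorder (factor n) z) = (\<Sum>n<N. if n \<in> {n\<in>I. a n = z} then 1 else 0)"
  proof (rule sum.cong[OF refl])
    fix n
    show "zorder (factor n) z = (if n \<in> {n\<in>I. a n = z} then 1 else 0)"
    proof (cases "n \<in> {n\<in>I. a n = z}")
      case True
      then have "factor n = zero_factor z" by (auto simp: factor_def)
      then show ?thesis using True zorder_zero_factor[OF z] by auto
    next
      case False
      then have "factor n z \<noteq> 0" using zero_factor_eq_0_iff[OF a_in z] by (auto simp: factor_def)
      then show ?thesis using False zorder_eq_0I[OF ana[OF holomorphic_factor]] by auto
    qed
  qed
  also have "\<dots> = int (card ({..<N} \<inter> {n\<in>I. a n = z}))"
    by (simp add: sum.If_cases)
  also have "{..<N} \<inter> {n\<in>I. a n = z} = {n\<in>I. a n = z}" using N by blast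
  finally show ?thesis by simp
qed

end

section \<open>Powers of extended nonnegative reals and Hoelder's inequality\<close>

lemma ennreal_powr_ennreal [simp]: "0 \<le> a \<Longrightarrow> ennreal_powr (ennreal a) s = ennreal (a powr s)"
  by (simp add: ennreal_powr_def)

lemma ennreal_powr_top [simp]: "ennreal_powr top s = top"
  by (simp add: ennreal_powr_def)

lemma ennreal_powr_0 [simp]: "ennreal_powr 0 s = 0"
  by (simp add: ennreal_powr_def)

lemma ennreal_powr_mono:
  assumes "0 \<le> s" "x \<le> y"
  shows "ennreal_powr x s \<le> ennreal_powr y s"
  using assms by (cases x; cases y) (auto intro!: powr_mono2 simp: top_unique)

lemma ennreal_powr_mult:
  assumes "0 < s"
  shows "ennreal_powr (x * y) s = ennreal_powr x s * ennreal_powr y s"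
proof (cases "x = top \<or> y = top")
  case True
  then show ?thesis
    using assms by (cases x; cases y) (auto simp: ennreal_mult_top ennreal_top_mult)
next
  case False
  then obtain a b where "x = ennreal a" "y = ennreal b" "0 \<le> a" "0 \<le> b" by (metis ennreal_cases)
  then show ?thesis by (simp add: powr_mult flip: ennreal_mult)
qed

lemma ennreal_powr_eq_0_iff [simp]: "ennreal_powr x s = 0 \<longleftrightarrow> x = 0"
  by (cases x) (auto simp: ennreal_eq_0_iff)

lemma ennreal_powr_eq_top_iff [simp]: "ennreal_powr x s = top \<longleftrightarrow> x = top"
  by (cases x) auto

lemma measurable_ennreal_powr [measurable]:
  assumes [measurable]: "f \<in> borel_measurable M"
  shows "(\<lambda>x. ennreal_powr (f x) s) \<in> borel_measurable M"
  unfolding ennreal_powr_def by measurable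

lemma ennreal_powr_add_le:
  assumes "0 \<le> s"
  shows "ennreal_powr (x + y) s \<le> ennreal (2 powr s) * (ennreal_powr x s + ennreal_powr y s)"
proof (cases "x = top \<or> y = top")
  case True
  then show ?thesis by (auto simp: ennreal_mult_top)
next
  case False
  then obtain a b where ab: "x = ennreal a" "y = ennreal b" "0 \<le> a" "0 \<le> b" by (metis ennreal_cases)
  have "(a + b) powr s \<le> (2 * max a b) powr s" using ab assms by (intro powr_mono2) auto
  also have "\<dots> = 2 powr s * max a b powr s" using ab by (simp add: powr_mult)
  also have "\<dots> \<le> 2 powr s * (a powr s + b powr s)" by (intro mult_left_mono) (auto simp: max_def)
  finally show ?thesis using ab by (simp flip: ennreal_plus ennreal_mult)
qed

text \<open>Young's inequality with a free scale \<open>l\<close> is integrated pointwise.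
  Everything is extended-valued because the integrals are not known to be finite when the inequality
  is applied.\<close>

lemma nn_integral_Holder:
  fixes F :: "'a \<Rightarrow> ennreal" and w :: "'a \<Rightarrow> real"
  assumes q: "1 < q" and [measurable]: "F \<in> borel_measurable M" "w \<in> borel_measurable M"
    and w: "\<And>x. x \<in> space M \<Longrightarrow> 0 < w x"
  shows "ennreal_powr (\<integral>\<^sup>+x. F x \<partial>M) q \<le>
    (\<integral>\<^sup>+x. ennreal_powr (F x) q * ennreal (w x) \<partial>M) *
    ennreal_powr (\<integral>\<^sup>+x. ennreal (w x powr (- 1 / (q - 1))) \<partial>M) (q - 1)"
proof -
  define A where "A = (\<integral>\<^sup>+x. ennreal_powr (F x) q * ennreal (w x) \<partial>M)"
  define B where "B = (\<integral>\<^sup>+x. ennreal (w x powr (- 1 / (q - 1))) \<partial>M)"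
  have zero: ?thesis if "AE x in M. F x = 0"
  proof -
    have "(\<integral>\<^sup>+x. F x \<partial>M) = 0" using that by (subst nn_integral_0_iff_AE) auto
    then show ?thesis by simp
  qed
  \<comment> \<open>A vanishing \<open>A\<close> or \<open>B\<close> forces \<open>F = 0\<close>
    almost everywhere because \<open>w > 0\<close> (for \<open>B\<close> the whole space is null); a
    nonzero pair with an infinite member makes the right-hand side infinite. Only the remaining case
    admits the balancing constant below.\<close>
  consider "A = 0" | "B = 0" | "A \<noteq> 0" "B \<noteq> 0" "A = top \<or> B = top" | "A \<noteq> 0" "B \<noteq> 0" "A \<noteq> top" "B \<noteq> top" by blast
  then show ?thesis
  proof cases
    case 1
    then have "AE x in M. ennreal_powr (F x) q * ennreal (w x) = 0"
      unfolding A_def by (subst (asm) nn_integral_0_iff_AE) auto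
    then have "AE x in M. F x = 0"
      by (rule AE_mp) (rule AE_I2, use w in force)
    then show ?thesis by (rule zero)
  next
    case 2
    then have "AE x in M. ennreal (w x powr (- 1 / (q - 1))) = 0"
      unfolding B_def by (subst (asm) nn_integral_0_iff_AE) auto
    then have "AE x in M. F x = 0"
      by (rule AE_mp) (rule AE_I2, use w in force)
    then show ?thesis by (rule zero)
  next
    case 3
    then have "A * ennreal_powr B (q - 1) = top" by (auto simp: ennreal_mult_top ennreal_top_mult)
    then show ?thesis unfolding A_def B_def by (simp add: top_unique)
  next
    case 4
    then obtain a b where a: "A = ennreal a" "a > 0" and b: "B = ennreal b" "b > 0"
      by (metis ennreal_cases ennreal_0 order_le_less)
    define p where "p = q / (q - 1)"
    have p: "p > 1" "1 / q + 1 / p = 1" "q + p = q * p" "p * (q - 1) = q"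
      using q by (auto simp: p_def field_simps)
    \<comment> \<open>This value balances the two terms of Young's inequality: both become multiples
      of \<open>a powr (1 / q) * b powr (1 / p)\<close>, with coefficients \<open>1 / q\<close> and
      \<open>1 / p\<close> that add up to \<open>1\<close>.\<close>
    define l where "l = (b / a) powr (1 / (q * p))"
    have l: "l > 0" using a b by (simp add: l_def)
    have lq: "l powr q = (b / a) powr (1 / p)" and lp: "l powr (-p) = (b / a) powr (- (1 / q))"
      using q p by (auto simp: l_def powr_powr)
    have e: "- (1/p) + 1 = 1/q" "- (1/q) + 1 = 1/p" using p by auto
    have pt: "F x \<le> ennreal (l powr q / q) * (ennreal_powr (F x) q * ennreal (w x)) +
        ennreal (l powr (-p) / p) * ennreal (w x powr (- 1 / (q - 1)))" if "x \<in> space M" for x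
    proof (cases "F x")
      case (real f)
      have wx: "w x > 0" using w that by simp
      have "f = (f * (l * w x powr (1 / q))) * (1 / (l * w x powr (1 / q)))"
        using l wx by simp
      also have "\<dots> \<le> (f * (l * w x powr (1 / q))) powr q / q + (1 / (l * w x powr (1 / q))) powr p / p"
        using q p l wx real by (intro Youngs_inequality) auto
      also have "(f * (l * w x powr (1 / q))) powr q = l powr q * (f powr q * w x)"
        using q l wx real by (simp add: powr_mult powr_powr)
      also have "(1 / (l * w x powr (1 / q))) powr p = l powr (- p) * w x powr (- p / q)"
        using q l wx by (simp add: powr_divide powr_mult powr_powr powr_minus field_simps)
      also have "- p / q = - 1 / (q - 1)" using q by (simp add: p_def)
      finally have "f \<le> l powr q / q * (f powr q * w x) + l powr (- p) / p * w x powr (- 1 / (q - 1))"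
        by simp
      then show ?thesis using real q p wx
        by (simp flip: ennreal_mult ennreal_plus)
    next
      case top
      have "l powr q / q > 0" using q l by simp
      then have "ennreal (l powr q / q) \<noteq> 0" by (simp only: ennreal_eq_0_iff not_le)
      then show ?thesis using top w[OF that] by (simp add: ennreal_mult_top ennreal_top_mult ennreal_eq_0_iff)
    qed
    have "(\<integral>\<^sup>+x. F x \<partial>M) \<le> (\<integral>\<^sup>+x. ennreal (l powr q / q) * (ennreal_powr (F x) q * ennreal (w x)) +
        ennreal (l powr (-p) / p) * ennreal (w x powr (- 1 / (q - 1))) \<partial>M)"
      by (intro nn_integral_mono pt)
    also have "\<dots> = ennreal (l powr q / q) * A + ennreal (l powr (-p) / p) * B"
      unfolding A_def B_def by (subst nn_integral_add) (auto simp: nn_integral_cmult)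
    also have "\<dots> = ennreal (l powr q / q * a + l powr (-p) / p * b)"
      using a b q p by (simp flip: ennreal_mult ennreal_plus)
    also have "l powr q / q * a + l powr (-p) / p * b = a powr (1 / q) * b powr (1 / p)"
    proof -
      have "l powr q * a = b powr (1/p) * (a powr (- (1/p)) * a powr 1)"
        unfolding lq using a b by (simp add: powr_divide powr_minus field_simps)
      also have "a powr (- (1/p)) * a powr 1 = a powr (1 / q)"
        by (simp only: powr_add[symmetric] e)
      finally have 1: "l powr q * a = a powr (1 / q) * b powr (1 / p)" by simp
      have "l powr (-p) * b = a powr (1/q) * (b powr (- (1/q)) * b powr 1)"
        unfolding lp using a b by (simp add: powr_divide powr_minus divide_simps)
      also have "b powr (- (1/q)) * b powr 1 = b powr (1 / p)"
        by (simp only: powr_add[symmetric] e)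
      finally have 2: "l powr (-p) * b = a powr (1 / q) * b powr (1 / p)" by simp
      have "l powr q / q * a + l powr (-p) / p * b = (l powr q * a) * (1/q) + (l powr (-p) * b) * (1/p)" by simp
      also have "\<dots> = a powr (1 / q) * b powr (1 / p) * (1/q + 1/p)" unfolding 1 2 by (simp add: algebra_simps)
      finally show ?thesis using p by simp
    qed
    finally have "ennreal_powr (\<integral>\<^sup>+x. F x \<partial>M) q \<le> ennreal_powr (ennreal (a powr (1 / q) * b powr (1 / p))) q"
      using q by (intro ennreal_powr_mono) auto
    also have "\<dots> = ennreal (a * b powr (q - 1))"
      using a b q by (simp add: powr_mult powr_powr p_def)
    also have "\<dots> = A * ennreal_powr B (q - 1)"
      using a b by (simp add: ennreal_mult)
    finally show ?thesis unfolding A_def B_def .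
  qed
qed

section \<open>Carleson squares\<close>

lemma Arg_of_real_mult_cis:
  assumes "0 < r" "\<bar>\<alpha>\<bar> < pi"
  shows "Arg (of_real r * cis \<alpha>) = \<alpha>"
  using assms by (intro Arg_unique[of r]) (auto simp: cis_conv_exp mult.commute)

lemma cis_Arg_of_real_mult_cis:
  assumes "0 < r"
  shows "cis (Arg (of_real r * cis \<alpha>)) = cis \<alpha>"
  using assms by (subst cis_Arg) (auto simp: sgn_mult sgn_of_real)

text \<open>The Carleson square at the point of modulus \<open>1 - t\<close> and argument
  \<open>\<theta>\<close>, described by its side and an unrestricted real angle. This avoids branch
  cuts when squares are halved and shifted.\<close>

definition polar_square :: "real \<Rightarrow> real \<Rightarrow> complex set" where
  "polar_square t \<theta> = {of_real r * cis \<phi> | r \<phi>. 1 - t < r \<and> r < 1 \<and> \<bar>\<phi> - \<theta>\<bar> < t / 2}"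

text \<open>\<open>Arg\<close> recovers the difference of the angles because
  \<open>t / 2 < pi\<close>; conversely \<open>\<phi>\<close> may be replaced by the angle
  \<open>\<theta> - \<alpha>\<close> with the same \<open>cis\<close>, where \<open>\<alpha>\<close>
  is the principal value.\<close>

lemma Carleson_square_polar:
  assumes "0 < t" "t < 1"
  shows "Carleson_square (of_real (1 - t) * cis \<theta>) = polar_square t \<theta>" (is "?L = ?R")
proof -
  have n: "cmod (of_real (1 - t) * cis \<theta>) = 1 - t"
    unfolding norm_mult norm_of_real norm_cis using assms by simp
  have eq: "of_real (1 - t) * cis \<theta> * cis (- \<phi>) = of_real (1 - t) * cis (\<theta> - \<phi>)" for \<phi>
    by (simp add: mult.assoc cis_mult)
  show ?thesis
  proof (intro equalityI subsetI)
    fix z assume "z \<in> ?L"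
    then obtain r \<phi> where z: "z = of_real r * cis \<phi>" "1 - t < r" "r < 1"
      and a: "\<bar>Arg (of_real (1 - t) * cis (\<theta> - \<phi>))\<bar> < t / 2"
      unfolding Carleson_square_def n eq by auto
    define \<alpha> where "\<alpha> = Arg (of_real (1 - t) * cis (\<theta> - \<phi>))"
    have "cis \<alpha> = cis (\<theta> - \<phi>)" unfolding \<alpha>_def using assms by (intro cis_Arg_of_real_mult_cis) auto
    then have "cis \<theta> / cis \<alpha> = cis \<theta> / cis (\<theta> - \<phi>)" by simp
    then have "cis (\<theta> - \<alpha>) = cis \<phi>" by (simp add: cis_divide)
    then have "z = of_real r * cis (\<theta> - \<alpha>)" using z by simp
    then show "z \<in> ?R" unfolding polar_square_def using z a unfolding \<alpha>_def[symmetric] by force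
  next
    fix z assume "z \<in> ?R"
    then obtain r \<phi> where z: "z = of_real r * cis \<phi>" "1 - t < r" "r < 1" "\<bar>\<phi> - \<theta>\<bar> < t / 2"
      unfolding polar_square_def by blast
    have z5: "\<bar>\<theta> - \<phi>\<bar> < t / 2" using z(4) by (simp only: abs_minus_commute)
    have "Arg (of_real (1 - t) * cis (\<theta> - \<phi>)) = \<theta> - \<phi>"
      using assms z5 pi_gt3 by (intro Arg_of_real_mult_cis) linarith+
    then have "\<bar>Arg (of_real (1 - t) * cis (\<theta> - \<phi>))\<bar> < t / 2" using z5 by simp
    then show "z \<in> ?L" unfolding Carleson_square_def n eq using z by auto
  qed
qed

lemma polar_squareI:
  assumes "z = of_real r * cis \<phi>" "1 - t < r" "r < 1" "\<phi> - \<theta> < t / 2" "\<theta> - \<phi> < t / 2"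
  shows "z \<in> polar_square t \<theta>"
proof -
  have "\<bar>\<phi> - \<theta>\<bar> < t / 2" using assms by linarith
  with assms show ?thesis unfolding polar_square_def by blast
qed

lemma polar_squareD:
  assumes "z \<in> polar_square t \<theta>" "t < 1"
  shows "\<exists>r \<phi>. z = of_real r * cis \<phi> \<and> 1 - t < r \<and> r < 1 \<and> \<phi> - \<theta> < t / 2 \<and> \<theta> - \<phi> < t / 2 \<and> cmod z = r"
proof -
  obtain r \<phi> where *: "z = of_real r * cis \<phi>" "1 - t < r" "r < 1" "\<bar>\<phi> - \<theta>\<bar> < t / 2"
    using assms(1) unfolding polar_square_def by blast
  have "\<phi> - \<theta> < t / 2" "\<theta> - \<phi> < t / 2" using *(4) by linarith+
  moreover have "cmod z = r" using * assms(2) by (simp add: norm_mult)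
  ultimately show ?thesis using * by blast
qed

text \<open>The square is the image under \<open>exp\<close> of an open rectangle of height
  \<open>t < 2 * pi\<close>, on which \<open>exp\<close> is injective; the open mapping theorem
  applies.\<close>

lemma open_polar_square:
  assumes "0 < t" "t < 1"
  shows "open (polar_square t \<theta>)"
proof -
  define R where "R = {\<zeta>. ln (1 - t) < Re \<zeta> \<and> Re \<zeta> < 0 \<and> \<theta> - t / 2 < Im \<zeta> \<and> Im \<zeta> < \<theta> + t / 2}"
  have eq: "polar_square t \<theta> = exp ` R"
  proof (intro equalityI subsetI)
    fix z assume zz: "z \<in> polar_square t \<theta>"
    then obtain r \<phi> where z: "z = of_real r * cis \<phi>" "1 - t < r" "r < 1" "\<phi> - \<theta> < t / 2" "\<theta> - \<phi> < t / 2"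
      using polar_squareD[OF zz assms(2)] by blast
    have "z = exp (Complex (ln r) \<phi>)" using z assms by (simp add: exp_eq_polar)
    moreover have "Complex (ln r) \<phi> \<in> R" using z assms by (auto simp: R_def)
    ultimately show "z \<in> exp ` R" by blast
  next
    fix z assume "z \<in> exp ` R"
    then obtain \<zeta> where \<zeta>: "\<zeta> \<in> R" "z = exp \<zeta>" by blast
    have "1 - t < exp (Re \<zeta>)" using \<zeta> assms exp_less_mono[of "ln (1 - t)" "Re \<zeta>"] by (simp add: R_def)
    then show "z \<in> polar_square t \<theta>" using \<zeta>
      by (intro polar_squareI[of _ "exp (Re \<zeta>)" "Im \<zeta>"]) (auto simp: R_def exp_eq_polar exp_of_real)
  qed
  have "R = {\<zeta>. ln (1 - t) < Re \<zeta>} \<inter> {\<zeta>. Re \<zeta> < 0} \<inter> {\<zeta>. \<theta> - t / 2 < Im \<zeta>} \<inter> {\<zeta>. Im \<zeta> < \<theta> + t / 2}"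
    by (auto simp: R_def)
  then have "open R"
    by (auto intro!: open_Int open_halfspace_Re_gt open_halfspace_Re_lt open_halfspace_Im_gt open_halfspace_Im_lt)
  moreover have "inj_on exp R"
  proof (rule inj_onI)
    fix x y assume xy: "x \<in> R" "y \<in> R" "exp x = exp y"
    have "\<bar>Im x - Im y\<bar> < 2 * pi" using xy(1,2) assms pi_gt3 unfolding R_def mem_Collect_eq by linarith
    then show "x = y" using xy(3) by (rule exp_complex_eqI)
  qed
  ultimately show ?thesis unfolding eq by (intro open_mapping_thm3) (auto intro: holomorphic_intros)
qed

lemma polar_square_borel [measurable]:
  "0 < t \<Longrightarrow> t < 1 \<Longrightarrow> polar_square t \<theta> \<in> sets borel"
  by (simp add: borel_open open_polar_square)

lemma polar_square_subset_disc: "t < 1 \<Longrightarrow> polar_square t \<theta> \<subseteq> \<bbbD>"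
proof
  fix z assume "t < 1" "z \<in> polar_square t \<theta>"
  then obtain r where "r < 1" "cmod z = r" using polar_squareD[of z t \<theta>] by blast
  then show "z \<in> \<bbbD>" by simp
qed

lemma cis_eq_imp_eq:
  assumes "cis \<phi> = cis \<psi>" "\<bar>\<phi> - \<psi>\<bar> < 2 * pi"
  shows "\<phi> = \<psi>"
proof -
  have "Complex 0 \<phi> = Complex 0 \<psi>"
  proof (rule exp_complex_eqI)
    show "exp (Complex 0 \<phi>) = exp (Complex 0 \<psi>)" by (simp only: exp_eq_polar complex.sel assms(1))
  qed (use assms(2) in simp)
  then show ?thesis by simp
qed

text \<open>The part of the square on which \<open>1 - |z|\<close> is comparable to
  \<open>t\<close>.\<close>

definition top_half :: "real \<Rightarrow> real \<Rightarrow> complex set" where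
  "top_half t \<theta> = polar_square t \<theta> \<inter> {z. cmod z \<le> 1 - t / 2}"

lemma top_half_borel [measurable]: "0 < t \<Longrightarrow> t < 1 \<Longrightarrow> top_half t \<theta> \<in> sets borel"
proof -
  assume "0 < t" "t < 1"
  moreover have "{z. cmod z \<le> 1 - t / 2} = cball 0 (1 - t / 2)" by auto
  ultimately show ?thesis unfolding top_half_def by (intro sets.Int polar_square_borel) auto
qed

lemma half_less_1: "t < 1 \<Longrightarrow> t / 2 < (1::real)"
  by simp

lemma polar_square_halves_subset:
  assumes "0 < t" "t < 1"
  shows "top_half t \<theta> \<union> (polar_square (t/2) (\<theta> - t/4) \<union> polar_square (t/2) (\<theta> + t/4)) \<subseteq> polar_square t \<theta>"
proof -
  have "polar_square (t/2) (\<theta> + s) \<subseteq> polar_square t \<theta>" if s: "\<bar>s\<bar> \<le> t / 4" for s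
  proof
    fix z assume zz: "z \<in> polar_square (t/2) (\<theta> + s)"
    then obtain r \<phi> where "z = of_real r * cis \<phi>" "1 - t/2 < r" "r < 1"
      "\<phi> - (\<theta> + s) < t/2/2" "(\<theta> + s) - \<phi> < t/2/2"
      using polar_squareD[OF zz half_less_1[OF assms(2)]] by blast
    moreover have "s \<le> t/4" "- s \<le> t/4" using s by linarith+
    ultimately show "z \<in> polar_square t \<theta>" using assms by (intro polar_squareI[of z r \<phi>]) (assumption | linarith)+
  qed
  from this[of "- t/4"] this[of "t/4"]
  have "polar_square (t/2) (\<theta> - t/4) \<subseteq> polar_square t \<theta>" "polar_square (t/2) (\<theta> + t/4) \<subseteq> polar_square t \<theta>"
    using assms by simp_all
  then show ?thesis unfolding top_half_def by blast
qed

lemma polar_square_halves_disjoint: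
  assumes "0 < t" "t < 1"
  shows "polar_square (t/2) (\<theta> - t/4) \<inter> polar_square (t/2) (\<theta> + t/4) = {}"
    and "top_half t \<theta> \<inter> (polar_square (t/2) (\<theta> - t/4) \<union> polar_square (t/2) (\<theta> + t/4)) = {}"
proof -
  show "polar_square (t/2) (\<theta> - t/4) \<inter> polar_square (t/2) (\<theta> + t/4) = {}"
  proof (rule ccontr)
    assume "\<not> ?thesis"
    then obtain z where z: "z \<in> polar_square (t/2) (\<theta> - t/4)" "z \<in> polar_square (t/2) (\<theta> + t/4)" by blast
    from z(1) obtain r \<phi> where 1: "z = of_real r * cis \<phi>" "1 - t/2 < r" "\<phi> - (\<theta> - t/4) < t/2/2" "(\<theta> - t/4) - \<phi> < t/2/2" "cmod z = r"
      using polar_squareD[OF z(1) half_less_1[OF assms(2)]] by blast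
    from z(2) obtain r' \<psi> where 2: "z = of_real r' * cis \<psi>" "1 - t/2 < r'" "\<psi> - (\<theta> + t/4) < t/2/2" "(\<theta> + t/4) - \<psi> < t/2/2" "cmod z = r'"
      using polar_squareD[OF z(2) half_less_1[OF assms(2)]] by blast
    have "cis \<phi> = cis \<psi>" using 1 2 assms by auto
    then have "\<phi> = \<psi>" using 1 2 assms pi_gt3 by (intro cis_eq_imp_eq) linarith+
    then show False using 1 2 by linarith
  qed
  show "top_half t \<theta> \<inter> (polar_square (t/2) (\<theta> - t/4) \<union> polar_square (t/2) (\<theta> + t/4)) = {}"
  proof -
    have "cmod z > 1 - t/2" if "z \<in> polar_square (t/2) \<psi>" for z \<psi>
      using polar_squareD[OF that half_less_1[OF assms(2)]] by auto
    then show ?thesis unfolding top_half_def by fastforce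
  qed
qed

text \<open>This is the whole line through \<open>0\<close> in the direction
  \<open>\<theta>\<close>. It contains the radius between the two half squares, which these open
  sets miss, and it is still a null set.\<close>

definition ray :: "real \<Rightarrow> complex set" where
  "ray \<theta> = {z. Im (z * cis (-\<theta>)) = 0}"

lemma ray_null: "ray \<theta> \<in> null_sets lborel"
proof -
  define a where "a = Complex (- sin \<theta>) (cos \<theta>)"
  have "sin \<theta> \<noteq> 0 \<or> cos \<theta> \<noteq> 0" using sin_zero_abs_cos_one[of \<theta>] by auto
  then have "a \<noteq> 0" unfolding a_def by (auto simp: complex_eq_iff)
  have "ray \<theta> = {z. a \<bullet> z = 0}"
    by (auto simp: ray_def a_def inner_complex_def algebra_simps)
  then have "negligible (ray \<theta>)" using negligible_hyperplane \<open>a \<noteq> 0\<close> by metis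
  then have "ray \<theta> \<in> null_sets lebesgue" by (simp add: negligible_iff_null_sets)
  moreover have "closed (ray \<theta>)" unfolding ray_def by (intro closed_Collect_eq continuous_intros)
  ultimately show ?thesis
    by (simp add: null_sets_def borel_closed)
qed

lemma polar_square_halves_cover:
  assumes "0 < t" "t < 1"
  shows "polar_square t \<theta> \<subseteq> top_half t \<theta> \<union> (polar_square (t/2) (\<theta> - t/4) \<union> polar_square (t/2) (\<theta> + t/4)) \<union> ray \<theta>"
proof
  fix z assume z: "z \<in> polar_square t \<theta>"
  then obtain r \<phi> where 1: "z = of_real r * cis \<phi>" "1 - t < r" "r < 1" "\<phi> - \<theta> < t/2" "\<theta> - \<phi> < t/2" "cmod z = r"
    using polar_squareD[OF z assms(2)] by blast
  consider "r \<le> 1 - t/2" | "r > 1 - t/2" "\<phi> < \<theta>" | "r > 1 - t/2" "\<phi> > \<theta>" | "\<phi> = \<theta>" by linarith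
  then show "z \<in> top_half t \<theta> \<union> (polar_square (t/2) (\<theta> - t/4) \<union> polar_square (t/2) (\<theta> + t/4)) \<union> ray \<theta>"
  proof cases
    case 1 then show ?thesis using z \<open>cmod z = r\<close> by (auto simp: top_half_def)
  next
    case 2 
    then have "z \<in> polar_square (t/2) (\<theta> - t/4)" using 1 by (intro polar_squareI[of _ r \<phi>]) auto
    then show ?thesis by blast
  next
    case 3
    then have "z \<in> polar_square (t/2) (\<theta> + t/4)" using 1 by (intro polar_squareI[of _ r \<phi>]) auto
    then show ?thesis by blast
  next
    case 4
    then show ?thesis using 1 by (auto simp: ray_def mult.assoc cis_mult)
  qed
qed

lemma cmod_cis_diff_le: "cmod (cis \<phi> - cis \<theta>) \<le> \<bar>\<phi> - \<theta>\<bar>"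
proof -
  have "cis \<phi> - cis \<theta> = cis \<theta> * (cis (\<phi> - \<theta>) - 1)" by (simp add: algebra_simps cis_mult)
  then have "cmod (cis \<phi> - cis \<theta>) = cmod (cis (\<phi> - \<theta>) - 1)" by (simp add: norm_mult)
  also have "\<dots> = 2 * \<bar>sin ((\<phi> - \<theta>) / 2)\<bar>" 
    using dist_exp_i_1[of "\<phi> - \<theta>"] by (simp add: cis_conv_exp)
  also have "\<dots> \<le> 2 * \<bar>(\<phi> - \<theta>) / 2\<bar>" using abs_sin_x_le_abs_x[of "(\<phi> - \<theta>) / 2"] by (intro mult_left_mono) simp_all
  finally show ?thesis by simp
qed

text \<open>The square lies in a disc of radius \<open>2 t\<close>, whose area is at most
  \<open>4 (2 t)^2\<close>.\<close>

lemma polar_square_measure_le: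
  assumes "0 < t" "t < 1"
  shows "measure lebesgue (polar_square t \<theta>) \<le> 16 * t\<^sup>2"
proof -
  have "polar_square t \<theta> \<subseteq> cball (of_real (1 - t) * cis \<theta>) (2 * t)"
  proof
    fix z assume zz: "z \<in> polar_square t \<theta>"
    then obtain r \<phi> where z: "z = of_real r * cis \<phi>" "1 - t < r" "r < 1" "\<phi> - \<theta> < t/2" "\<theta> - \<phi> < t/2" "cmod z = r"
      using polar_squareD[OF zz assms(2)] by blast
    have cis_le: "cmod (cis \<phi> - cis \<theta>) \<le> t / 2" using cmod_cis_diff_le[of \<phi> \<theta>] z by linarith
    have "z - of_real (1 - t) * cis \<theta> = of_real (r - (1 - t)) * cis \<theta> + of_real r * (cis \<phi> - cis \<theta>)"
      using z by (simp add: algebra_simps)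
    then have "cmod (z - of_real (1 - t) * cis \<theta>) \<le> cmod (of_real (r - (1 - t)) * cis \<theta>) + cmod (of_real r * (cis \<phi> - cis \<theta>))"
      using norm_triangle_ineq by metis
    also have "\<dots> = \<bar>r - (1 - t)\<bar> + \<bar>r\<bar> * cmod (cis \<phi> - cis \<theta>)"
      unfolding norm_mult norm_of_real by simp
    also have "\<dots> \<le> t + 1 * (t / 2)"
      using z assms cis_le by (intro add_mono mult_mono) auto
    finally show "z \<in> cball (of_real (1 - t) * cis \<theta>) (2 * t)" using assms by (simp add: dist_norm norm_minus_commute)
  qed
  then have "measure lebesgue (polar_square t \<theta>) \<le> measure lebesgue (cball (of_real (1 - t) * cis \<theta>) (2 * t))"
    using assms by (intro measure_mono_fmeasurable) (auto intro: open_polar_square)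
  also have "\<dots> = pi * (2 * t)\<^sup>2" using assms by (simp add: content_cball unit_ball_vol_2)
  also have "\<dots> \<le> 4 * (2 * t)\<^sup>2" using pi_less_4 by (intro mult_right_mono) auto
  finally show ?thesis by (simp add: power_mult_distrib)
qed

lemma abs_Arg_less:
  assumes "\<bar>Im w\<bar> < k * Re w" "0 < Re w"
  shows "\<bar>Arg w\<bar> < k"
proof -
  have "\<bar>Arg w\<bar> = \<bar>arctan (Im w / Re w)\<bar>" using arg_conv_arctan[OF assms(2)] by simp
  also have "\<dots> \<le> \<bar>Im w / Re w\<bar>" by (rule abs_arctan_le)
  also have "\<dots> = \<bar>Im w\<bar> / Re w" using assms by simp
  also have "\<dots> < k" using assms by (simp add: field_simps)
  finally show ?thesis .
qed

text \<open>The centre is at the radial middle of the top half, between \<open>1 - t\<close> and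
  \<open>1 - t / 2\<close>. After a rotation to \<open>\<theta> = 0\<close> the real part stays
  above \<open>3/16\<close>, so an imaginary part below \<open>t / 16\<close> keeps the angle below
  \<open>t / 2\<close>.\<close>

lemma top_half_ball:
  assumes "0 < t" "t < 1"
  shows "ball (of_real (1 - 3 * t / 4) * cis \<theta>) (t / 16) \<subseteq> top_half t \<theta>"
proof
  fix z assume z: "z \<in> ball (of_real (1 - 3 * t / 4) * cis \<theta>) (t / 16)"
  define w where "w = z * cis (- \<theta>)"
  have zw: "z = w * cis \<theta>" by (simp add: w_def mult.assoc cis_mult)
  have "z - of_real (1 - 3 * t / 4) * cis \<theta> = (w - of_real (1 - 3 * t / 4)) * cis \<theta>"
    by (simp add: zw algebra_simps)
  then have w: "cmod (w - of_real (1 - 3 * t / 4)) < t / 16"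
    using z by (simp add: dist_norm norm_minus_commute norm_mult)
  have re: "\<bar>Re w - (1 - 3 * t / 4)\<bar> < t / 16" and im: "\<bar>Im w\<bar> < t / 16"
    using w abs_Re_le_cmod[of "w - of_real (1 - 3 * t / 4)"] abs_Im_le_cmod[of "w - of_real (1 - 3 * t / 4)"] by auto
  have rw: "Re w > 3/16" using re assms by linarith
  have "t / 2 * (3/16) \<le> t / 2 * Re w" using rw assms by (intro mult_left_mono) auto
  then have "\<bar>Im w\<bar> < t / 2 * Re w" using im assms by linarith
  then have a: "\<bar>Arg w\<bar> < t / 2" using rw by (intro abs_Arg_less) auto
  have nw: "\<bar>cmod w - (1 - 3 * t / 4)\<bar> < t / 16"
  proof -
    have "\<bar>cmod w - cmod (of_real (1 - 3 * t / 4))\<bar> \<le> cmod (w - of_real (1 - 3 * t / 4))"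
      by (rule norm_triangle_ineq3)
    moreover have "cmod (of_real (1 - 3 * t / 4)) = 1 - 3 * t / 4"
      unfolding norm_of_real using assms by simp
    ultimately show ?thesis using w by linarith
  qed
  have w0: "w \<noteq> 0" using rw by auto
  have "w = of_real (cmod w) * cis (Arg w)" using w0 by (simp add: cis_Arg sgn_eq)
  then have "z = of_real (cmod w) * cis (\<theta> + Arg w)" by (metis zw cis_mult mult.assoc mult.commute)
  then have "z \<in> polar_square t \<theta>" using nw a assms by (intro polar_squareI) (assumption | linarith)+
  moreover have "cmod z = cmod w" by (simp add: zw norm_mult)
  ultimately show "z \<in> top_half t \<theta>" using nw assms unfolding top_half_def by (simp; linarith)
qed

text \<open>For \<open>s \<le> 1/16\<close> the point rotated by \<open>- Arg w\<close> has real
  part above \<open>1/2\<close>, so an imaginary part below \<open>2 s\<close> means an angle below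
  \<open>4 s\<close>, half the side of the square. This is why the dyadic scales below start at
  \<open>(1/2) ^ 4\<close>.\<close>

lemma near_points_polar_square:
  assumes "cmod (y - w) < 2 * s" "1 - cmod y < s" "1 - cmod w < s" "0 < s" "s \<le> 1/16" "cmod y < 1"
  shows "y \<in> polar_square (8 * s) (Arg w)"
proof -
  have "w \<noteq> 0" using assms by auto
  define x where "x = y * cis (- Arg w)"
  have wA: "w = of_real (cmod w) * cis (Arg w)" using \<open>w \<noteq> 0\<close> by (simp add: cis_Arg sgn_eq)
  have yx: "y = x * cis (Arg w)" by (simp add: x_def mult.assoc cis_mult)
  have "y - w = (x - of_real (cmod w)) * cis (Arg w)" using wA yx by (metis left_diff_distrib)
  then have x: "cmod (x - of_real (cmod w)) < 2 * s" using assms(1) by (simp add: norm_mult)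
  have re: "\<bar>Re x - cmod w\<bar> < 2 * s" and im: "\<bar>Im x\<bar> < 2 * s"
    using x abs_Re_le_cmod[of "x - of_real (cmod w)"] abs_Im_le_cmod[of "x - of_real (cmod w)"] by auto
  have rx: "Re x > 1/2" using re assms by linarith
  have "4 * s * (1/2) \<le> 4 * s * Re x" using rx assms by (intro mult_left_mono) auto
  then have "\<bar>Im x\<bar> < 4 * s * Re x" using im by linarith
  then have a: "\<bar>Arg x\<bar> < 4 * s" using rx by (intro abs_Arg_less) auto
  have "x \<noteq> 0" using rx by auto
  then have "x = of_real (cmod x) * cis (Arg x)" by (simp add: cis_Arg sgn_eq)
  then have "y = of_real (cmod x) * cis (Arg w + Arg x)" by (metis yx cis_mult mult.assoc mult.commute)
  moreover have "cmod x = cmod y" by (simp add: yx norm_mult)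
  ultimately show ?thesis using a assms by (intro polar_squareI[of _ "cmod y" "Arg w + Arg x"]) (simp; linarith)+
qed

text \<open>Rounding \<open>4 * Arg z\<close> leaves an angular error of at most \<open>1/8\<close>,
  below the angular half width \<open>1/4\<close> of the squares; \<open>4 * |Arg z| < 16\<close>
  bounds their number.\<close>

lemma annulus_subset_polar_squares:
  "{z. 1/2 < cmod z \<and> cmod z < 1} \<subseteq> (\<Union>j\<in>{-16..16::int}. polar_square (1/2) (real_of_int j / 4))"
proof
  fix z assume z: "z \<in> {z. 1/2 < cmod z \<and> cmod z < 1}"
  define j where "j = round (4 * Arg z)"
  have j: "\<bar>Arg z - real_of_int j / 4\<bar> < 1/4"
    using of_int_round_abs_le[of "4 * Arg z"] unfolding j_def by linarith
  have "\<bar>Arg z\<bar> < 4" using Arg_bounded[of z] pi_less_4 by linarith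
  then have "\<bar>real_of_int j\<bar> < 17" using j by linarith
  then have "j \<in> {-16..16}" by auto
  moreover have "z \<in> polar_square (1/2) (real_of_int j / 4)"
  proof (rule polar_squareI)
    have "z \<noteq> 0" using z by auto
    then show "z = of_real (cmod z) * cis (Arg z)" by (simp add: cis_Arg sgn_eq)
  qed (use z j in \<open>(simp; linarith)+\<close>)
  ultimately show "z \<in> (\<Union>j\<in>{-16..16::int}. polar_square (1/2) (real_of_int j / 4))" by blast
qed

section \<open>The Berezin transform in weighted spaces\<close>

lemma set_nn_integral_Holder:
  fixes F :: "'a \<Rightarrow> ennreal" and w :: "'a \<Rightarrow> real"
  assumes q: "1 < q" and [measurable]: "F \<in> borel_measurable M" "w \<in> borel_measurable M" "E \<in> sets M"
    and w: "\<And>x. x \<in> space M \<Longrightarrow> 0 < w x"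
  shows "ennreal_powr (\<integral>\<^sup>+x\<in>E. F x \<partial>M) q \<le>
    (\<integral>\<^sup>+x\<in>E. ennreal_powr (F x) q * ennreal (w x) \<partial>M) *
    ennreal_powr (\<integral>\<^sup>+x\<in>E. ennreal (w x powr (- 1 / (q - 1))) \<partial>M) (q - 1)"
  using nn_integral_Holder[of q F "density M (indicator E)" w] q w
  by (simp add: nn_integral_density mult.commute)

lemma nn_integral_top_half_halves_le:
  fixes u :: "complex \<Rightarrow> ennreal"
  assumes [measurable]: "u \<in> borel_measurable borel" and t: "0 < t" "t < 1"
  shows "(\<integral>\<^sup>+z\<in>top_half t \<theta>. u z \<partial>lborel) +
    ((\<integral>\<^sup>+z\<in>polar_square (t/2) (\<theta> - t/4). u z \<partial>lborel) +
     (\<integral>\<^sup>+z\<in>polar_square (t/2) (\<theta> + t/4). u z \<partial>lborel)) \<le> (\<integral>\<^sup>+z\<in>polar_square t \<theta>. u z \<partial>lborel)"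
proof -
  let ?T = "top_half t \<theta>" and ?A = "polar_square (t/2) (\<theta> - t/4)" and ?B = "polar_square (t/2) (\<theta> + t/4)"
  have [measurable]: "?T \<in> sets borel" "?A \<in> sets borel" "?B \<in> sets borel" using t by auto
  have "indicator ?T z + (indicator ?A z + indicator ?B z) \<le> (indicator (polar_square t \<theta>) z :: ennreal)" for z
    using polar_square_halves_subset[OF t, of \<theta>] polar_square_halves_disjoint[OF t, of \<theta>]
    by (auto simp: indicator_def)
  then have "u z * (indicator ?T z + (indicator ?A z + indicator ?B z)) \<le> u z * indicator (polar_square t \<theta>) z" for z
    by (intro mult_left_mono) auto
  then have "(\<integral>\<^sup>+z. u z * indicator ?T z + (u z * indicator ?A z + u z * indicator ?B z) \<partial>lborel) \<le>
      (\<integral>\<^sup>+z\<in>polar_square t \<theta>. u z \<partial>lborel)"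
    by (intro nn_integral_mono) (simp add: distrib_left)
  then show ?thesis by (simp add: nn_integral_add)
qed

text \<open>
  The halves of a square carry at most the proportion \<open>1 - 1 / L\<close> of its mass, so the mass decays
  geometrically towards the unit circle.
\<close>

lemma nn_integral_dist_powr_polar_square_le:
  fixes u :: "complex \<Rightarrow> ennreal"
  assumes [measurable]: "u \<in> borel_measurable borel"
    and L: "1 \<le> L" and e: "0 < e" "2 powr e * (2 - 1 / L) \<le> 2"
    and double: "\<And>t \<theta>. 0 < t \<Longrightarrow> t < 1 \<Longrightarrow>
      (\<integral>\<^sup>+z\<in>polar_square t \<theta>. u z \<partial>lborel) \<le> ennreal L * (\<integral>\<^sup>+z\<in>top_half t \<theta>. u z \<partial>lborel)"
    and fin: "\<And>t \<theta>. 0 < t \<Longrightarrow> t < 1 \<Longrightarrow> (\<integral>\<^sup>+z\<in>polar_square t \<theta>. u z \<partial>lborel) < top"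
    and t: "0 < t" "t < 1"
  shows "(\<integral>\<^sup>+z\<in>polar_square t \<theta>. ennreal ((1 - cmod z) powr (-e)) * u z \<partial>lborel) \<le>
    ennreal (2 * t powr (-e)) * (\<integral>\<^sup>+z\<in>polar_square t \<theta>. u z \<partial>lborel)"
proof -
  \<comment> \<open>Truncation to points at distance more than \<open>t / 2 ^ n\<close> from the
    circle: the induction on \<open>n\<close> starts from an empty set, and passing to a half square
    lowers \<open>n\<close> by one because \<open>t\<close> is halved as well.\<close>
  define B where "B t n = {z. 1 - cmod z > t / 2 ^ n}" for t :: real and n :: nat
  have openB: "open (B t n)" for t n unfolding B_def by (intro open_Collect_less continuous_intros)
  then have [measurable]: "B t n \<in> sets borel" for t n by simp
  have *: "(\<integral>\<^sup>+z\<in>polar_square t \<theta> \<inter> B t n. ennreal ((1 - cmod z) powr (-e)) * u z \<partial>lborel) \<le>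
      ennreal (2 * t powr (-e)) * (\<integral>\<^sup>+z\<in>polar_square t \<theta>. u z \<partial>lborel)"
    if t: "0 < t" "t < 1" for n t \<theta>
    using that
  proof (induction n arbitrary: t \<theta>)
    case 0
    have "polar_square t \<theta> \<inter> B t 0 = {}"
    proof -
      have "z \<notin> B t 0" if "z \<in> polar_square t \<theta>" for z using polar_squareD[OF that 0(2)] by (auto simp: B_def)
      then show ?thesis by blast
    qed
    then show ?case by simp
  next
    case (Suc n)
    let ?T = "top_half t \<theta>" and ?A = "polar_square (t/2) (\<theta> - t/4)" and ?B = "polar_square (t/2) (\<theta> + t/4)"
    let ?I = "\<lambda>S. (\<integral>\<^sup>+z\<in>S. u z \<partial>lborel)" and ?J = "\<lambda>S. (\<integral>\<^sup>+z\<in>S. ennreal ((1 - cmod z) powr (-e)) * u z \<partial>lborel)"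
    have t: "0 < t" "t < 1" "0 < t/2" "t/2 < 1" using Suc by auto
    have [measurable]: "?T \<in> sets borel" "?A \<in> sets borel" "?B \<in> sets borel" "polar_square t \<theta> \<in> sets borel" using t by auto
    have BB: "B t (Suc n) = B (t/2) n" by (simp add: B_def)
    have ind: "(indicator (polar_square t \<theta> \<inter> B t (Suc n)) z :: ennreal) \<le>
       indicator ?T z + (indicator (?A \<inter> B (t/2) n) z + indicator (?B \<inter> B (t/2) n) z)" if "z \<notin> ray \<theta>" for z
      using polar_square_halves_cover[OF t(1,2), of \<theta>] that unfolding BB by (auto simp: indicator_def)
    have "?J (polar_square t \<theta> \<inter> B t (Suc n)) \<le>
       (\<integral>\<^sup>+z. (ennreal ((1 - cmod z) powr (-e)) * u z) * indicator ?T z +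
         ((ennreal ((1 - cmod z) powr (-e)) * u z) * indicator (?A \<inter> B (t/2) n) z +
          (ennreal ((1 - cmod z) powr (-e)) * u z) * indicator (?B \<inter> B (t/2) n) z) \<partial>lborel)"
    proof (rule nn_integral_mono_AE)
      show "AE z in lborel. ennreal ((1 - cmod z) powr (-e)) * u z * indicator (polar_square t \<theta> \<inter> B t (Suc n)) z \<le>
         (ennreal ((1 - cmod z) powr (-e)) * u z) * indicator ?T z +
         ((ennreal ((1 - cmod z) powr (-e)) * u z) * indicator (?A \<inter> B (t/2) n) z +
          (ennreal ((1 - cmod z) powr (-e)) * u z) * indicator (?B \<inter> B (t/2) n) z)"
        using AE_not_in[OF ray_null[of \<theta>]]
      proof eventually_elim
        case (elim z)
        show ?case using mult_left_mono[OF ind[OF elim], of "ennreal ((1 - cmod z) powr (-e)) * u z"]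
          by (simp add: distrib_left)
      qed
    qed
    also have "\<dots> = ?J ?T + (?J (?A \<inter> B (t/2) n) + ?J (?B \<inter> B (t/2) n))"
      by (simp add: nn_integral_add)
    also have "\<dots> \<le> ennreal ((t/2) powr (-e)) * ?I ?T +
       (ennreal (2 * (t/2) powr (-e)) * ?I ?A + ennreal (2 * (t/2) powr (-e)) * ?I ?B)"
    proof (intro add_mono Suc.IH t(3,4))
      have "?J ?T \<le> (\<integral>\<^sup>+z. ennreal ((t/2) powr (-e)) * (u z * indicator ?T z) \<partial>lborel)"
      proof (intro nn_integral_mono)
        fix z
        show "ennreal ((1 - cmod z) powr (-e)) * u z * indicator ?T z \<le> ennreal ((t/2) powr (-e)) * (u z * indicator ?T z)"
        proof (cases "z \<in> ?T")
          case True
          then have "t / 2 \<le> 1 - cmod z" by (auto simp: top_half_def)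
          then have "(1 - cmod z) powr (-e) \<le> (t/2) powr (-e)" using t e by (intro powr_mono2') auto
          then show ?thesis using True by (auto intro!: mult_right_mono ennreal_leI)
        qed simp
      qed
      then show "?J ?T \<le> ennreal ((t/2) powr (-e)) * ?I ?T" by (simp add: nn_integral_cmult)
    qed
    also have "\<dots> \<le> ennreal (2 * t powr (-e)) * ?I (polar_square t \<theta>)"
    proof -
      have le: "?I ?T + (?I ?A + ?I ?B) \<le> ?I (polar_square t \<theta>)"
        using t by (intro nn_integral_top_half_halves_le) auto
      have "?I (polar_square t \<theta>) \<noteq> top" using fin[of t \<theta>] t by auto
      then obtain s where s: "?I (polar_square t \<theta>) = ennreal s" "0 \<le> s" by (metis ennreal_cases)
      have nt: "?I ?T \<noteq> top" "?I ?A \<noteq> top" "?I ?B \<noteq> top" using le s by (auto simp: top_unique)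
      obtain x where x: "?I ?T = ennreal x" "0 \<le> x" using nt(1) by (metis ennreal_cases)
      obtain y where y: "?I ?A = ennreal y" "0 \<le> y" using nt(2) by (metis ennreal_cases)
      obtain y' where y': "?I ?B = ennreal y'" "0 \<le> y'" using nt(3) by (metis ennreal_cases)
      have 1: "x + (y + y') \<le> s" using le s x y y' by (simp flip: ennreal_plus)
      have 2: "s \<le> L * x" using double[of t \<theta>] t s x L by (simp flip: ennreal_mult)
      \<comment> \<open>Here \<open>s\<close> is the total mass, \<open>x\<close> that of the top
        half, \<open>y\<close> and \<open>y'\<close> those of the half squares, which carry the
        factor \<open>2\<close> of the induction hypothesis. The gain \<open>- x\<close> becomes the
        factor \<open>2 - 1 / L\<close> through \<open>s \<le> L * x\<close>, and \<open>e\<close>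
        is small enough for this factor to absorb \<open>2 powr e\<close>.\<close>
      have "x + 2 * y + 2 * y' \<le> 2 * s - x" using 1 by simp
      also have "\<dots> \<le> (2 - 1 / L) * s" using 2 L by (simp add: field_simps)
      finally have "2 powr e * (x + 2 * y + 2 * y') \<le> 2 powr e * ((2 - 1 / L) * s)" by (intro mult_left_mono) auto
      also have "\<dots> = (2 powr e * (2 - 1 / L)) * s" by simp
      also have "\<dots> \<le> 2 * s" using e s by (intro mult_right_mono) auto
      finally have "t powr (-e) * (2 powr e * (x + 2 * y + 2 * y')) \<le> t powr (-e) * (2 * s)" by (intro mult_left_mono) auto
      moreover have "(t/2) powr (-e) = t powr (-e) * 2 powr e" using t by (simp add: powr_divide powr_minus divide_simps)
      ultimately have "(t/2) powr (-e) * x + (2 * (t/2) powr (-e) * y + 2 * (t/2) powr (-e) * y') \<le> 2 * t powr (-e) * s"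
        by (simp add: algebra_simps)
      then show ?thesis unfolding s x y y' using s x y y' by (simp flip: ennreal_mult ennreal_plus)
    qed
    finally show ?case .
  qed
  have pt: "ennreal ((1 - cmod z) powr (-e)) * u z * indicator (polar_square t \<theta>) z =
      (SUP n. ennreal ((1 - cmod z) powr (-e)) * u z * indicator (polar_square t \<theta> \<inter> B t n) z)" (is "?l z = (SUP n. ?r n z)") for z
  proof (cases "z \<in> polar_square t \<theta>")
    case True
    then have "0 < 1 - cmod z" using polar_square_subset_disc[OF t(2), of \<theta>] by auto
    then obtain n where "t * (1/2) ^ n < 1 - cmod z" using real_arch_pow_inv[of "(1 - cmod z) / t" "1/2"] t
      by (auto simp: field_simps)
    then have "z \<in> B t n" by (simp add: B_def field_simps)
    then have "?l z = ?r n z" using True by simp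
    also have "\<dots> \<le> (SUP n. ?r n z)" by (rule SUP_upper) simp
    finally have "?l z \<le> (SUP n. ?r n z)" .
    moreover have "(SUP n. ?r n z) \<le> ?l z" by (intro SUP_least mult_left_mono) (auto simp: indicator_def)
    ultimately show ?thesis by (rule antisym)
  qed simp
  have "(\<integral>\<^sup>+z\<in>polar_square t \<theta>. ennreal ((1 - cmod z) powr (-e)) * u z \<partial>lborel) =
      (SUP n. \<integral>\<^sup>+z\<in>polar_square t \<theta> \<inter> B t n. ennreal ((1 - cmod z) powr (-e)) * u z \<partial>lborel)"
    unfolding pt
  proof (rule nn_integral_monotone_convergence_SUP)
    have "B t m \<subseteq> B t n" if "m \<le> n" for m n
    proof -
      have "t / 2 ^ n \<le> t / 2 ^ m" using t that by (intro divide_left_mono power_increasing) auto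
      then show ?thesis unfolding B_def by auto
    qed
    then have BS: "B t n \<subseteq> B t (Suc n)" for n by simp
    show "incseq (\<lambda>n z. ennreal ((1 - cmod z) powr (-e)) * u z * indicator (polar_square t \<theta> \<inter> B t n) z)"
      using BS by (intro incseq_SucI le_funI mult_left_mono) (auto simp: indicator_def subset_iff)
  qed (use t in measurable)
  also have "\<dots> \<le> ennreal (2 * t powr (-e)) * (\<integral>\<^sup>+z\<in>polar_square t \<theta>. u z \<partial>lborel)"
    by (intro SUP_least * t)
  finally show ?thesis .
qed

text \<open>A geometric sum of ratio \<open>2 powr (- b)\<close> is dominated by its largest term,
  which belongs to the smallest scale and is at most \<open>d powr (- b)\<close>.\<close>

lemma nn_integral_geometric_powr_le:
  assumes b: "0 < b" and d: "0 < d"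
  shows "(\<integral>\<^sup>+n. ennreal (((1/2) ^ (n + 4)) powr (- b)) \<partial>count_space {n. d < (1/2) ^ (n + 4)}) \<le>
    ennreal (1 / (1 - 2 powr (- b)) * d powr (- b))"
proof -
  define s where "s n = (1/2 :: real) ^ (n + 4)" for n :: nat
  define C where "C = 1 / (1 - 2 powr (- b))"
  have c1: "0 < 2 powr (- b)" "2 powr (- b) < 1" using b by (auto simp: powr_less_one)
  have C0: "C > 0" using c1 by (simp add: C_def)
  have "1 - 2 powr (- b) \<noteq> 0" using c1 by linarith
  then have "C * (1 - 2 powr (- b)) = 1" unfolding C_def by (metis nonzero_divide_eq_eq)
  \<comment> \<open>\<open>C\<close> is the fixed point of \<open>C * 2 powr (- b) + 1\<close>,
    which is exactly what the induction step of \<open>sum\<close> reproduces.\<close>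
  then have C: "C > 0" "C = C * 2 powr (- b) + 1" using C0 by (simp_all add: algebra_simps)
  have s0: "s n > 0" for n by (simp add: s_def)
  have sS: "s n powr (- b) = 2 powr (- b) * s (Suc n) powr (- b)" for n
  proof -
    have "s n = 2 * s (Suc n)" by (simp only: s_def add_Suc power_Suc)
    then show ?thesis using s0[of "Suc n"] by (simp add: powr_mult)
  qed
  have sum: "(\<Sum>n<Suc m. s n powr (- b)) \<le> C * s m powr (- b)" for m
  proof (induction m)
    case 0
    have "0 \<le> C * 2 powr (- b)" using C(1) by simp
    then have "1 \<le> C" using C(2) by linarith
    then have "1 * s 0 powr (- b) \<le> C * s 0 powr (- b)" by (intro mult_right_mono) auto
    then show ?case by simp
  next
    case (Suc m)
    have "(\<Sum>n<Suc (Suc m). s n powr (- b)) \<le> C * s m powr (- b) + s (Suc m) powr (- b)" using Suc by simp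
    also have "\<dots> = (C * 2 powr (- b) + 1) * s (Suc m) powr (- b)" by (simp add: sS[of m] algebra_simps)
    finally show ?case using C(2) by simp
  qed
  define J where "J = {n. d < s n}"
  obtain N where N': "(1/2) ^ N < d" using real_arch_pow_inv[of d "1/2"] d by auto
  have "s N \<le> (1/2) ^ N" unfolding s_def by (intro power_decreasing) auto
  then have N: "s N < d" using N' by linarith
  have dec: "s m \<le> s n" if "n \<le> m" for m n unfolding s_def using that by (intro power_decreasing) auto
  have Jsub: "J \<subseteq> {..<N}"
  proof
    fix n assume "n \<in> J"
    then have "s N < s n" using N by (simp add: J_def)
    then show "n \<in> {..<N}" using dec[of N n] by (cases "n < N") auto
  qed
  then have fin: "finite J" using finite_subset by blast
  have "(\<Sum>n\<in>J. s n powr (- b)) \<le> C * d powr (- b)"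
  proof (cases "J = {}")
    case True then show ?thesis using C by simp
  next
    case False
    define m where "m = Max J"
    have m: "m \<in> J" "\<And>n. n \<in> J \<Longrightarrow> n \<le> m" using fin False by (auto simp: m_def)
    then have "J \<subseteq> {..<Suc m}" by (auto simp: less_Suc_eq_le)
    then have "(\<Sum>n\<in>J. s n powr (- b)) \<le> (\<Sum>n<Suc m. s n powr (- b))" by (intro sum_mono2) auto
    also have "\<dots> \<le> C * s m powr (- b)" by (rule sum)
    also have "s m powr (- b) \<le> d powr (- b)" using m(1) d b by (intro powr_mono2') (auto simp: J_def)
    finally show ?thesis using C by simp
  qed
  then show ?thesis unfolding s_def[symmetric] C_def[symmetric] J_def[symmetric]
    using fin by (simp add: nn_integral_count_space_finite sum_ennreal ennreal_leI)
qed

text \<open>The weight is taken Borel, positive everywhere, and relative to Lebesgue measure. The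
  denominators \<open>|S|^2\<close>, of order \<open>t ^ 4\<close>, have moved to the right, where
  they occur to the total power \<open>1 + (q - 1) = q\<close>.\<close>

locale Bekolle_weight =
  fixes q K :: real and \<omega> :: "complex \<Rightarrow> real"
  assumes q: "1 < q" and K: "0 < K"
    and \<omega>_borel [measurable]: "\<omega> \<in> borel_measurable borel"
    and \<omega>_pos: "\<And>z. 0 < \<omega> z"
    and \<omega>_fin: "(\<integral>\<^sup>+z\<in>\<bbbD>. ennreal (\<omega> z) \<partial>lborel) < top"
    and Bq: "\<And>t \<theta>. 0 < t \<Longrightarrow> t < 1 \<Longrightarrow>
      (\<integral>\<^sup>+z\<in>polar_square t \<theta>. ennreal (\<omega> z * (1 - (cmod z)\<^sup>2) powr (2 * q)) \<partial>lborel) *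
      ennreal_powr (\<integral>\<^sup>+z\<in>polar_square t \<theta>. ennreal (\<omega> z powr (- 1 / (q - 1))) \<partial>lborel) (q - 1)
      \<le> ennreal (K * t powr (4 * q))"
begin

definition v :: "complex \<Rightarrow> ennreal" where
  "v z = ennreal (\<omega> z * (1 - (cmod z)\<^sup>2) powr (2 * q))"

text \<open>The dual weight for the exponent \<open>q\<close>: its \<open>q\<close>-th power times
  \<open>\<omega>\<close> is again \<open>\<sigma>\<close>.\<close>

definition \<sigma> :: "complex \<Rightarrow> ennreal" where
  "\<sigma> z = ennreal (\<omega> z powr (- 1 / (q - 1)))"

lemma v_measurable [measurable]: "v \<in> borel_measurable borel"
  unfolding v_def by measurable

lemma \<sigma>_measurable [measurable]: "\<sigma> \<in> borel_measurable borel"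
  unfolding \<sigma>_def by measurable

lemma v_le:
  assumes "z \<in> \<bbbD>"
  shows "v z \<le> ennreal (\<omega> z)"
proof -
  have "(cmod z)\<^sup>2 < 1" using assms by (simp add: abs_square_less_1)
  then have "(1 - (cmod z)\<^sup>2) powr (2 * q) \<le> 1" using q by (intro powr_le1) auto
  then show ?thesis unfolding v_def using \<omega>_pos[of z] by (intro ennreal_leI) (simp add: mult_left_le)
qed

text \<open>On the ball of radius \<open>t / 16\<close> inside the top half one has
  \<open>1 - |z|^2 \<ge> t / 2\<close>; with \<open>pi > 3\<close> this gives the constant
  \<open>(1/2)^2 * 3 * (1/16)^2 = 3 / 1024\<close>.\<close>

lemma nn_integral_top_half_ge:
  assumes t: "0 < t" "t < 1"
  shows "ennreal (3 / 1024 * t ^ 4) \<le> (\<integral>\<^sup>+z\<in>top_half t \<theta>. ennreal ((1 - (cmod z)\<^sup>2)\<^sup>2) \<partial>lborel)"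
proof -
  let ?b = "ball (of_real (1 - 3 * t / 4) * cis \<theta>) (t / 16)"
  have "3 / 1024 * t ^ 4 = (t/2)\<^sup>2 * (3 * (t / 16)\<^sup>2)" by (simp add: power_divide eval_nat_numeral)
  also have "\<dots> \<le> (t/2)\<^sup>2 * (pi * (t / 16)\<^sup>2)" using pi_gt3 by (intro mult_left_mono mult_right_mono) auto
  finally have "ennreal (3 / 1024 * t ^ 4) \<le> ennreal ((t/2)\<^sup>2) * ennreal (pi * (t / 16)\<^sup>2)"
    by (simp add: ennreal_leI flip: ennreal_mult)
  also have "ennreal (pi * (t / 16)\<^sup>2) = emeasure lborel ?b"
    using t by (simp add: emeasure_ball unit_ball_vol_2)
  also have "ennreal ((t/2)\<^sup>2) * emeasure lborel ?b = (\<integral>\<^sup>+z\<in>?b. ennreal ((t/2)\<^sup>2) \<partial>lborel)"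
    by (simp add: nn_integral_cmult_indicator)
  also have "\<dots> \<le> (\<integral>\<^sup>+z\<in>top_half t \<theta>. ennreal ((1 - (cmod z)\<^sup>2)\<^sup>2) \<partial>lborel)"
  proof (rule nn_integral_mono)
    fix z
    show "ennreal ((t/2)\<^sup>2) * indicator ?b z \<le> ennreal ((1 - (cmod z)\<^sup>2)\<^sup>2) * indicator (top_half t \<theta>) z"
    proof (cases "z \<in> ?b")
      case True
      then have T: "z \<in> top_half t \<theta>" using top_half_ball[OF t, of \<theta>] by blast
      then have "cmod z \<le> 1 - t/2" by (simp add: top_half_def)
      moreover have "(cmod z)\<^sup>2 \<le> cmod z * 1" unfolding power2_eq_square
        using calculation t by (intro mult_left_mono) auto
      ultimately have "t/2 \<le> 1 - (cmod z)\<^sup>2" by simp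
      then have "(t/2)\<^sup>2 \<le> (1 - (cmod z)\<^sup>2)\<^sup>2" using t by (intro power_mono) auto
      then show ?thesis using T True by (simp add: ennreal_leI)
    qed simp
  qed
  finally show ?thesis .
qed

text \<open>Hoelder's inequality for \<open>(1 - |z|^2)^2\<close>, whose \<open>q\<close>-th power
  times \<open>\<omega>\<close> is \<open>v\<close>. It reverses the bound \<open>Bq\<close>, and
  does so on the top half alone.\<close>

lemma top_half_product_ge:
  assumes t: "0 < t" "t < 1"
  shows "ennreal ((3 / 1024) powr q * t powr (4 * q)) \<le>
    (\<integral>\<^sup>+z\<in>top_half t \<theta>. v z \<partial>lborel) * ennreal_powr (\<integral>\<^sup>+z\<in>top_half t \<theta>. \<sigma> z \<partial>lborel) (q - 1)"
proof -
  have [measurable]: "top_half t \<theta> \<in> sets borel" using t by simp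
  have t4: "t ^ 4 = t powr 4" using t by simp
  have "(3 / 1024 * t ^ 4) powr q = (3 / 1024) powr q * t powr (4 * q)"
    unfolding t4 using t by (simp only: powr_mult powr_powr)
  then have "ennreal ((3 / 1024) powr q * t powr (4 * q)) = ennreal_powr (ennreal (3 / 1024 * t ^ 4)) q"
    using t by simp
  also have "\<dots> \<le> ennreal_powr (\<integral>\<^sup>+z\<in>top_half t \<theta>. ennreal ((1 - (cmod z)\<^sup>2)\<^sup>2) \<partial>lborel) q"
    using q by (intro ennreal_powr_mono nn_integral_top_half_ge t) auto
  also have "\<dots> \<le> (\<integral>\<^sup>+z\<in>top_half t \<theta>. ennreal_powr (ennreal ((1 - (cmod z)\<^sup>2)\<^sup>2)) q * ennreal (\<omega> z) \<partial>lborel) *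
    ennreal_powr (\<integral>\<^sup>+z\<in>top_half t \<theta>. ennreal (\<omega> z powr (- 1 / (q - 1))) \<partial>lborel) (q - 1)"
    using q \<omega>_pos by (intro set_nn_integral_Holder) auto
  also have "(\<integral>\<^sup>+z\<in>top_half t \<theta>. ennreal_powr (ennreal ((1 - (cmod z)\<^sup>2)\<^sup>2)) q * ennreal (\<omega> z) \<partial>lborel) =
      (\<integral>\<^sup>+z\<in>top_half t \<theta>. v z \<partial>lborel)"
  proof (rule nn_integral_cong)
    fix z
    show "ennreal_powr (ennreal ((1 - (cmod z)\<^sup>2)\<^sup>2)) q * ennreal (\<omega> z) * indicator (top_half t \<theta>) z =
        v z * indicator (top_half t \<theta>) z"
    proof (cases "z \<in> top_half t \<theta>")
      case True
      then have "cmod z < 1" using t by (simp add: top_half_def)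
      then have p: "1 - (cmod z)\<^sup>2 > 0" by (simp add: abs_square_less_1)
      have "(1 - (cmod z)\<^sup>2)\<^sup>2 = (1 - (cmod z)\<^sup>2) powr 2" using p by simp
      then have "((1 - (cmod z)\<^sup>2)\<^sup>2) powr q = (1 - (cmod z)\<^sup>2) powr (2 * q)"
        by (simp only: powr_powr)
      then show ?thesis using \<omega>_pos[of z] by (simp add: v_def mult.commute flip: ennreal_mult)
    qed simp
  qed
  finally show ?thesis unfolding \<sigma>_def .
qed

lemma square_product_le:
  assumes t: "0 < t" "t < 1"
  shows "(\<integral>\<^sup>+z\<in>polar_square t \<theta>. v z \<partial>lborel) * ennreal_powr (\<integral>\<^sup>+z\<in>polar_square t \<theta>. \<sigma> z \<partial>lborel) (q - 1)
    \<le> ennreal (K * t powr (4 * q))"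
  using Bq[OF t] unfolding v_def \<sigma>_def .

definition L where "L = max 1 (max (K / (3 / 1024) powr q) ((K / (3 / 1024) powr q) powr (1 / (q - 1))))"

lemma L1: "1 \<le> L" by (simp add: L_def)

text \<open>The upper bound on the square and the lower bound on its top half are both of order
  \<open>t powr (4 * q)\<close>. Comparing one of the two masses by mere monotonicity and cancelling
  it leaves the estimate for the other; for \<open>\<sigma>\<close> a root of order
  \<open>q - 1\<close> is taken, hence the two entries in \<open>L\<close>.\<close>

lemma doubling:
  assumes t: "0 < t" "t < 1"
  shows "(\<integral>\<^sup>+z\<in>polar_square t \<theta>. v z \<partial>lborel) < top" "(\<integral>\<^sup>+z\<in>polar_square t \<theta>. \<sigma> z \<partial>lborel) < top"
    "(\<integral>\<^sup>+z\<in>polar_square t \<theta>. v z \<partial>lborel) \<le> ennreal L * (\<integral>\<^sup>+z\<in>top_half t \<theta>. v z \<partial>lborel)"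
    "(\<integral>\<^sup>+z\<in>polar_square t \<theta>. \<sigma> z \<partial>lborel) \<le> ennreal L * (\<integral>\<^sup>+z\<in>top_half t \<theta>. \<sigma> z \<partial>lborel)"
proof -
  define V where "V = (\<integral>\<^sup>+z\<in>polar_square t \<theta>. v z \<partial>lborel)"
  define W where "W = (\<integral>\<^sup>+z\<in>top_half t \<theta>. v z \<partial>lborel)"
  define S where "S = (\<integral>\<^sup>+z\<in>polar_square t \<theta>. \<sigma> z \<partial>lborel)"
  define R where "R = (\<integral>\<^sup>+z\<in>top_half t \<theta>. \<sigma> z \<partial>lborel)"
  define c where "c = (3 / 1024) powr q * t powr (4 * q)"
  define k where "k = K / (3 / 1024) powr q"
  have c: "c > 0" using t by (simp add: c_def)
  have k: "k > 0" using K by (simp add: k_def)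
  have kc: "K * t powr (4 * q) = k * c" by (simp add: k_def c_def)
  have T: "top_half t \<theta> \<subseteq> polar_square t \<theta>" by (simp add: top_half_def)
  have WV: "W \<le> V" "R \<le> S" unfolding W_def V_def R_def S_def
    using T by (intro nn_integral_mono mult_left_mono; force simp: indicator_def)+
  have lo: "ennreal c \<le> W * ennreal_powr R (q - 1)"
    using top_half_product_ge[OF t, of \<theta>] unfolding c_def W_def R_def .
  have up: "V * ennreal_powr S (q - 1) \<le> ennreal (k * c)"
    using square_product_le[OF t, of \<theta>] unfolding V_def S_def kc .
  have W0: "W \<noteq> 0" "R \<noteq> 0" using lo c by (auto simp: ennreal_eq_0_iff)
  then have V0: "V \<noteq> 0" "S \<noteq> 0" using WV by auto
  have Vf: "V \<noteq> top" "S \<noteq> top" using up V0 by (auto simp: ennreal_mult_top ennreal_top_mult top_unique)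
  then have Wf: "W \<noteq> top" "R \<noteq> top" using WV by (auto simp: top_unique)
  show "(\<integral>\<^sup>+z\<in>polar_square t \<theta>. v z \<partial>lborel) < top" "(\<integral>\<^sup>+z\<in>polar_square t \<theta>. \<sigma> z \<partial>lborel) < top"
    using Vf by (simp_all add: V_def S_def less_top)
  obtain v1 where v1: "V = ennreal v1" "0 < v1" using Vf V0 by (metis ennreal_cases ennreal_0 order_le_less)
  obtain w where w: "W = ennreal w" "0 < w" using Wf W0 by (metis ennreal_cases ennreal_0 order_le_less)
  obtain s where s: "S = ennreal s" "0 < s" using Vf V0 by (metis ennreal_cases ennreal_0 order_le_less)
  obtain r where r: "R = ennreal r" "0 < r" using Wf W0 by (metis ennreal_cases ennreal_0 order_le_less)
  have wv: "w \<le> v1" and rs: "r \<le> s" using WV v1 w r s by auto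
  have lo': "c \<le> w * r powr (q - 1)" using lo w r by (simp flip: ennreal_mult)
  have up': "v1 * s powr (q - 1) \<le> k * c" using up v1 s k c by (simp flip: ennreal_mult)
  have 1: "v1 * s powr (q - 1) \<le> k * (w * r powr (q - 1))"
    using up' mult_left_mono[OF lo', of k] k by linarith
  have rs': "r powr (q - 1) \<le> s powr (q - 1)" using rs r q by (intro powr_mono2) auto
  have "v1 * s powr (q - 1) \<le> (k * w) * s powr (q - 1)"
  proof -
    have "k * w * r powr (q - 1) \<le> k * w * s powr (q - 1)" using rs' k w by (intro mult_left_mono) auto
    then show ?thesis using 1 by (simp only: mult.assoc)
  qed
  then have "v1 \<le> k * w" using s by simp
  also have "\<dots> \<le> L * w" using w by (intro mult_right_mono) (auto simp: L_def k_def)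
  finally show "(\<integral>\<^sup>+z\<in>polar_square t \<theta>. v z \<partial>lborel) \<le> ennreal L * (\<integral>\<^sup>+z\<in>top_half t \<theta>. v z \<partial>lborel)"
    unfolding V_def[symmetric] W_def[symmetric] using v1 w L1 by (simp flip: ennreal_mult)
  have "w * s powr (q - 1) \<le> v1 * s powr (q - 1)" using wv by (intro mult_right_mono) auto
  then have "w * s powr (q - 1) \<le> w * (k * r powr (q - 1))" using 1 by (simp add: mult_ac)
  then have "s powr (q - 1) \<le> k * r powr (q - 1)" using w by simp
  then have "(s powr (q - 1)) powr (1 / (q - 1)) \<le> (k * r powr (q - 1)) powr (1 / (q - 1))"
    using q by (intro powr_mono2) auto
  then have "s \<le> k powr (1 / (q - 1)) * r" using q s r k by (simp add: powr_mult powr_powr)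
  also have "\<dots> \<le> L * r" using r by (intro mult_right_mono) (auto simp: L_def k_def)
  finally show "(\<integral>\<^sup>+z\<in>polar_square t \<theta>. \<sigma> z \<partial>lborel) \<le> ennreal L * (\<integral>\<^sup>+z\<in>top_half t \<theta>. \<sigma> z \<partial>lborel)"
    unfolding S_def[symmetric] R_def[symmetric] using s r L1 by (simp flip: ennreal_mult)
qed

definition e where "e = log 2 (2 / (2 - 1 / L))"

lemma e: "0 < e" "2 powr e * (2 - 1 / L) \<le> 2"
proof -
  have "0 < 1 / L" "1 / L \<le> 1" using L1 by (auto simp: field_simps)
  then have "1 < 2 / (2 - 1 / L)" "2 - 1 / L > 0" by (auto simp: field_simps)
  then have p: "1 < 2 / (2 - 1 / L)" "2 - 1 / L \<noteq> 0" "0 < 2 / (2 - 1 / L)" by auto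
  show "0 < e" unfolding e_def using p by simp
  have "2 powr e = 2 / (2 - 1 / L)" unfolding e_def using p by (intro powr_log_cancel) auto
  then show "2 powr e * (2 - 1 / L) \<le> 2" using p(2) by (metis nonzero_divide_eq_eq order_refl)
qed

text \<open>Each weighted mass costs a factor \<open>2 * t powr (- e)\<close>, and together the two
  enter with the power \<open>1 + (q - 1) = q\<close>.\<close>

lemma weighted_square_product_le:
  assumes t: "0 < t" "t < 1"
  shows "(\<integral>\<^sup>+z\<in>polar_square t \<theta>. ennreal ((1 - cmod z) powr (-e)) * v z \<partial>lborel) *
    ennreal_powr (\<integral>\<^sup>+z\<in>polar_square t \<theta>. ennreal ((1 - cmod z) powr (-e)) * \<sigma> z \<partial>lborel) (q - 1)
    \<le> ennreal (2 powr q * K * t powr (4 * q - e * q))"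
proof -
  let ?V = "(\<integral>\<^sup>+z\<in>polar_square t \<theta>. v z \<partial>lborel)" and ?S = "(\<integral>\<^sup>+z\<in>polar_square t \<theta>. \<sigma> z \<partial>lborel)"
  have "(\<integral>\<^sup>+z\<in>polar_square t \<theta>. ennreal ((1 - cmod z) powr (-e)) * v z \<partial>lborel) *
    ennreal_powr (\<integral>\<^sup>+z\<in>polar_square t \<theta>. ennreal ((1 - cmod z) powr (-e)) * \<sigma> z \<partial>lborel) (q - 1) \<le>
    (ennreal (2 * t powr (-e)) * ?V) * ennreal_powr (ennreal (2 * t powr (-e)) * ?S) (q - 1)"
    using q t doubling by (intro mult_mono ennreal_powr_mono nn_integral_dist_powr_polar_square_le[OF _ L1 e]) auto
  also have "\<dots> = (ennreal (2 * t powr (-e)) * ennreal_powr (ennreal (2 * t powr (-e))) (q - 1)) * (?V * ennreal_powr ?S (q - 1))"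
    using q by (simp add: ennreal_powr_mult mult_ac)
  also have "\<dots> \<le> (ennreal (2 * t powr (-e)) * ennreal_powr (ennreal (2 * t powr (-e))) (q - 1)) * ennreal (K * t powr (4 * q))"
    using square_product_le[OF t] by (intro mult_left_mono) auto
  also have "\<dots> = ennreal ((2 * t powr (-e)) * (2 * t powr (-e)) powr (q - 1) * (K * t powr (4 * q)))"
    using K by (simp flip: ennreal_mult)
  also have "(2 * t powr (-e)) * (2 * t powr (-e)) powr (q - 1) = (2 * t powr (-e)) powr q"
    using t powr_add[of "2 * t powr (-e)" 1 "q - 1"] by simp
  also have "(2 * t powr (-e)) powr q = 2 powr q * t powr (- e * q)" using t by (simp add: powr_mult powr_powr)
  also have "2 powr q * t powr (- e * q) * (K * t powr (4 * q)) = 2 powr q * K * (t powr (- e * q) * t powr (4 * q))" by simp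
  also have "t powr (- e * q) * t powr (4 * q) = t powr (4 * q - e * q)"
    by (simp flip: powr_add)
  finally show ?thesis .
qed

end

text \<open>The indicator of an open subset of the product space is jointly measurable, as Fubini's
  theorem requires.\<close>

definition near_kernel :: "real \<Rightarrow> complex \<Rightarrow> complex \<Rightarrow> ennreal" where
  "near_kernel s z w = indicator {p. cmod (snd p) < 1 \<and> cmod (1 - cnj (fst p) * snd p) < s} (z, w)"

lemma near_kernel_measurable_pair [measurable]:
  "(\<lambda>p. near_kernel s (fst p) (snd p)) \<in> borel_measurable (lborel \<Otimes>\<^sub>M lborel)"
proof -
  let ?O = "{p :: complex \<times> complex. cmod (snd p) < 1 \<and> cmod (1 - cnj (fst p) * snd p) < s}"
  have "open ?O"
    by (intro open_Collect_conj open_Collect_less continuous_intros)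
  then have "?O \<in> sets (borel :: (complex \<times> complex) measure)" by simp
  then have "?O \<in> sets (lborel \<Otimes>\<^sub>M lborel)" by (simp only: lborel_prod sets_lborel)
  then have "(indicator ?O :: _ \<Rightarrow> ennreal) \<in> borel_measurable (lborel \<Otimes>\<^sub>M lborel)" by simp
  then show ?thesis unfolding near_kernel_def by simp
qed

lemma near_kernel_measurable [measurable]:
  assumes "f \<in> borel_measurable M" "g \<in> borel_measurable M"
  shows "(\<lambda>x. near_kernel s (f x) (g x)) \<in> borel_measurable M"
proof -
  have "(\<lambda>x. (f x, g x)) \<in> M \<rightarrow>\<^sub>M lborel \<Otimes>\<^sub>M lborel"
    using assms by (intro measurable_Pair) auto
  from measurable_compose[OF this near_kernel_measurable_pair] show ?thesis by simp
qed

lemma near_kernel_cases: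
  obtains "near_kernel s z w = 0" | "near_kernel s z w = 1" "cmod w < 1" "cmod (1 - cnj z * w) < s"
  by (auto simp: near_kernel_def indicator_def)

text \<open>\<open>|1 - cnj z w|\<close> dominates \<open>|z - w|\<close> as well as the distances
  of both points from the circle; hence the near kernel only couples points of a common square of
  side comparable to \<open>s\<close>.\<close>

lemma dist_less_of_near:
  assumes "cmod z < 1" "cmod w < 1" "cmod (1 - cnj z * w) < s"
  shows "cmod (z - w) < s" "1 - cmod w < s" "1 - cmod z < s"
proof -
  have "0 \<le> (1 - (cmod z)\<^sup>2) * (1 - (cmod w)\<^sup>2)"
    using assms by (intro mult_nonneg_nonneg) (auto simp: abs_square_le_1)
  then have "(cmod (z - w))\<^sup>2 \<le> (cmod (1 - cnj z * w))\<^sup>2" by (simp add: cmod_one_minus_cnj_mult_sq)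
  then have "cmod (z - w) \<le> cmod (1 - cnj z * w)" by (simp add: power2_le_iff_abs_le)
  then show "cmod (z - w) < s" using assms by linarith
  have "1 - cmod z * cmod w \<le> cmod (1 - cnj z * w)"
    using norm_triangle_ineq2[of 1 "cnj z * w"] by (simp add: norm_mult)
  moreover have "cmod z * cmod w \<le> cmod w" "cmod z * cmod w \<le> cmod z"
    using assms by (auto simp: mult_left_le mult_left_le_one_le)
  ultimately show "1 - cmod w < s" "1 - cmod z < s" using assms by linarith+
qed

text \<open>Where \<open>|1 - cnj z w| \<ge> 1/16\<close> the constant suffices. Otherwise a single
  term of the series does, that of the scale with
  \<open>(1/2) ^ (n + 5) \<le> |1 - cnj z w| < (1/2) ^ (n + 4)\<close>.\<close>

lemma near_kernel_powr_sum_ge: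
  assumes z: "cmod z < 1" and w: "cmod w < 1"
  shows "ennreal (1 / cmod (1 - cnj z * w) ^ 4) \<le> ennreal (16 ^ 4) +
    (\<Sum>n. ennreal ((2 / (1/2) ^ (n + 4)) ^ 4) * near_kernel ((1/2) ^ (n + 4)) z w)"
proof (cases "cmod (1 - cnj z * w) < 1/16")
  case False
  have "1 / cmod (1 - cnj z * w) ^ 4 \<le> 1 / (1/16) ^ 4"
    using False by (intro divide_left_mono power_mono mult_pos_pos zero_less_power) auto
  then have "ennreal (1 / cmod (1 - cnj z * w) ^ 4) \<le> ennreal (16 ^ 4)"
    by (intro ennreal_leI) (simp add: power_divide)
  then show ?thesis by (rule order_trans) simp
next
  case True
  let ?c = "cmod (1 - cnj z * w)"
  have c0: "0 < ?c" using one_minus_cnj_mult_nonzero[OF z w] by simp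
  define P where "P n \<longleftrightarrow> (1/2) ^ (n + 5) \<le> ?c" for n :: nat
  obtain M where M: "(1/2) ^ M < ?c" using real_arch_pow_inv[OF c0, of "1/2"] by auto
  have "(1/2 :: real) ^ (M + 5) \<le> (1/2) ^ M" by (intro power_decreasing) auto
  then have "P M" using M unfolding P_def by linarith
  define n where "n = (LEAST n. P n)"
  have Pn: "P n" unfolding n_def by (rule LeastI[of P, OF \<open>P M\<close>])
  have less: "?c < (1/2) ^ (n + 4)"
  proof (cases n)
    case 0
    then show ?thesis using True by (simp add: power_divide)
  next
    case (Suc m)
    then have "\<not> P m" unfolding n_def by (intro not_less_Least) simp
    then have "?c < (1/2) ^ (m + 5)" unfolding P_def by simp
    moreover have "n + 4 = m + 5" using Suc by simp
    ultimately show ?thesis by (simp only:)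
  qed
  have "(1/2 :: real) ^ (n + 5) = (1/2) ^ (n + 4) / 2"
  proof -
    have "n + 5 = Suc (n + 4)" by simp
    then show ?thesis by (simp only: power_Suc times_divide_eq_left mult_1)
  qed
  then have ge: "(1/2) ^ (n + 4) / 2 \<le> ?c" using Pn by (simp only: P_def)
  have p: "(0::real) < (1/2) ^ (n + 4)" by simp
  have "1 / ?c ^ 4 = (1 / ?c) ^ 4" by (simp add: power_divide)
  also have "\<dots> \<le> (2 / (1/2) ^ (n + 4)) ^ 4"
  proof (intro power_mono)
    have "1 / ?c \<le> 1 / ((1/2) ^ (n + 4) / 2)" using ge p c0 by (intro divide_left_mono mult_pos_pos) auto
    then show "1 / ?c \<le> 2 / (1/2) ^ (n + 4)" by (simp only: divide_divide_eq_right mult_1)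
  qed (use c0 in auto)
  finally have "ennreal (1 / ?c ^ 4) \<le> ennreal ((2 / (1/2) ^ (n + 4)) ^ 4) * near_kernel ((1/2) ^ (n + 4)) z w"
    using less w by (simp add: near_kernel_def ennreal_leI)
  also have "\<dots> \<le> (\<Sum>n. ennreal ((2 / (1/2) ^ (n + 4)) ^ 4) * near_kernel ((1/2) ^ (n + 4)) z w)"
    using sum_le_suminf[of "\<lambda>n. ennreal ((2 / (1/2) ^ (n + 4)) ^ 4) * near_kernel ((1/2) ^ (n + 4)) z w" "{n}"] by simp
  finally show ?thesis by (rule order_trans) simp
qed

lemma collar_borel [measurable]: "{w :: complex. cmod w < 1 \<and> 1 - cmod w < s} \<in> sets borel"
proof -
  have "open {w :: complex. cmod w < 1 \<and> 1 - cmod w < s}"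
    by (intro open_Collect_conj open_Collect_less continuous_intros)
  then show ?thesis by simp
qed

section \<open>The operator at a single scale\<close>

context Bekolle_weight
begin

text \<open>The exponent is chosen so that the dual weight becomes
  \<open>(1 - |w|) powr (- e) * \<sigma> w\<close>, for which the estimates on squares hold. The
  value \<open>1\<close> outside the disc keeps the weight positive, as Hoelder's inequality above
  demands.\<close>

definition near_weight :: "complex \<Rightarrow> real" where
  "near_weight w = (if cmod w < 1 then \<omega> w * (1 - cmod w) powr (e * (q - 1)) else 1)"

lemma near_weight_measurable [measurable]: "near_weight \<in> borel_measurable borel"
  unfolding near_weight_def by measurable

lemma near_weight_pos: "0 < near_weight w"
  using \<omega>_pos by (simp add: near_weight_def)

lemma near_weight_powr:
  assumes "cmod w < 1"
  shows "ennreal (near_weight w powr (- 1 / (q - 1))) = ennreal ((1 - cmod w) powr (-e)) * \<sigma> w"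
proof -
  have "near_weight w powr (- 1 / (q - 1)) = \<omega> w powr (- 1 / (q - 1)) * (1 - cmod w) powr (e * (q - 1) * (- 1 / (q - 1)))"
    using assms \<omega>_pos[of w] by (simp add: near_weight_def powr_mult powr_powr)
  also have "e * (q - 1) * (- 1 / (q - 1)) = - e" using q by simp
  finally show ?thesis by (simp add: \<sigma>_def mult.commute flip: ennreal_mult)
qed

text \<open>A Schur test: Hoelder's inequality at each \<open>z\<close>, then Fubini's theorem. For
  fixed \<open>w\<close>, all \<open>z\<close> coupled with \<open>w\<close> and all
  \<open>y\<close> coupled with such a \<open>z\<close> lie in one square of side
  \<open>8 * s\<close>, so the remaining integral is bounded by the product in
  \<open>weighted_square_product_le\<close>.\<close>

lemma near_operator_le:
  fixes g :: "complex \<Rightarrow> ennreal"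
  assumes s: "0 < s" "s \<le> 1/16" and [measurable]: "g \<in> borel_measurable borel"
  shows "(\<integral>\<^sup>+z\<in>\<bbbD>. ennreal ((1 - cmod z) powr (-e)) * v z *
      ennreal_powr (\<integral>\<^sup>+w. near_kernel s z w * g w \<partial>lborel) q \<partial>lborel) \<le>
    ennreal (2 powr q * K * (8 * s) powr (4 * q - e * q)) *
    (\<integral>\<^sup>+w\<in>{w. cmod w < 1 \<and> 1 - cmod w < s}. ennreal_powr (g w) q * ennreal (near_weight w) \<partial>lborel)"
proof -
  define C where "C = ennreal (2 powr q * K * (8 * s) powr (4 * q - e * q))"
  define \<Phi> where "\<Phi> z = ennreal_powr (\<integral>\<^sup>+w. near_kernel s z w * (ennreal ((1 - cmod w) powr (-e)) * \<sigma> w) \<partial>lborel) (q - 1)" for z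
  define u where "u z = ennreal ((1 - cmod z) powr (-e)) * v z * indicator \<bbbD> z" for z :: complex
  define h where "h w = ennreal_powr (g w) q * ennreal (near_weight w)" for w
  have [measurable]: "\<Phi> \<in> borel_measurable lborel" unfolding \<Phi>_def by measurable
  have [measurable]: "\<bbbD> \<in> sets borel" by simp
  have [measurable]: "u \<in> borel_measurable lborel" unfolding u_def by measurable
  have [measurable]: "h \<in> borel_measurable lborel" unfolding h_def by measurable
  have step: "ennreal_powr (\<integral>\<^sup>+w. near_kernel s z w * g w \<partial>lborel) q \<le>
      (\<integral>\<^sup>+w. near_kernel s z w * h w \<partial>lborel) * \<Phi> z" for z
  proof -
    let ?E = "{w. cmod w < 1 \<and> cmod (1 - cnj z * w) < s}"
    have "open ?E" by (intro open_Collect_conj open_Collect_less continuous_intros)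
    then have [measurable]: "?E \<in> sets lborel" by simp
    have k: "near_kernel s z w = indicator ?E w" for w by (simp add: near_kernel_def indicator_def)
    have "ennreal_powr (\<integral>\<^sup>+w\<in>?E. g w \<partial>lborel) q \<le> (\<integral>\<^sup>+w\<in>?E. h w \<partial>lborel) *
       ennreal_powr (\<integral>\<^sup>+w\<in>?E. ennreal (near_weight w powr (- 1 / (q - 1))) \<partial>lborel) (q - 1)"
      unfolding h_def using q near_weight_pos by (intro set_nn_integral_Holder) auto
    also have "(\<integral>\<^sup>+w\<in>?E. ennreal (near_weight w powr (- 1 / (q - 1))) \<partial>lborel) =
       (\<integral>\<^sup>+w\<in>?E. (ennreal ((1 - cmod w) powr (-e)) * \<sigma> w) \<partial>lborel)"
      using near_weight_powr by (intro nn_integral_cong) (auto simp: indicator_def)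
    finally show ?thesis unfolding \<Phi>_def k by (simp only: mult.commute[of "indicator _ _"])
  qed
  have bound: "(\<integral>\<^sup>+z. u z * near_kernel s z w * \<Phi> z \<partial>lborel) \<le>
      C * indicator {w. cmod w < 1 \<and> 1 - cmod w < s} w" for w
  proof (cases "cmod w < 1 \<and> 1 - cmod w < s")
    case False
    have "u z * near_kernel s z w * \<Phi> z = 0" for z
    proof (rule ccontr)
      assume "u z * near_kernel s z w * \<Phi> z \<noteq> 0"
      then have "cmod z < 1" "near_kernel s z w \<noteq> 0" by (auto simp: u_def indicator_def split: if_splits)
      moreover then have "cmod w < 1" "cmod (1 - cnj z * w) < s" by (auto simp: near_kernel_def indicator_def split: if_splits)
      ultimately show False using dist_less_of_near[of z w s] False by auto
    qed
    then have "(\<integral>\<^sup>+z. u z * near_kernel s z w * \<Phi> z \<partial>lborel) = (\<integral>\<^sup>+z. 0 \<partial>(lborel :: complex measure))"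
      by (intro nn_integral_cong)
    then show ?thesis by simp
  next
    case True
    let ?Q = "polar_square (8 * s) (Arg w)"
    let ?P = "\<lambda>f. \<integral>\<^sup>+y\<in>?Q. ennreal ((1 - cmod y) powr (-e)) * f y \<partial>lborel"
    have Q [measurable]: "?Q \<in> sets borel" using s by auto
    have pt: "u z * near_kernel s z w * \<Phi> z \<le> (ennreal ((1 - cmod z) powr (-e)) * v z * indicator ?Q z) * ennreal_powr (?P \<sigma>) (q - 1)" for z
    proof (cases "u z * near_kernel s z w * \<Phi> z = 0")
      case False
      then have z: "cmod z < 1" "near_kernel s z w \<noteq> 0" by (auto simp: u_def indicator_def split: if_splits)
      then have zw: "cmod w < 1" "cmod (1 - cnj z * w) < s" by (auto simp: near_kernel_def indicator_def split: if_splits)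
      note n = dist_less_of_near[OF z(1) zw]
      have yQ: "y \<in> ?Q" if "cmod y < 1" "cmod (1 - cnj z * y) < s" for y
      proof (rule near_points_polar_square)
        note m = dist_less_of_near[OF z(1) that]
        have "cmod (y - w) \<le> cmod (z - y) + cmod (z - w)"
          using norm_triangle_ineq4[of "z - w" "z - y"] by simp
        then show "cmod (y - w) < 2 * s" using m n by linarith
        show "1 - cmod y < s" "1 - cmod w < s" "0 < s" "s \<le> 1/16" "cmod y < 1" using m n s that by auto
      qed
      have zQ: "z \<in> ?Q"
      proof (rule near_points_polar_square)
        show "cmod (z - w) < 2 * s" using n s by linarith
      qed (use n s z in auto)
      have "\<Phi> z \<le> ennreal_powr (?P \<sigma>) (q - 1)"
        unfolding \<Phi>_def
      proof (intro ennreal_powr_mono nn_integral_mono)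
        fix y
        show "near_kernel s z y * (ennreal ((1 - cmod y) powr (-e)) * \<sigma> y) \<le>
            ennreal ((1 - cmod y) powr (-e)) * \<sigma> y * indicator ?Q y"
          by (cases rule: near_kernel_cases[of s z y]) (use yQ in auto)
      qed (use q in auto)
      moreover have "near_kernel s z w = 1" using zw by (simp add: near_kernel_def)
      ultimately show ?thesis using z zQ by (auto simp: u_def intro!: mult_left_mono)
    next
      case True
      then show ?thesis by (simp only: zero_le)
    qed
    have "(\<integral>\<^sup>+z. u z * near_kernel s z w * \<Phi> z \<partial>lborel) \<le>
        (\<integral>\<^sup>+z. (ennreal ((1 - cmod z) powr (-e)) * v z * indicator ?Q z) * ennreal_powr (?P \<sigma>) (q - 1) \<partial>lborel)"
      by (intro nn_integral_mono pt)
    also have "\<dots> = ?P v * ennreal_powr (?P \<sigma>) (q - 1)" by (rule nn_integral_multc) measurable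
    also have "\<dots> \<le> C" unfolding C_def using s by (intro weighted_square_product_le) auto
    finally show ?thesis using True by simp
  qed
  have "(\<integral>\<^sup>+z\<in>\<bbbD>. ennreal ((1 - cmod z) powr (-e)) * v z *
      ennreal_powr (\<integral>\<^sup>+w. near_kernel s z w * g w \<partial>lborel) q \<partial>lborel) \<le>
      (\<integral>\<^sup>+z. u z * ((\<integral>\<^sup>+w. near_kernel s z w * h w \<partial>lborel) * \<Phi> z) \<partial>lborel)"
  proof (rule nn_integral_mono)
    fix z
    show "ennreal ((1 - cmod z) powr (-e)) * v z * ennreal_powr (\<integral>\<^sup>+w. near_kernel s z w * g w \<partial>lborel) q * indicator \<bbbD> z \<le>
        u z * ((\<integral>\<^sup>+w. near_kernel s z w * h w \<partial>lborel) * \<Phi> z)"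
      using mult_left_mono[OF step[of z], of "u z"] by (simp add: u_def mult_ac)
  qed
  also have "\<dots> = (\<integral>\<^sup>+z. (\<integral>\<^sup>+w. u z * near_kernel s z w * \<Phi> z * h w \<partial>lborel) \<partial>lborel)"
  proof (rule nn_integral_cong)
    fix z
    have "(\<integral>\<^sup>+w. u z * near_kernel s z w * \<Phi> z * h w \<partial>lborel) = (\<integral>\<^sup>+w. (u z * \<Phi> z) * (near_kernel s z w * h w) \<partial>lborel)"
      by (simp add: mult_ac)
    also have "\<dots> = (u z * \<Phi> z) * (\<integral>\<^sup>+w. near_kernel s z w * h w \<partial>lborel)" by (rule nn_integral_cmult) measurable
    finally show "u z * ((\<integral>\<^sup>+w. near_kernel s z w * h w \<partial>lborel) * \<Phi> z) = (\<integral>\<^sup>+w. u z * near_kernel s z w * \<Phi> z * h w \<partial>lborel)"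
      by (simp add: mult_ac)
  qed
  also have "\<dots> = (\<integral>\<^sup>+w. (\<integral>\<^sup>+z. u z * near_kernel s z w * \<Phi> z * h w \<partial>lborel) \<partial>lborel)"
    by (rule lborel_pair.Fubini'[symmetric]) measurable
  also have "\<dots> = (\<integral>\<^sup>+w. (\<integral>\<^sup>+z. u z * near_kernel s z w * \<Phi> z \<partial>lborel) * h w \<partial>lborel)"
    by (intro nn_integral_cong nn_integral_multc) measurable
  also have "\<dots> \<le> (\<integral>\<^sup>+w. (C * indicator {w. cmod w < 1 \<and> 1 - cmod w < s} w) * h w \<partial>lborel)"
    by (intro nn_integral_mono mult_right_mono bound) auto
  also have "\<dots> = (\<integral>\<^sup>+w. C * (h w * indicator {w. cmod w < 1 \<and> 1 - cmod w < s} w) \<partial>lborel)"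
    by (simp add: mult_ac)
  also have "\<dots> = C * (\<integral>\<^sup>+w\<in>{w. cmod w < 1 \<and> 1 - cmod w < s}. h w \<partial>lborel)"
    by (rule nn_integral_cmult) measurable
  finally show ?thesis unfolding C_def h_def .
qed

end

section \<open>Summation over the scales\<close>

context Bekolle_weight
begin

lemma nn_integral_v_fin: "(\<integral>\<^sup>+z\<in>\<bbbD>. v z \<partial>lborel) < top"
proof -
  have "(\<integral>\<^sup>+z\<in>\<bbbD>. v z \<partial>lborel) \<le> (\<integral>\<^sup>+z\<in>\<bbbD>. ennreal (\<omega> z) \<partial>lborel)"
    by (intro nn_integral_mono) (auto simp: indicator_def v_le)
  then show ?thesis using \<omega>_fin by (rule order_le_less_trans)
qed

text \<open>Hoelder's inequality for the counting measure on the scales. Only scales above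
  \<open>d\<close> occur, so the dual sum is geometric and costs \<open>d powr (- e)\<close> once it
  is raised to the power \<open>q - 1\<close>.\<close>

lemma powr_suminf_le:
  fixes x :: "nat \<Rightarrow> ennreal"
  assumes d: "0 < d" and x: "\<And>n. \<not> d < (1/2) ^ (n + 4) \<Longrightarrow> x n = 0"
  shows "ennreal_powr (\<Sum>n. x n) q \<le>
    ennreal ((1 / (1 - 2 powr (- (e / (q - 1))))) powr (q - 1) * d powr (- e)) *
    (\<Sum>n. ennreal_powr (x n) q * ennreal (((1/2) ^ (n + 4)) powr e))"
proof -
  define J where "J = {n :: nat. d < (1/2) ^ (n + 4)}"
  define c where "c = 1 / (1 - 2 powr (- (e / (q - 1))))"
  have eq: "0 < e / (q - 1)" using e q by simp
  have "2 powr (- (e / (q - 1))) < 1" using eq by (auto simp: powr_less_one)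
  then have c: "0 < c" by (simp add: c_def)
  have sJ: "(\<Sum>n. f n) = (\<integral>\<^sup>+n. f n \<partial>count_space J)" if "\<And>n. n \<notin> J \<Longrightarrow> f n = 0" for f :: "nat \<Rightarrow> ennreal"
  proof -
    have "(\<Sum>n. f n) = (\<integral>\<^sup>+n. f n \<partial>count_space UNIV)" by (simp add: nn_integral_count_space_nat)
    also have "\<dots> = (\<integral>\<^sup>+n. f n \<partial>count_space J)"
      using that by (intro nn_integral_count_space_eq) auto
    finally show ?thesis .
  qed
  have "ennreal_powr (\<Sum>n. x n) q = ennreal_powr (\<integral>\<^sup>+n. x n \<partial>count_space J) q"
    using x by (subst sJ) (auto simp: J_def)
  also have "\<dots> \<le> (\<integral>\<^sup>+n. ennreal_powr (x n) q * ennreal (((1/2) ^ (n + 4)) powr e) \<partial>count_space J) *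
      ennreal_powr (\<integral>\<^sup>+n. ennreal ((((1/2) ^ (n + 4)) powr e) powr (- 1 / (q - 1))) \<partial>count_space J) (q - 1)"
    using q by (intro nn_integral_Holder) auto
  also have "(\<integral>\<^sup>+n. ennreal ((((1/2) ^ (n + 4)) powr e) powr (- 1 / (q - 1))) \<partial>count_space J) =
      (\<integral>\<^sup>+n. ennreal (((1/2) ^ (n + 4)) powr (- (e / (q - 1)))) \<partial>count_space J)"
    by (simp add: powr_powr)
  also have "(\<integral>\<^sup>+n. ennreal_powr (x n) q * ennreal (((1/2) ^ (n + 4)) powr e) \<partial>count_space J) =
      (\<Sum>n. ennreal_powr (x n) q * ennreal (((1/2) ^ (n + 4)) powr e))"
    using x by (intro sJ[symmetric]) (auto simp: J_def)
  also have "(\<Sum>n. ennreal_powr (x n) q * ennreal (((1/2) ^ (n + 4)) powr e)) *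
      ennreal_powr (\<integral>\<^sup>+n. ennreal (((1/2) ^ (n + 4)) powr (- (e / (q - 1)))) \<partial>count_space J) (q - 1) \<le>
      (\<Sum>n. ennreal_powr (x n) q * ennreal (((1/2) ^ (n + 4)) powr e)) *
      ennreal_powr (ennreal (c * d powr (- (e / (q - 1))))) (q - 1)"
    unfolding c_def J_def using q d eq by (intro mult_left_mono ennreal_powr_mono nn_integral_geometric_powr_le) auto
  also have "ennreal_powr (ennreal (c * d powr (- (e / (q - 1))))) (q - 1) = ennreal (c powr (q - 1) * d powr (- e))"
  proof -
    have "(c * d powr (- (e / (q - 1)))) powr (q - 1) = c powr (q - 1) * d powr (- (e / (q - 1)) * (q - 1))"
      using c d by (simp add: powr_mult powr_powr)
    also have "- (e / (q - 1)) * (q - 1) = - e" using q by simp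
    finally show ?thesis using c by simp
  qed
  finally show ?thesis unfolding c_def by (simp only: mult.commute)
qed

text \<open>
  The kernel is decomposed dyadically into \<open>near_kernel\<close>s. Hoelder's inequality over the scales
  uses the weights \<open>s\<^sub>n powr e\<close>, and over \<open>w\<close> (in \<open>near_operator_le\<close>) the weights
  \<open>(1 - |w|) powr (e (q - 1))\<close>; the powers of \<open>s\<^sub>n\<close> then cancel up to a geometric series.
\<close>

theorem Berezin_bounded:
  fixes g :: "complex \<Rightarrow> ennreal"
  assumes [measurable]: "g \<in> borel_measurable borel"
    and g1: "(\<integral>\<^sup>+w\<in>\<bbbD>. g w \<partial>lborel) < top"
    and gq: "(\<integral>\<^sup>+w\<in>\<bbbD>. ennreal_powr (g w) q * ennreal (\<omega> w) \<partial>lborel) < top"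
  shows "(\<integral>\<^sup>+z\<in>\<bbbD>. ennreal_powr (ennreal ((1 - (cmod z)\<^sup>2)\<^sup>2) *
      (\<integral>\<^sup>+w\<in>\<bbbD>. ennreal (1 / cmod (1 - cnj z * w) ^ 4) * g w \<partial>lborel)) q * ennreal (\<omega> z) \<partial>lborel) < top"
proof -
  have [measurable]: "\<bbbD> \<in> sets borel" by simp
  define s where "s n = (1/2 :: real) ^ (n + 4)" for n :: nat
  have s: "0 < s n" "s n \<le> 1/16" for n
  proof -
    have "(1/2 :: real) ^ (n + 4) \<le> (1/2) ^ 4" by (intro power_decreasing) auto
    then show "0 < s n" "s n \<le> 1/16" by (auto simp: s_def power_divide)
  qed
  define m where "m = (\<integral>\<^sup>+w\<in>\<bbbD>. g w \<partial>lborel)"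
  define x where "x n z = ennreal ((2 / s n) ^ 4) * (\<integral>\<^sup>+w. near_kernel (s n) z w * g w \<partial>lborel)" for n z
  have [measurable]: "x n \<in> borel_measurable borel" for n unfolding x_def by measurable
  define c1 where "c1 = (1 / (1 - 2 powr (- (e / (q - 1))))) powr (q - 1)"
  \<comment> \<open>\<open>b\<close> is the exponent of \<open>1 - |w|\<close> in
    \<open>near_weight\<close>, and also what is left when the powers of \<open>s n\<close> are
    collected in fact \<open>3\<close>: \<open>e - 4 * q + (4 * q - e * q) = - b\<close>.\<close>
  define b where "b = e * (q - 1)"
  have b: "0 < b" using e q by (simp add: b_def)
  define c2 where "c2 = 1 / (1 - 2 powr (- b))"
  define c3 where "c3 = 2 powr q * K * 8 powr (4 * q - e * q) * 2 powr (4 * q)"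
  have c3: "0 < c3" using K by (simp add: c3_def)
  define h where "h w = ennreal_powr (g w) q * ennreal (near_weight w)" for w
  have [measurable]: "h \<in> borel_measurable borel" unfolding h_def by measurable
  have 1: "(\<integral>\<^sup>+w\<in>\<bbbD>. ennreal (1 / cmod (1 - cnj z * w) ^ 4) * g w \<partial>lborel) \<le>
      ennreal (16 ^ 4) * m + (\<Sum>n. x n z)" if z: "z \<in> \<bbbD>" for z
  proof -
    have "(\<integral>\<^sup>+w\<in>\<bbbD>. ennreal (1 / cmod (1 - cnj z * w) ^ 4) * g w \<partial>lborel) \<le>
      (\<integral>\<^sup>+w. ennreal (16 ^ 4) * (g w * indicator \<bbbD> w) +
        (\<Sum>n. ennreal ((2 / s n) ^ 4) * (near_kernel (s n) z w * g w)) \<partial>lborel)"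
    proof (rule nn_integral_mono)
      fix w
      show "ennreal (1 / cmod (1 - cnj z * w) ^ 4) * g w * indicator \<bbbD> w \<le>
          ennreal (16 ^ 4) * (g w * indicator \<bbbD> w) + (\<Sum>n. ennreal ((2 / s n) ^ 4) * (near_kernel (s n) z w * g w))"
      proof (cases "w \<in> \<bbbD>")
        case True
        have "ennreal (1 / cmod (1 - cnj z * w) ^ 4) * g w \<le>
            (ennreal (16 ^ 4) + (\<Sum>n. ennreal ((2 / s n) ^ 4) * near_kernel (s n) z w)) * g w"
          unfolding s_def using z True by (intro mult_right_mono near_kernel_powr_sum_ge) auto
        also have "\<dots> = ennreal (16 ^ 4) * g w + (\<Sum>n. ennreal ((2 / s n) ^ 4) * near_kernel (s n) z w) * g w"
          by (rule distrib_right)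
        also have "(\<Sum>n. ennreal ((2 / s n) ^ 4) * near_kernel (s n) z w) * g w =
            (\<Sum>n. ennreal ((2 / s n) ^ 4) * near_kernel (s n) z w * g w)"
          by (rule ennreal_suminf_multc[symmetric])
        finally show ?thesis using True by (simp add: mult.assoc)
      qed simp
    qed
    also have "\<dots> = ennreal (16 ^ 4) * m + (\<Sum>n. x n z)"
      unfolding m_def x_def
      by (subst nn_integral_add) (auto simp: nn_integral_cmult nn_integral_suminf)
    finally show ?thesis .
  qed
  have x0: "x n z = 0" if z: "z \<in> \<bbbD>" and n: "\<not> 1 - cmod z < s n" for n z
  proof -
    have "near_kernel (s n) z w = 0" for w
      using dist_less_of_near(3)[of z w "s n"] z n by (cases rule: near_kernel_cases[of "s n" z w]) auto
    then show ?thesis by (simp add: x_def)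
  qed
  \<comment> \<open>The part of the kernel with \<open>|1 - cnj z w| \<ge> 1/16\<close> is
    controlled by the total mass \<open>m\<close>, which \<open>g1\<close> makes finite. For the
    rest \<open>powr_suminf_le\<close> is used with \<open>d = 1 - |z|\<close>, since by
    \<open>x0\<close> no scale below this distance contributes at \<open>z\<close>.\<close>
  have 2: "ennreal_powr (ennreal ((1 - (cmod z)\<^sup>2)\<^sup>2) *
      (\<integral>\<^sup>+w\<in>\<bbbD>. ennreal (1 / cmod (1 - cnj z * w) ^ 4) * g w \<partial>lborel)) q * ennreal (\<omega> z) \<le>
      ennreal (2 powr q) * (ennreal_powr (ennreal (16 ^ 4) * m) q * v z +
        (\<Sum>n. ennreal (c1 * s n powr e) * (ennreal ((1 - cmod z) powr (-e)) * v z * ennreal_powr (x n z) q)))"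
    if z: "z \<in> \<bbbD>" for z
  proof -
    let ?I = "\<integral>\<^sup>+w\<in>\<bbbD>. ennreal (1 / cmod (1 - cnj z * w) ^ 4) * g w \<partial>lborel"
    have d: "0 < 1 - cmod z" using z by simp
    have t: "0 < 1 - (cmod z)\<^sup>2" using z by (simp add: abs_square_less_1)
    have "(1 - (cmod z)\<^sup>2)\<^sup>2 = (1 - (cmod z)\<^sup>2) powr 2" using t by simp
    then have tq: "((1 - (cmod z)\<^sup>2)\<^sup>2) powr q = (1 - (cmod z)\<^sup>2) powr (2 * q)"
      by (simp only: powr_powr)
    have "ennreal_powr (ennreal ((1 - (cmod z)\<^sup>2)\<^sup>2) * ?I) q * ennreal (\<omega> z) = v z * ennreal_powr ?I q"
      using q \<omega>_pos[of z] by (simp add: ennreal_powr_mult tq v_def mult_ac ennreal_mult)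
    also have "\<dots> \<le> v z * ennreal_powr (ennreal (16 ^ 4) * m + (\<Sum>n. x n z)) q"
      using q 1[OF z] by (intro mult_left_mono ennreal_powr_mono) auto
    also have "\<dots> \<le> v z * (ennreal (2 powr q) * (ennreal_powr (ennreal (16 ^ 4) * m) q + ennreal_powr (\<Sum>n. x n z) q))"
      using q by (intro mult_left_mono ennreal_powr_add_le) auto
    also have "\<dots> \<le> v z * (ennreal (2 powr q) * (ennreal_powr (ennreal (16 ^ 4) * m) q +
        ennreal (c1 * (1 - cmod z) powr (- e)) * (\<Sum>n. ennreal_powr (x n z) q * ennreal (s n powr e))))"
      unfolding c1_def s_def using d x0[OF z] by (intro mult_left_mono add_left_mono powr_suminf_le) (auto simp: s_def)
    also have "\<dots> = ennreal (2 powr q) * (ennreal_powr (ennreal (16 ^ 4) * m) q * v z +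
        (v z * ennreal (c1 * (1 - cmod z) powr (- e))) * (\<Sum>n. ennreal_powr (x n z) q * ennreal (s n powr e)))"
      by (simp add: distrib_left mult_ac)
    also have "(v z * ennreal (c1 * (1 - cmod z) powr (- e))) * (\<Sum>n. ennreal_powr (x n z) q * ennreal (s n powr e)) =
       (\<Sum>n. (v z * ennreal (c1 * (1 - cmod z) powr (- e))) * (ennreal_powr (x n z) q * ennreal (s n powr e)))"
      by (rule ennreal_suminf_cmult[symmetric])
    also have "(\<lambda>n. (v z * ennreal (c1 * (1 - cmod z) powr (- e))) * (ennreal_powr (x n z) q * ennreal (s n powr e))) =
       (\<lambda>n. ennreal (c1 * s n powr e) * (ennreal ((1 - cmod z) powr (-e)) * v z * ennreal_powr (x n z) q))"
      by (simp add: c1_def ennreal_mult mult_ac)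
    finally show ?thesis .
  qed
  have 3: "(\<integral>\<^sup>+z\<in>\<bbbD>. ennreal (c1 * s n powr e) * (ennreal ((1 - cmod z) powr (-e)) * v z * ennreal_powr (x n z) q) \<partial>lborel) \<le>
      ennreal (c1 * c3) * (\<integral>\<^sup>+w\<in>{w. cmod w < 1 \<and> 1 - cmod w < s n}. ennreal (s n powr (- b)) * h w \<partial>lborel)" (is "?lhs \<le> _") for n
  proof -
    define H where "H = (\<integral>\<^sup>+w\<in>{w. cmod w < 1 \<and> 1 - cmod w < s n}. h w \<partial>lborel)"
    have sn4: "((2 / s n) ^ 4) powr q = 2 powr (4 * q) * s n powr (- (4 * q))"
    proof -
      have "(2 / s n) ^ 4 = (2 / s n) powr 4" using s[of n] by simp
      then have "((2 / s n) ^ 4) powr q = (2 / s n) powr (4 * q)" by (simp only: powr_powr)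
      also have "\<dots> = 2 powr (4 * q) * s n powr (- (4 * q))" using s[of n] by (simp add: powr_divide powr_minus divide_simps)
      finally show ?thesis .
    qed
    have pt: "ennreal (c1 * s n powr e) * (ennreal ((1 - cmod z) powr (-e)) * v z * ennreal_powr (x n z) q) * indicator \<bbbD> z =
        ennreal (c1 * s n powr e * ((2 / s n) ^ 4) powr q) * (ennreal ((1 - cmod z) powr (-e)) * v z *
          ennreal_powr (\<integral>\<^sup>+w. near_kernel (s n) z w * g w \<partial>lborel) q * indicator \<bbbD> z)" for z
      using q s[of n] by (simp add: x_def ennreal_powr_mult ennreal_mult c1_def mult_ac)
    have "?lhs = ennreal (c1 * s n powr e * ((2 / s n) ^ 4) powr q) *
        (\<integral>\<^sup>+z\<in>\<bbbD>. ennreal ((1 - cmod z) powr (-e)) * v z * ennreal_powr (\<integral>\<^sup>+w. near_kernel (s n) z w * g w \<partial>lborel) q \<partial>lborel)"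
      unfolding pt by (rule nn_integral_cmult) measurable
    also have "\<dots> \<le> ennreal (c1 * s n powr e * ((2 / s n) ^ 4) powr q) * (ennreal (2 powr q * K * (8 * s n) powr (4 * q - e * q)) * H)"
      unfolding H_def h_def using s by (intro mult_left_mono near_operator_le) auto
    also have "\<dots> = ennreal (c1 * s n powr e * ((2 / s n) ^ 4) powr q * (2 powr q * K * (8 * s n) powr (4 * q - e * q))) * H"
      using K by (simp add: c1_def ennreal_mult mult.assoc)
    also have "c1 * s n powr e * ((2 / s n) ^ 4) powr q * (2 powr q * K * (8 * s n) powr (4 * q - e * q)) =
       c1 * c3 * (s n powr e * s n powr (- (4 * q)) * s n powr (4 * q - e * q))"
      unfolding sn4 c3_def using s[of n] by (simp add: powr_mult)
    also have "s n powr e * s n powr (- (4 * q)) * s n powr (4 * q - e * q) = s n powr (- b)"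
    proof -
      have "e + - (4 * q) + (4 * q - e * q) = - b" by (simp add: b_def algebra_simps)
      then show ?thesis by (simp only: powr_add[symmetric])
    qed
    also have "ennreal (c1 * c3 * s n powr (- b)) * H = ennreal (c1 * c3) * (ennreal (s n powr (- b)) * H)"
      using c3 by (simp add: c1_def ennreal_mult mult.assoc)
    also have "ennreal (s n powr (- b)) * H = (\<integral>\<^sup>+w\<in>{w. cmod w < 1 \<and> 1 - cmod w < s n}. ennreal (s n powr (- b)) * h w \<partial>lborel)"
      unfolding H_def by (subst nn_integral_cmult[symmetric]) (auto simp: mult.assoc)
    finally show ?thesis .
  qed
  \<comment> \<open>Only scales above \<open>1 - |w|\<close> count at \<open>w\<close>. Their sum is
    at most \<open>c2 * (1 - |w|) powr (- b)\<close>, which cancels the power of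
    \<open>1 - |w|\<close> in \<open>near_weight\<close> and leaves \<open>\<omega>\<close>.\<close>
  have 4: "(\<Sum>n. \<integral>\<^sup>+w\<in>{w. cmod w < 1 \<and> 1 - cmod w < s n}. ennreal (s n powr (- b)) * h w \<partial>lborel) \<le>
      ennreal c2 * (\<integral>\<^sup>+w\<in>\<bbbD>. ennreal_powr (g w) q * ennreal (\<omega> w) \<partial>lborel)"
  proof -
    have "(\<Sum>n. \<integral>\<^sup>+w\<in>{w. cmod w < 1 \<and> 1 - cmod w < s n}. ennreal (s n powr (- b)) * h w \<partial>lborel) =
        (\<integral>\<^sup>+w. (\<Sum>n. ennreal (s n powr (- b)) * h w * indicator {w. cmod w < 1 \<and> 1 - cmod w < s n} w) \<partial>lborel)"
      by (subst nn_integral_suminf) auto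
    also have "\<dots> \<le> (\<integral>\<^sup>+w. ennreal c2 * (ennreal_powr (g w) q * ennreal (\<omega> w) * indicator \<bbbD> w) \<partial>lborel)"
    proof (rule nn_integral_mono)
      fix w
      show "(\<Sum>n. ennreal (s n powr (- b)) * h w * indicator {w. cmod w < 1 \<and> 1 - cmod w < s n} w) \<le>
          ennreal c2 * (ennreal_powr (g w) q * ennreal (\<omega> w) * indicator \<bbbD> w)"
      proof (cases "w \<in> \<bbbD>")
        case True
        then have d: "0 < 1 - cmod w" by simp
        let ?J = "{n. 1 - cmod w < s n}"
        have "(\<Sum>n. ennreal (s n powr (- b)) * h w * indicator {w. cmod w < 1 \<and> 1 - cmod w < s n} w) =
            (\<integral>\<^sup>+n. ennreal (s n powr (- b)) * h w * indicator {w. cmod w < 1 \<and> 1 - cmod w < s n} w \<partial>count_space UNIV)"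
          by (simp add: nn_integral_count_space_nat)
        also have "\<dots> = (\<integral>\<^sup>+n. ennreal (s n powr (- b)) * h w * indicator {w. cmod w < 1 \<and> 1 - cmod w < s n} w \<partial>count_space ?J)"
          by (intro nn_integral_count_space_eq) (auto simp: indicator_def)
        also have "\<dots> \<le> (\<integral>\<^sup>+n. ennreal (s n powr (- b)) * h w \<partial>count_space ?J)"
          by (intro nn_integral_mono) (auto simp: indicator_def)
        also have "\<dots> = (\<integral>\<^sup>+n. ennreal (s n powr (- b)) \<partial>count_space ?J) * h w" by (rule nn_integral_multc) simp
        also have "\<dots> \<le> ennreal (c2 * (1 - cmod w) powr (- b)) * h w"
          unfolding c2_def s_def using b d by (intro mult_right_mono nn_integral_geometric_powr_le) auto
        also have "ennreal (c2 * (1 - cmod w) powr (- b)) * h w =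
            ennreal_powr (g w) q * (ennreal (c2 * (1 - cmod w) powr (- b)) * ennreal (\<omega> w * (1 - cmod w) powr b))"
          using True by (simp add: h_def near_weight_def b_def mult_ac)
        also have "ennreal (c2 * (1 - cmod w) powr (- b)) * ennreal (\<omega> w * (1 - cmod w) powr b) =
            ennreal ((c2 * (1 - cmod w) powr (- b)) * (\<omega> w * (1 - cmod w) powr b))"
          using \<omega>_pos[of w] by (simp add: ennreal_mult'')
        also have "(c2 * (1 - cmod w) powr (- b)) * (\<omega> w * (1 - cmod w) powr b) = c2 * \<omega> w"
          using d by (simp add: powr_minus field_simps)
        also have "ennreal (c2 * \<omega> w) = ennreal c2 * ennreal (\<omega> w)" using \<omega>_pos[of w] by (simp add: ennreal_mult'')
        finally show ?thesis using True by (simp add: mult_ac)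
      qed simp
    qed
    also have "\<dots> = ennreal c2 * (\<integral>\<^sup>+w\<in>\<bbbD>. ennreal_powr (g w) q * ennreal (\<omega> w) \<partial>lborel)"
      by (rule nn_integral_cmult) measurable
    finally show ?thesis .
  qed
  let ?u = "\<lambda>n z. ennreal (c1 * s n powr e) * (ennreal ((1 - cmod z) powr (-e)) * v z * ennreal_powr (x n z) q)"
  have "(\<integral>\<^sup>+z\<in>\<bbbD>. ennreal_powr (ennreal ((1 - (cmod z)\<^sup>2)\<^sup>2) *
      (\<integral>\<^sup>+w\<in>\<bbbD>. ennreal (1 / cmod (1 - cnj z * w) ^ 4) * g w \<partial>lborel)) q * ennreal (\<omega> z) \<partial>lborel) \<le>
      (\<integral>\<^sup>+z. ennreal (2 powr q) * (ennreal_powr (ennreal (16 ^ 4) * m) q * (v z * indicator \<bbbD> z) +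
        (\<Sum>n. ?u n z * indicator \<bbbD> z)) \<partial>lborel)"
  proof (rule nn_integral_mono)
    fix z
    show "ennreal_powr (ennreal ((1 - (cmod z)\<^sup>2)\<^sup>2) *
      (\<integral>\<^sup>+w\<in>\<bbbD>. ennreal (1 / cmod (1 - cnj z * w) ^ 4) * g w \<partial>lborel)) q * ennreal (\<omega> z) * indicator \<bbbD> z \<le>
      ennreal (2 powr q) * (ennreal_powr (ennreal (16 ^ 4) * m) q * (v z * indicator \<bbbD> z) + (\<Sum>n. ?u n z * indicator \<bbbD> z))"
      using 2[of z] by (cases "z \<in> \<bbbD>") auto
  qed
  also have "\<dots> = ennreal (2 powr q) * (ennreal_powr (ennreal (16 ^ 4) * m) q * (\<integral>\<^sup>+z\<in>\<bbbD>. v z \<partial>lborel) +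
      (\<Sum>n. \<integral>\<^sup>+z\<in>\<bbbD>. ?u n z \<partial>lborel))"
  proof -
    have m1: "(\<lambda>z. ennreal_powr (ennreal (16 ^ 4) * m) q * (v z * indicator \<bbbD> z)) \<in> borel_measurable lborel" by measurable
    have m2: "(\<lambda>z. ?u n z * indicator \<bbbD> z) \<in> borel_measurable lborel" for n by measurable
    have m3: "(\<lambda>z. \<Sum>n. ?u n z * indicator \<bbbD> z) \<in> borel_measurable lborel"
      by (rule borel_measurable_suminf_order) (rule m2)
    have "(\<integral>\<^sup>+z. ennreal_powr (ennreal (16 ^ 4) * m) q * (v z * indicator \<bbbD> z) \<partial>lborel) =
        ennreal_powr (ennreal (16 ^ 4) * m) q * (\<integral>\<^sup>+z\<in>\<bbbD>. v z \<partial>lborel)"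
      by (rule nn_integral_cmult) measurable
    moreover have "(\<integral>\<^sup>+z. (\<Sum>n. ?u n z * indicator \<bbbD> z) \<partial>lborel) = (\<Sum>n. \<integral>\<^sup>+z\<in>\<bbbD>. ?u n z \<partial>lborel)"
      by (rule nn_integral_suminf) (rule m2)
    ultimately show ?thesis
      using nn_integral_cmult[OF borel_measurable_add[OF m1 m3], of "ennreal (2 powr q)"] nn_integral_add[OF m1 m3]
      by (simp only:)
  qed
  also have "\<dots> \<le> ennreal (2 powr q) * (ennreal_powr (ennreal (16 ^ 4) * m) q * (\<integral>\<^sup>+z\<in>\<bbbD>. v z \<partial>lborel) +
      (\<Sum>n. ennreal (c1 * c3) * (\<integral>\<^sup>+w\<in>{w. cmod w < 1 \<and> 1 - cmod w < s n}. ennreal (s n powr (- b)) * h w \<partial>lborel)))"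
    by (intro mult_left_mono add_left_mono suminf_le 3) auto
  also have "\<dots> \<le> ennreal (2 powr q) * (ennreal_powr (ennreal (16 ^ 4) * m) q * (\<integral>\<^sup>+z\<in>\<bbbD>. v z \<partial>lborel) +
      ennreal (c1 * c3) * (ennreal c2 * (\<integral>\<^sup>+w\<in>\<bbbD>. ennreal_powr (g w) q * ennreal (\<omega> w) \<partial>lborel)))"
    using 4 by (intro mult_left_mono add_left_mono) (auto simp: mult_left_mono)
  also have "\<dots> < top"
  proof -
    have "m \<noteq> top" using g1 by (simp add: m_def)
    then have "ennreal_powr (ennreal (16 ^ 4) * m) q \<noteq> top" by (auto simp: ennreal_mult_eq_top_iff)
    then show ?thesis using nn_integral_v_fin gq
      by (auto simp: ennreal_mult_less_top less_top[symmetric] ennreal_mult_eq_top_iff ennreal_add_eq_top)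
  qed
  finally show ?thesis .
qed

lemma nn_integral_\<sigma>_annulus_fin: "(\<integral>\<^sup>+z\<in>{z. 1/2 < cmod z \<and> cmod z < 1}. \<sigma> z \<partial>lborel) < top"
proof -
  have [measurable]: "polar_square (1/2) \<theta> \<in> sets borel" for \<theta> by simp
  have "(\<integral>\<^sup>+z\<in>{z. 1/2 < cmod z \<and> cmod z < 1}. \<sigma> z \<partial>lborel) \<le>
      (\<integral>\<^sup>+z. (\<Sum>j\<in>{-16..16::int}. \<sigma> z * indicator (polar_square (1/2) (real_of_int j / 4)) z) \<partial>lborel)"
  proof (rule nn_integral_mono)
    fix z
    show "\<sigma> z * indicator {z. 1/2 < cmod z \<and> cmod z < 1} z \<le>
        (\<Sum>j\<in>{-16..16::int}. \<sigma> z * indicator (polar_square (1/2) (real_of_int j / 4)) z)"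
    proof (cases "1/2 < cmod z \<and> cmod z < 1")
      case True
      then obtain j where j: "j \<in> {-16..16::int}" "z \<in> polar_square (1/2) (real_of_int j / 4)"
        using annulus_subset_polar_squares by blast
      have "\<sigma> z * indicator (polar_square (1/2) (real_of_int j / 4)) z \<le>
          (\<Sum>j\<in>{-16..16::int}. \<sigma> z * indicator (polar_square (1/2) (real_of_int j / 4)) z)"
        using j by (intro member_le_sum) auto
      then show ?thesis using True j by simp
    qed simp
  qed
  also have "\<dots> = (\<Sum>j\<in>{-16..16::int}. \<integral>\<^sup>+z\<in>polar_square (1/2) (real_of_int j / 4). \<sigma> z \<partial>lborel)"
    by (rule nn_integral_sum) measurable
  also have "\<dots> < top" using doubling(2)[of "1/2"] by (simp add: less_top[symmetric])
  finally show ?thesis .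
qed

text \<open>Hoelder's inequality turns integrability of the \<open>q\<close>-th power against
  \<open>\<omega>\<close> into plain integrability near the circle, which
  \<open>Berezin_bounded\<close> requires; the dual weight has finite mass on finitely many squares
  covering the annulus.\<close>

lemma nn_integral_annulus_fin:
  fixes g :: "complex \<Rightarrow> ennreal"
  assumes [measurable]: "g \<in> borel_measurable borel"
    and gq: "(\<integral>\<^sup>+w\<in>\<bbbD>. ennreal_powr (g w) q * ennreal (\<omega> w) \<partial>lborel) < top"
  shows "(\<integral>\<^sup>+w\<in>{z. 1/2 < cmod z \<and> cmod z < 1}. g w \<partial>lborel) < top"
proof -
  let ?A = "{z :: complex. 1/2 < cmod z \<and> cmod z < 1}"
  have "open ?A" by (intro open_Collect_conj open_Collect_less continuous_intros)
  then have [measurable]: "?A \<in> sets borel" by simp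
  have "ennreal_powr (\<integral>\<^sup>+w\<in>?A. g w \<partial>lborel) q \<le> (\<integral>\<^sup>+w\<in>?A. ennreal_powr (g w) q * ennreal (\<omega> w) \<partial>lborel) *
    ennreal_powr (\<integral>\<^sup>+w\<in>?A. ennreal (\<omega> w powr (- 1 / (q - 1))) \<partial>lborel) (q - 1)"
    using q \<omega>_pos by (intro set_nn_integral_Holder) auto
  also have "\<dots> \<le> (\<integral>\<^sup>+w\<in>\<bbbD>. ennreal_powr (g w) q * ennreal (\<omega> w) \<partial>lborel) * ennreal_powr (\<integral>\<^sup>+w\<in>?A. \<sigma> w \<partial>lborel) (q - 1)"
    unfolding \<sigma>_def by (intro mult_mono nn_integral_mono mult_left_mono) (auto simp: indicator_def)
  also have "\<dots> < top"
    using gq nn_integral_\<sigma>_annulus_fin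
    by (auto simp: ennreal_mult_less_top less_top[symmetric] ennreal_mult_eq_top_iff)
  finally show ?thesis by (simp add: less_top[symmetric])
qed

end

section \<open>Conformal change of variables\<close>

text \<open>The change of variables formula is applied in \<open>real^2\<close>; this measure
  preserving identification carries it over to \<open>complex\<close>.\<close>

definition complex_of_vec :: "real^2 \<Rightarrow> complex" where
  "complex_of_vec v = Complex (v $ 1) (v $ 2)"

definition vec_of_complex :: "complex \<Rightarrow> real^2" where
  "vec_of_complex z = vector [Re z, Im z]"

lemma complex_of_vec_inverse [simp]:
  "complex_of_vec (vec_of_complex z) = z" "vec_of_complex (complex_of_vec v) = v"
  by (auto simp: complex_of_vec_def vec_of_complex_def complex_eq_iff vec_eq_iff forall_2 vector_2)

lemma bounded_linear_complex_of_vec: "bounded_linear complex_of_vec"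
  unfolding complex_of_vec_def linear_conv_bounded_linear[symmetric]
  by (intro linearI) (auto simp: complex_eq_iff)

lemma bounded_linear_vec_of_complex: "bounded_linear vec_of_complex"
  unfolding vec_of_complex_def linear_conv_bounded_linear[symmetric]
  by (intro linearI) (auto simp: vec_eq_iff forall_2 vector_2)

lemma borel_complex_of_vec [measurable]: "complex_of_vec \<in> borel_measurable borel"
  using bounded_linear_complex_of_vec by (intro borel_measurable_continuous_onI linear_continuous_on)

lemma distr_complex_of_vec: "distr lborel borel complex_of_vec = lborel"
proof (rule lborel_eqI[symmetric])
  fix l u :: complex assume lu: "\<And>b. b \<in> Basis \<Longrightarrow> l \<bullet> b \<le> u \<bullet> b"
  have r: "Re l \<le> Re u" "Im l \<le> Im u" using lu[of 1] lu[of \<i>] by (auto simp: Basis_complex_def)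
  have "complex_of_vec -` box l u = box (vec_of_complex l) (vec_of_complex u)"
    by (auto simp: box_def Basis_complex_def complex_of_vec_def vec_of_complex_def Basis_vec_def inner_axis
        vector_2 forall_2)
  moreover have B: "Basis = {axis (1::2) (1::real), axis 2 1}" by (auto simp: Basis_vec_def UNIV_2)
  moreover have "(\<Prod>b\<in>Basis. (vec_of_complex u - vec_of_complex l) \<bullet> b) = (Re u - Re l) * (Im u - Im l)"
    unfolding B by (subst prod.insert) (auto simp: inner_axis vec_of_complex_def axis_eq_axis)
  moreover have "vec_of_complex l \<bullet> b \<le> vec_of_complex u \<bullet> b" if "b \<in> Basis" for b
    using that r unfolding B by (auto simp: inner_axis vec_of_complex_def vector_2)
  ultimately have "emeasure lborel (complex_of_vec -` box l u) = ennreal ((Re u - Re l) * (Im u - Im l))"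
    by (simp only: emeasure_lborel_box)
  then show "emeasure (distr lborel borel complex_of_vec) (box l u) = ennreal (\<Prod>b\<in>Basis. (u - l) \<bullet> b)"
    by (simp add: emeasure_distr Basis_complex_def)
qed simp

lemma nn_integral_complex_of_vec:
  assumes [measurable]: "f \<in> borel_measurable borel"
  shows "(\<integral>\<^sup>+z. f z \<partial>lborel) = (\<integral>\<^sup>+v. f (complex_of_vec v) \<partial>lborel)"
  by (subst distr_complex_of_vec[symmetric], rule nn_integral_distr) auto

lemma distr_Complex: "distr lborel borel (\<lambda>(x, y). Complex x y) = lborel"
proof (rule lborel_eqI[symmetric])
  have m: "(\<lambda>(x, y). Complex x y) \<in> borel_measurable (borel :: (real \<times> real) measure)"
    by (intro borel_measurable_continuous_onI) (auto intro!: continuous_intros simp: split_beta Complex_eq)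
  fix l u :: complex assume lu: "\<And>b. b \<in> Basis \<Longrightarrow> l \<bullet> b \<le> u \<bullet> b"
  have r: "Re l \<le> Re u" "Im l \<le> Im u" using lu[of 1] lu[of \<i>] by (auto simp: Basis_complex_def)
  have "(\<lambda>(x, y). Complex x y) -` box l u = box (Re l) (Re u) \<times> box (Im l) (Im u)"
    by (auto simp: box_def Basis_complex_def)
  then have "emeasure (distr lborel borel (\<lambda>(x, y). Complex x y)) (box l u) =
      emeasure (lborel \<Otimes>\<^sub>M lborel) (box (Re l) (Re u) \<times> box (Im l) (Im u))"
    using m by (subst emeasure_distr) (auto simp: lborel_prod)
  also have "\<dots> = emeasure lborel (box (Re l) (Re u)) * emeasure lborel (box (Im l) (Im u))"
    by (rule lborel.emeasure_pair_measure_Times) auto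
  finally show "emeasure (distr lborel borel (\<lambda>(x, y). Complex x y)) (box l u) = ennreal (\<Prod>b\<in>Basis. (u - l) \<bullet> b)"
    using r by (simp add: Basis_complex_def ennreal_mult)
qed simp

lemma nn_integral_Complex:
  assumes [measurable]: "f \<in> borel_measurable borel"
  shows "(\<integral>\<^sup>+z. f z \<partial>lborel) = (\<integral>\<^sup>+x. (\<integral>\<^sup>+y. f (Complex x y) \<partial>lborel) \<partial>lborel)"
proof -
  have m: "(\<lambda>(x, y). Complex x y) \<in> borel_measurable (borel :: (real \<times> real) measure)"
    by (intro borel_measurable_continuous_onI) (auto intro!: continuous_intros simp: split_beta Complex_eq)
  have m2: "(\<lambda>p. f (case p of (x, y) \<Rightarrow> Complex x y)) \<in> borel_measurable (lborel \<Otimes>\<^sub>M lborel)"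
    using measurable_compose[OF m assms] by (simp add: lborel_prod)
  have "(\<integral>\<^sup>+z. f z \<partial>lborel) = (\<integral>\<^sup>+p. f (case p of (x, y) \<Rightarrow> Complex x y) \<partial>lborel)"
    using m by (subst distr_Complex[symmetric], subst nn_integral_distr) auto
  also have "\<dots> = (\<integral>\<^sup>+p. f (case p of (x, y) \<Rightarrow> Complex x y) \<partial>(lborel \<Otimes>\<^sub>M lborel))" by (simp add: lborel_prod)
  also have "\<dots> = (\<integral>\<^sup>+x. (\<integral>\<^sup>+y. f (Complex x y) \<partial>lborel) \<partial>lborel)"
    by (subst lborel.nn_integral_fst[OF m2, symmetric]) simp
  finally show ?thesis .
qed

lemma det_matrix_complex_mult:
  "det (matrix (\<lambda>v. vec_of_complex (c * complex_of_vec v))) = (cmod c)\<^sup>2"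
  unfolding cmod_power2
  by (simp add: det_2 matrix_def vec_of_complex_def complex_of_vec_def axis_def power2_eq_square)

text \<open>The Jacobian of a holomorphic map is \<open>|deriv \<psi>|^2\<close>. As an inequality
  the claim is trivial for an infinite right-hand side, so the formula for absolutely integrable
  functions settles the rest.\<close>

lemma nn_integral_conformal_le:
  assumes S: "open S" and hol: "\<psi> holomorphic_on S" and inj: "inj_on \<psi> S"
    and F [measurable]: "F \<in> borel_measurable borel" and F0: "\<And>w. 0 \<le> F w"
  shows "(\<integral>\<^sup>+z\<in>S. ennreal (F (\<psi> z) * (cmod (deriv \<psi> z))\<^sup>2) \<partial>lborel) \<le> (\<integral>\<^sup>+w\<in>\<psi> ` S. ennreal (F w) \<partial>lborel)"
proof (cases "(\<integral>\<^sup>+w\<in>\<psi> ` S. ennreal (F w) \<partial>lborel) = top")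
  case False
  define T where "T = \<psi> ` S"
  have "open T" unfolding T_def using open_mapping_thm3[OF hol S inj] .
  then have [measurable]: "T \<in> sets borel" "S \<in> sets borel" using S by auto
  define S' where "S' = complex_of_vec -` S"
  define T' where "T' = complex_of_vec -` T"
  have "open S'" "open T'" unfolding S'_def T'_def using S \<open>open T\<close> bounded_linear_complex_of_vec
    by (auto intro!: open_vimage linear_continuous_on)
  then have [measurable]: "S' \<in> sets borel" "T' \<in> sets borel" by auto
  define g where "g v = vec_of_complex (\<psi> (complex_of_vec v))" for v
  define g' where "g' v h = vec_of_complex (deriv \<psi> (complex_of_vec v) * complex_of_vec h)" for v h
  have der: "(g has_derivative g' v) (at v within S')" if "v \<in> S'" for v
  proof -
    have "(\<psi> has_derivative (*) (deriv \<psi> (complex_of_vec v))) (at (complex_of_vec v))"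
      using holomorphic_derivI[OF hol S] that by (simp add: S'_def has_field_derivative_def)
    from diff_chain_at[OF bounded_linear_imp_has_derivative[OF bounded_linear_complex_of_vec] this]
    have "(\<psi> \<circ> complex_of_vec has_derivative (\<lambda>h. deriv \<psi> (complex_of_vec v) * complex_of_vec h)) (at v)"
      by (simp add: o_def)
    from diff_chain_at[OF this bounded_linear_imp_has_derivative[OF bounded_linear_vec_of_complex]]
    have "(g has_derivative g' v) (at v)" by (simp add: o_def g_def[abs_def] g'_def[abs_def])
    then show ?thesis by (rule has_derivative_at_withinI)
  qed
  have injg: "inj_on g S'"
  proof (rule inj_onI)
    fix x y assume "x \<in> S'" "y \<in> S'" "g x = g y"
    then have "\<psi> (complex_of_vec x) = \<psi> (complex_of_vec y)" unfolding g_def by (metis complex_of_vec_inverse(1))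
    then have "complex_of_vec x = complex_of_vec y" using inj \<open>x \<in> S'\<close> \<open>y \<in> S'\<close> by (auto simp: S'_def dest: inj_onD)
    then show "x = y" by (metis complex_of_vec_inverse(2))
  qed
  have gS: "g ` S' = T'"
  proof (intro equalityI subsetI)
    fix y assume "y \<in> T'"
    then obtain z where z: "z \<in> S" "complex_of_vec y = \<psi> z" by (auto simp: T'_def T_def)
    then have "y = g (vec_of_complex z)" unfolding g_def by (metis complex_of_vec_inverse)
    then show "y \<in> g ` S'" using z by (auto simp: S'_def)
  qed (auto simp: g_def S'_def T'_def T_def)
  have detg: "\<bar>det (matrix (g' v))\<bar> = (cmod (deriv \<psi> (complex_of_vec v)))\<^sup>2" for v
    unfolding g'_def[abs_def] det_matrix_complex_mult by simp
  let ?f = "\<lambda>v. F (complex_of_vec v)"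
  have Teq: "(\<integral>\<^sup>+w\<in>T. ennreal (F w) \<partial>lborel) = (\<integral>\<^sup>+v. ennreal (indicator T' v * ?f v) \<partial>lborel)"
    by (subst nn_integral_complex_of_vec) (auto intro!: nn_integral_cong simp: T'_def indicator_def)
  have int: "integrable lborel (\<lambda>v. indicator T' v * ?f v)"
  proof (rule integrableI_nonneg)
    show "(\<integral>\<^sup>+v. ennreal (indicator T' v * ?f v) \<partial>lborel) < \<infinity>" using False Teq by (simp add: T_def less_top)
  qed (auto simp: F0)
  then have "integrable lebesgue (\<lambda>v. indicator T' v * ?f v)" by (subst integrable_completion) auto
  then have absT: "?f absolutely_integrable_on T'" by (simp add: set_integrable_def)
  \<comment> \<open>The change of variables formula is stated for vector-valued functions, so the
    real integrand is viewed in \<open>real^1\<close>.\<close>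
  have "(\<lambda>v. (vec (?f v) :: real^1)) absolutely_integrable_on T' \<and>
      integral T' (\<lambda>v. (vec (?f v) :: real^1)) = vec (integral T' ?f)"
    using absT by (simp add: absolutely_integrable_on_1_iff integral_on_1_eq vec_eq_iff)
  then have "(\<lambda>v. \<bar>det (matrix (g' v))\<bar> *\<^sub>R (vec (?f (g v)) :: real^1)) absolutely_integrable_on S' \<and>
      integral S' (\<lambda>v. \<bar>det (matrix (g' v))\<bar> *\<^sub>R (vec (?f (g v)) :: real^1)) = vec (integral T' ?f)"
    unfolding gS[symmetric]
    by (subst has_absolute_integral_change_of_variables[OF _ der injg]) auto
  then have absS: "(\<lambda>v. \<bar>det (matrix (g' v))\<bar> * ?f (g v)) absolutely_integrable_on S'"
    and intS: "integral S' (\<lambda>v. \<bar>det (matrix (g' v))\<bar> * ?f (g v)) = integral T' ?f"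
    by (auto simp: absolutely_integrable_on_1_iff integral_on_1_eq vec_eq_iff)
  let ?G = "\<lambda>v. F (\<psi> (complex_of_vec v)) * (cmod (deriv \<psi> (complex_of_vec v)))\<^sup>2"
  have G: "(\<lambda>v. \<bar>det (matrix (g' v))\<bar> * ?f (g v)) = ?G" by (auto simp: detg g_def mult.commute)
  have mS: "(\<lambda>z. ennreal (F (\<psi> z) * (cmod (deriv \<psi> z))\<^sup>2) * indicator S z) \<in> borel_measurable borel"
  proof -
    have "\<psi> \<in> borel_measurable (restrict_space borel S)" "deriv \<psi> \<in> borel_measurable (restrict_space borel S)"
      using hol S by (auto intro!: borel_measurable_continuous_on_restrict holomorphic_on_imp_continuous_on holomorphic_deriv)
    then have "(\<lambda>z. ennreal (F (\<psi> z) * (cmod (deriv \<psi> z))\<^sup>2)) \<in> borel_measurable (restrict_space borel S)"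
      by measurable
    then show ?thesis by (subst (asm) borel_measurable_restrict_space_iff_ennreal) auto
  qed
  have "(\<integral>\<^sup>+z\<in>S. ennreal (F (\<psi> z) * (cmod (deriv \<psi> z))\<^sup>2) \<partial>lborel) = (\<integral>\<^sup>+v. ennreal (indicator S' v * ?G v) \<partial>lborel)"
    by (subst nn_integral_complex_of_vec[OF mS]) (auto intro!: nn_integral_cong simp: S'_def indicator_def)
  also have "\<dots> = (\<integral>\<^sup>+v. ennreal (indicator S' v * ?G v) \<partial>lebesgue)" by (simp add: nn_integral_completion)
  also have "\<dots> = ennreal (\<integral>v. indicator S' v * ?G v \<partial>lebesgue)"
    using absS F0 unfolding G set_integrable_def by (intro nn_integral_eq_integral) (auto intro!: AE_I2)
  also have "(\<integral>v. indicator S' v * ?G v \<partial>lebesgue) = integral S' ?G"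
    using set_lebesgue_integral_eq_integral(2)[OF absS] unfolding G by (simp add: set_lebesgue_integral_def)
  also have "\<dots> = integral T' ?f" using intS unfolding G .
  also have "\<dots> = (\<integral>v. indicator T' v * ?f v \<partial>lebesgue)"
    using set_lebesgue_integral_eq_integral(2)[OF absT] by (simp add: set_lebesgue_integral_def)
  also have "\<dots> = (\<integral>v. indicator T' v * ?f v \<partial>lborel)" by (subst integral_completion) auto
  also have "ennreal \<dots> = (\<integral>\<^sup>+v. ennreal (indicator T' v * ?f v) \<partial>lborel)"
    using int F0 by (intro nn_integral_eq_integral[symmetric]) auto
  finally show ?thesis using Teq by (simp add: T_def)
qed simp

section \<open>Mean values of functions with zeros\<close>

text \<open>Cauchy's formula at the centre, with the circle parametrised over \<open>{0..1}\<close>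
  as in \<open>circlepath\<close>.\<close>

lemma circle_mean_ge:
  assumes H: "H holomorphic_on ball 0 R" and r: "0 < r" "r < R"
  shows "ennreal (cmod (H 0)) \<le> (\<integral>\<^sup>+t\<in>{0..1}. ennreal (cmod (H (of_real r * exp (2 * of_real pi * \<i> * of_real t)))) \<partial>lborel)"
proof -
  define c where "c t = complex_of_real r * exp (2 * of_real pi * \<i> * of_real t)" for t :: real
  have cn: "cmod (c t) = r" for t using r by (simp add: c_def norm_mult)
  have c0: "c t \<noteq> 0" for t using r by (simp add: c_def)
  have "H holomorphic_on cball 0 r" using H r by (auto intro: holomorphic_on_subset)
  then have "((\<lambda>u. H u / (u - 0)) has_contour_integral (2 * of_real pi * \<i> * H 0)) (circlepath 0 r)"
    using r by (intro Cauchy_integral_circlepath_simple) auto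
  then have "((\<lambda>t. H (c t) / c t * (2 * pi * \<i> * c t)) has_integral (2 * of_real pi * \<i> * H 0)) {0..1}"
    unfolding has_contour_integral vector_derivative_circlepath by (simp add: circlepath c_def mult_ac)
  then have "((\<lambda>t. (2 * of_real pi * \<i>) * H (c t)) has_integral (2 * of_real pi * \<i> * H 0)) {0..1}"
    using c0 by (simp add: mult_ac)
  from has_integral_mult_right[OF this, of "1 / (2 * of_real pi * \<i>)"]
  have I: "((\<lambda>t. H (c t)) has_integral H 0) {0..1}" by simp
  have "continuous_on {0..1} (\<lambda>t. H (c t))"
  proof (rule continuous_on_compose2[OF holomorphic_on_imp_continuous_on[OF H]])
    show "continuous_on {0..1} c" unfolding c_def by (intro continuous_intros)
  qed (use cn r in auto)
  then have si: "set_integrable lborel {0..1} (\<lambda>t. H (c t))" by (rule borel_integrable_atLeastAtMost')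
  have "H 0 = (LINT t : {0..1} | lborel. H (c t))"
    using set_borel_integral_eq_integral(2)[OF si] integral_unique[OF I] by simp
  then have "ennreal (cmod (H 0)) \<le> (\<integral>\<^sup>+t. cmod (indicator {0..1} t *\<^sub>R H (c t)) \<partial>lborel)"
    using integral_norm_bound_ennreal[OF si[unfolded set_integrable_def]] by (simp add: set_lebesgue_integral_def)
  also have "\<dots> = (\<integral>\<^sup>+t\<in>{0..1}. ennreal (cmod (H (c t))) \<partial>lborel)"
    by (intro nn_integral_cong) (auto simp: indicator_def)
  finally show ?thesis unfolding c_def .
qed

text \<open>A zero-free function on a disc has a logarithm \<open>g\<close>, so
  \<open>|G| powr s\<close> is the modulus of the holomorphic function \<open>exp (s * g)\<close>
  for every real \<open>s\<close>.\<close>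

lemma circle_powr_mean_ge:
  assumes G: "G holomorphic_on ball 0 R" and nz: "\<And>w. w \<in> ball 0 R \<Longrightarrow> G w \<noteq> 0" and r: "0 < r" "r < R"
  shows "ennreal (cmod (G 0) powr s) \<le>
    (\<integral>\<^sup>+t\<in>{0..1}. ennreal (cmod (G (of_real r * exp (2 * of_real pi * \<i> * of_real t))) powr s) \<partial>lborel)"
proof -
  obtain g where g: "g holomorphic_on ball 0 R" "\<And>w. w \<in> ball 0 R \<Longrightarrow> G w = exp (g w)"
    using contractible_imp_holomorphic_log[OF G convex_imp_contractible[OF convex_ball] nz] by metis
  define H where "H w = exp (of_real s * g w)" for w
  have H: "H holomorphic_on ball 0 R" unfolding H_def by (intro holomorphic_intros g)
  have HG: "cmod (H w) = cmod (G w) powr s" if "w \<in> ball 0 R" for w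
    using g(2)[OF that] by (simp add: H_def powr_def)
  have in_ball: "of_real r * exp (2 * of_real pi * \<i> * of_real t) \<in> ball 0 R" for t :: real
    using r by (simp add: norm_mult)
  show ?thesis using circle_mean_ge[OF H r] HG[OF in_ball] HG[of 0] r by simp
qed

section \<open>Moebius coordinates and factorisation of zeros\<close>

lemma disc_involution_involutive:
  assumes "cmod z < 1" "cmod w < 1"
  shows "disc_involution z (disc_involution z w) = w"
proof -
  have nz: "1 - cnj z * w \<noteq> 0" "1 - cnj z * z \<noteq> 0"
    using one_minus_cnj_mult_nonzero assms by auto
  have 1: "z - (z - w) / (1 - cnj z * w) = w * (1 - cnj z * z) / (1 - cnj z * w)"
    using nz by (simp add: field_simps)
  have 2: "1 - cnj z * ((z - w) / (1 - cnj z * w)) = (1 - cnj z * z) / (1 - cnj z * w)"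
    using nz by (simp add: field_simps)
  show ?thesis unfolding disc_involution_def 1 2 using nz by simp
qed

lemma disc_involution_0 [simp]: "disc_involution z 0 = z"
  by (simp add: disc_involution_def)

lemma cmod_disc_involution_commute: "cmod (disc_involution a z) = cmod (disc_involution z a)"
proof -
  have "cmod (1 - cnj a * z) = cmod (cnj (1 - cnj a * z))" by (simp only: complex_mod_cnj)
  also have "cnj (1 - cnj a * z) = 1 - cnj z * a" by simp
  finally show ?thesis by (simp add: disc_involution_def norm_divide norm_minus_commute)
qed

text \<open>In the coordinate given by \<open>disc_involution z\<close>, a zero factor is again a
  linear factor, times a function without zeros.\<close>

lemma disc_involution_diff:
  assumes "cmod z < 1" "cmod w < 1" "cmod b < 1"
  shows "disc_involution z w - disc_involution z b =
    - ((1 - cnj z * z) / ((1 - cnj z * b) * (1 - cnj z * w))) * (w - b)"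
proof -
  have nz: "1 - cnj z * w \<noteq> 0" "1 - cnj z * b \<noteq> 0"
    using one_minus_cnj_mult_nonzero assms by auto
  show ?thesis unfolding disc_involution_def using nz
    by (simp add: divide_simps) (simp add: algebra_simps)
qed

lemma disc_involution_has_field_derivative:
  assumes "cmod z < 1" "cmod w < 1"
  shows "(disc_involution z has_field_derivative (- (1 - cnj z * z) / (1 - cnj z * w)\<^sup>2)) (at w)"
proof -
  have nz: "1 - cnj z * w \<noteq> 0" using one_minus_cnj_mult_nonzero assms by auto
  show ?thesis unfolding disc_involution_def[abs_def]
    by (rule derivative_eq_intros refl nz)+ (use nz in \<open>simp add: power2_eq_square algebra_simps\<close>)
qed

lemma holomorphic_disc_involution:
  assumes "cmod z < 1"
  shows "disc_involution z holomorphic_on \<bbbD>"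
  unfolding disc_involution_def[abs_def] using one_minus_cnj_mult_nonzero[OF assms]
  by (intro holomorphic_intros) auto

lemma disc_involution_in_disc: "cmod z < 1 \<Longrightarrow> w \<in> \<bbbD> \<Longrightarrow> disc_involution z w \<in> \<bbbD>"
  using cmod_disc_involution_less_1 by simp

lemma zorder_linear: "zorder (\<lambda>w. w - a) a = 1" for a :: complex
  by (rule zorder_eqI[where S = UNIV and g = "\<lambda>_. 1"]) auto

lemma zorder_pos_iff_disc:
  assumes u: "u holomorphic_on \<bbbD>" and nz: "\<exists>z\<in>\<bbbD>. u z \<noteq> 0" and z: "z \<in> \<bbbD>"
  shows "zorder u z > 0 \<longleftrightarrow> u z = 0"
proof (rule zorder_pos_iff[OF u _ z])
  obtain b where "b \<in> \<bbbD>" "u b \<noteq> 0" using nz by blast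
  then have "eventually (\<lambda>w. u w \<noteq> 0 \<and> w \<in> \<bbbD>) (at z)"
    by (intro non_zero_neighbour_alt[where \<beta> = b] u z) auto
  then have "eventually (\<lambda>w. u w \<noteq> 0) (at z)" by eventually_elim auto
  then show "frequently (\<lambda>w. u w \<noteq> 0) (at z)" by (rule eventually_frequently[rotated]) simp
qed simp

lemma zero_sequence_eq_0_iff:
  assumes f: "f holomorphic_on \<bbbD>" and nz: "\<exists>z\<in>\<bbbD>. f z \<noteq> 0" and Z: "is_zero_sequence_of Z f" and z: "z \<in> \<bbbD>"
  shows "f z = 0 \<longleftrightarrow> (\<exists>i\<in>seq_index Z. snd Z i = z)"
proof -
  have fin: "finite {i\<in>seq_index Z. snd Z i = z}" and card: "int (card {i\<in>seq_index Z. snd Z i = z}) = zorder f z"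
    using Z z unfolding is_zero_sequence_of_def by auto
  have "f z = 0 \<longleftrightarrow> card {i\<in>seq_index Z. snd Z i = z} > 0"
    using zorder_pos_iff_disc[OF f nz z] unfolding card[symmetric] by simp
  then show ?thesis using fin by (auto simp: card_gt_0_iff)
qed

lemma zero_sequence_in_disc:
  assumes "is_zero_sequence_of Z f" "i \<in> seq_index Z"
  shows "cmod (snd Z i) < 1"
  using assms by (auto simp: is_zero_sequence_of_def seq_in_def)

text \<open>\<open>A\<close> is a pseudohyperbolic disc about \<open>z\<close> contained in a
  compact subset of the unit disc, so it meets only finitely many zeros. The polynomial formed from
  them has the same orders as \<open>f\<close> on \<open>A\<close>, and the quotient is
  zero-free.\<close>

lemma zero_sequence_factorization:
  assumes f: "f holomorphic_on \<bbbD>" and nz: "\<exists>u\<in>\<bbbD>. f u \<noteq> 0" and Z: "is_zero_sequence_of Z f"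
    and z: "cmod z < 1" and R: "0 < R" "R < 1"
  defines "I \<equiv> {i \<in> seq_index Z. cmod (disc_involution z (snd Z i)) < R}"
  defines "A \<equiv> {u \<in> \<bbbD>. cmod (disc_involution z u) < R}"
  shows "finite I \<and> open A \<and> (\<exists>h. h holomorphic_on A \<and> (\<forall>u\<in>A. h u \<noteq> 0) \<and> (\<forall>u\<in>A. f u = h u * (\<Prod>i\<in>I. u - snd Z i)))"
proof -
  have aD: "snd Z i \<in> \<bbbD>" if "i \<in> seq_index Z" for i using zero_sequence_in_disc[OF Z that] by simp
  have fib: "finite {i\<in>seq_index Z. snd Z i = u}" and card: "int (card {i\<in>seq_index Z. snd Z i = u}) = zorder f u"
    if "u \<in> \<bbbD>" for u using Z that unfolding is_zero_sequence_of_def by blast+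
  note zero_iff = zero_sequence_eq_0_iff[OF f nz Z]
  define K where "K = disc_involution z ` cball 0 R"
  have cont: "continuous_on \<bbbD> (disc_involution z)"
    using holomorphic_disc_involution[OF z] holomorphic_on_imp_continuous_on by blast
  have KD: "K \<subseteq> \<bbbD>" unfolding K_def using disc_involution_in_disc[OF z] R by auto
  have "compact K" unfolding K_def using R
    by (intro compact_continuous_image continuous_on_subset[OF cont]) auto
  have finK: "finite {u\<in>K. f u = 0}"
  proof (cases "f constant_on \<bbbD>")
    case True
    then have "f u \<noteq> 0" if "u \<in> \<bbbD>" for u using nz that unfolding constant_on_def by metis
    then have "{u\<in>K. f u = 0} = {}" using KD by blast
    then show ?thesis by (simp only: finite.emptyI)
  next
    case False
    show ?thesis by (rule holomorphic_compact_finite_zeros[OF f _ _ \<open>compact K\<close> KD False]) auto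
  qed
  have AK: "A \<subseteq> K"
  proof
    fix u assume u: "u \<in> A"
    then have "u = disc_involution z (disc_involution z u)" using disc_involution_involutive[OF z, of u] by (simp add: A_def)
    then show "u \<in> K" using u by (auto simp: K_def A_def)
  qed
  have aA: "snd Z i \<in> A" if "i \<in> I" for i using that aD by (auto simp: I_def A_def)
  have "I \<subseteq> (\<Union>u\<in>{u\<in>K. f u = 0}. {i\<in>seq_index Z. snd Z i = u})"
  proof
    fix i assume i: "i \<in> I"
    then have "i \<in> seq_index Z" by (simp add: I_def)
    then show "i \<in> (\<Union>u\<in>{u\<in>K. f u = 0}. {i\<in>seq_index Z. snd Z i = u})" using aA[OF i] AK KD zero_iff by blast
  qed
  moreover have "finite (\<Union>u\<in>{u\<in>K. f u = 0}. {i\<in>seq_index Z. snd Z i = u})" using finK KD fib by blast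
  ultimately have finI: "finite I" by (rule finite_subset)
  have A_eq: "A = \<bbbD> \<inter> disc_involution z -` ball 0 R" by (auto simp: A_def)
  then have openA: "open A" using continuous_open_preimage[OF cont] by simp
  have A_img: "A = disc_involution z ` ball 0 R"
  proof (intro equalityI subsetI)
    fix u assume u: "u \<in> A"
    then have "u = disc_involution z (disc_involution z u)" using disc_involution_involutive[OF z, of u] by (simp add: A_def)
    then show "u \<in> disc_involution z ` ball 0 R" using u by (auto simp: A_def)
  next
    fix u assume "u \<in> disc_involution z ` ball 0 R"
    then obtain w where w: "cmod w < R" "u = disc_involution z w" by auto
    then have "cmod w < 1" using R by simp
    then show "u \<in> A" using w disc_involution_involutive[OF z, of w] disc_involution_in_disc[OF z, of w] by (simp add: A_def)
  qed
  have connA: "connected A" unfolding A_img using R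
    by (intro connected_continuous_image continuous_on_subset[OF cont]) auto
  have AD: "A \<subseteq> \<bbbD>" by (auto simp: A_def)
  define P where "P u = (\<Prod>i\<in>I. u - snd Z i)" for u
  have PI: "{i\<in>I. snd Z i = u} = {i\<in>seq_index Z. snd Z i = u}" if "u \<in> A" for u
    using that by (auto simp: I_def A_def)
  have Phol: "P holomorphic_on A" unfolding P_def by (intro holomorphic_intros)
  have P0: "P u = 0 \<longleftrightarrow> (\<exists>i\<in>I. snd Z i = u)" for u unfolding P_def using finI by auto
  have zP: "zorder P u = int (card {i\<in>I. snd Z i = u})" for u
  proof -
    have "finite (snd Z ` I)" using finI by simp
    then have ev: "eventually (\<lambda>w. w \<notin> snd Z ` I) (at u)"
      using islimpt_finite[of "snd Z ` I" u] by (simp add: islimpt_iff_eventually)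
    have "zorder P u = (\<Sum>i\<in>I. zorder (\<lambda>w. w - snd Z i) u)"
      unfolding P_def[abs_def]
    proof (rule zorder_prod_analytic)
      show "eventually (\<lambda>w. (\<Prod>i\<in>I. w - snd Z i) \<noteq> 0) (at u)"
        using ev by eventually_elim (use P0 in \<open>auto simp: P_def\<close>)
    qed (intro analytic_intros)
    also have "\<dots> = (\<Sum>i\<in>I. if snd Z i = u then 1 else 0)"
    proof (rule sum.cong[OF refl])
      fix i
      show "zorder (\<lambda>w. w - snd Z i) u = (if snd Z i = u then 1 else 0)"
      proof (cases "snd Z i = u")
        case True then show ?thesis using zorder_linear[of u] by simp
      next
        case False
        then have "zorder (\<lambda>w. w - snd Z i) u = 0" by (intro zorder_eq_0I analytic_intros) auto
        then show ?thesis using False by simp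
      qed
    qed
    also have "\<dots> = int (card {i\<in>I. snd Z i = u})" using finI by (simp add: sum.If_cases Int_def)
    finally show ?thesis .
  qed
  obtain h where "h holomorphic_on A" "\<And>u. u \<in> A \<Longrightarrow> h u \<noteq> 0" "\<And>u. u \<in> A \<Longrightarrow> f u = h u * P u"
  proof (rule holomorphic_zorder_factorization[OF holomorphic_on_subset[OF f AD] openA connA Phol])
    fix u assume u: "u \<in> A"
    show z: "zorder P u = zorder f u" using zP[of u] PI[OF u] card[of u] u AD by auto
    show "P u = 0 \<longleftrightarrow> f u = 0" using P0[of u] PI[OF u] zero_iff[of u] u AD by blast
  qed blast
  then show ?thesis using finI openA unfolding P_def by blast
qed

text \<open>
  Jensen's formula in multiplicative form: reflecting the zeros with \<open>\<beta> i < r\<close> in the circle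
  \<open>|w| = r\<close> does not change the modulus there and leaves a zero-free function \<open>G\<close>.
\<close>

lemma circle_with_zeros_ge:
  assumes f: "f holomorphic_on \<bbbD>" and Z: "is_zero_sequence_of Z f"
    and z: "cmod z < 1" and fz: "f z \<noteq> 0" and r: "0 < r" "r < 1" and s: "0 \<le> s"
    and F: "finite F" "F \<subseteq> seq_index Z"
  defines "\<beta> \<equiv> \<lambda>i. cmod (disc_involution z (snd Z i))"
  assumes circle: "\<And>i. i \<in> seq_index Z \<Longrightarrow> \<beta> i \<noteq> r"
  shows "ennreal ((cmod (f z) * (\<Prod>i\<in>F. max 1 (r / \<beta> i))) powr s) \<le>
    (\<integral>\<^sup>+t\<in>{0..1}. ennreal (cmod (f (disc_involution z (of_real r * exp (2 * of_real pi * \<i> * of_real t)))) powr s) \<partial>lborel)"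
proof -
  \<comment> \<open>Any radius between \<open>r\<close> and \<open>1\<close> would do; it makes the
    factorisation valid on a neighbourhood of the closed disc of radius \<open>r\<close>.\<close>
  define R where "R = (1 + r) / 2"
  have R: "0 < R" "R < 1" "r < R" using r by (auto simp: R_def)
  define I where "I = {i \<in> seq_index Z. \<beta> i < R}"
  define A where "A = {u \<in> \<bbbD>. cmod (disc_involution z u) < R}"
  have nz: "\<exists>u\<in>\<bbbD>. f u \<noteq> 0" using z fz by (intro bexI[of _ z]) auto
  from zero_sequence_factorization[OF f nz Z z R(1,2)]
  obtain h where finI: "finite I" and openA: "open A" and h: "h holomorphic_on A" "\<And>u. u \<in> A \<Longrightarrow> h u \<noteq> 0"
    and fh: "\<And>u. u \<in> A \<Longrightarrow> f u = h u * (\<Prod>i\<in>I. u - snd Z i)"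
    unfolding I_def A_def \<beta>_def by blast
  note aD = zero_sequence_in_disc[OF Z]
  define b where "b i = disc_involution z (snd Z i)" for i
  have \<beta>b: "\<beta> i = cmod (b i)" for i by (simp add: \<beta>_def b_def)
  have b1: "cmod (b i) < 1" if "i \<in> seq_index Z" for i
    unfolding b_def using cmod_disc_involution_less_1[OF z aD[OF that]] .
  have bb: "disc_involution z (b i) = snd Z i" if "i \<in> seq_index Z" for i
    unfolding b_def using disc_involution_involutive[OF z aD[OF that]] .
  define c where "c i w = - ((1 - cnj z * z) / ((1 - cnj z * b i) * (1 - cnj z * w)))" for i w
  define T where "T i w = (if \<beta> i < r then (of_real (r\<^sup>2) - cnj (b i) * w) / of_real r else w - b i)" for i w
  define G where "G w = h (disc_involution z w) * (\<Prod>i\<in>I. c i w * T i w)" for w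
  have phiA: "disc_involution z w \<in> A" if "w \<in> ball 0 R" for w
  proof -
    have "cmod w < 1" using that R by simp
    then show ?thesis using that disc_involution_involutive[OF z] disc_involution_in_disc[OF z, of w] by (simp add: A_def)
  qed
  have nz1: "1 - cnj z * w \<noteq> 0" if "w \<in> ball 0 R" for w
    using one_minus_cnj_mult_nonzero[OF z, of w] that R by simp
  have Ghol: "G holomorphic_on ball 0 R"
  proof -
    have "disc_involution z holomorphic_on ball 0 R"
      by (rule holomorphic_on_subset[OF holomorphic_disc_involution[OF z]]) (use R in auto)
    then have 1: "(\<lambda>w. h (disc_involution z w)) holomorphic_on ball 0 R"
      using holomorphic_on_compose_gen[OF _ h(1)] phiA by (force simp: o_def)
    have 2: "(\<lambda>w. c i w * T i w) holomorphic_on ball 0 R" if "i \<in> I" for i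
    proof -
      have nb: "1 - cnj z * b i \<noteq> 0" using one_minus_cnj_mult_nonzero[OF z b1] that by (auto simp: I_def)
      have "c i holomorphic_on ball 0 R" unfolding c_def[abs_def] using nz1 nb by (intro holomorphic_intros) auto
      moreover have "T i holomorphic_on ball 0 R"
        unfolding T_def[abs_def] using r by (cases "\<beta> i < r") (auto intro!: holomorphic_intros)
      ultimately show ?thesis by (intro holomorphic_intros)
    qed
    show ?thesis unfolding G_def[abs_def] by (intro holomorphic_on_mult holomorphic_on_prod 1 2)
  qed
  have factor: "disc_involution z w - snd Z i = c i w * (w - b i)" if "i \<in> seq_index Z" "w \<in> ball 0 R" for i w
  proof -
    have "disc_involution z w - disc_involution z (b i) = c i w * (w - b i)"
      unfolding c_def using that R b1[OF that(1)] by (intro disc_involution_diff z) auto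
    then show ?thesis by (simp only: bb[OF that(1)])
  qed
  have fG: "f (disc_involution z w) = h (disc_involution z w) * (\<Prod>i\<in>I. c i w * (w - b i))" if "w \<in> ball 0 R" for w
  proof -
    have "(\<Prod>i\<in>I. disc_involution z w - snd Z i) = (\<Prod>i\<in>I. c i w * (w - b i))"
      using factor[OF _ that] by (intro prod.cong) (auto simp: I_def)
    then show ?thesis using fh[OF phiA[OF that]] by simp
  qed
  have Tcirc: "cmod (T i w) = cmod (w - b i)" if "cmod w = r" for i w
  proof (cases "\<beta> i < r")
    case True
    have "complex_of_real (r\<^sup>2) = w * cnj w" using complex_norm_square[of w] that by (simp only:)
    then have "complex_of_real (r\<^sup>2) - cnj (b i) * w = w * cnj (w - b i)"
      by (simp only: complex_cnj_diff right_diff_distrib mult.commute)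
    then have "cmod (complex_of_real (r\<^sup>2) - cnj (b i) * w) = r * cmod (w - b i)"
      using that by (metis complex_mod_cnj norm_mult)
    then show ?thesis using True r by (simp add: T_def norm_divide)
  qed (simp add: T_def)
  have Gcirc: "cmod (G w) = cmod (f (disc_involution z w))" if "cmod w = r" for w
  proof -
    have "w \<in> ball 0 R" using that R by simp
    then show ?thesis using fG[of w] by (simp add: G_def norm_mult prod_norm[symmetric] Tcirc[OF that])
  qed
  have Tnz: "T i w \<noteq> 0" if i: "i \<in> seq_index Z" and w: "cmod w \<le> r" for i w
  proof (cases "\<beta> i < r")
    case True
    have "cmod (cnj (b i) * w) \<le> \<beta> i * r" unfolding norm_mult \<beta>b using w by (auto intro!: mult_mono)
    also have "\<dots> < r * r" using True r by simp
    finally have "cmod (cnj (b i) * w) < r\<^sup>2" by (simp add: power2_eq_square)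
    moreover have "cmod (of_real (r\<^sup>2)) = r\<^sup>2" by (simp only: norm_of_real) simp
    ultimately have "complex_of_real (r\<^sup>2) \<noteq> cnj (b i) * w" by (metis less_irrefl)
    then show ?thesis using True r by (simp add: T_def)
  next
    case False
    then have "r < cmod (b i)" using circle[OF i] by (simp add: \<beta>b)
    then show ?thesis using False w by (auto simp: T_def)
  qed
  have cnz: "c i w \<noteq> 0" if "i \<in> seq_index Z" "w \<in> ball 0 R" for i w
    using nz1[OF that(2)] one_minus_cnj_mult_nonzero[OF z b1[OF that(1)]] one_minus_cnj_mult_nonzero[OF z z]
    by (simp add: c_def)
  have Gnz: "G w \<noteq> 0" if "w \<in> cball 0 r" for w
  proof -
    have wR: "w \<in> ball 0 R" using that R by auto
    have "(\<Prod>i\<in>I. c i w * T i w) \<noteq> 0"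
      using cnz[OF _ wR] Tnz[of _ w] that finI by (auto simp: I_def)
    then show ?thesis using h(2)[OF phiA[OF wR]] by (simp add: G_def)
  qed
  \<comment> \<open>\<open>circle_powr_mean_ge\<close> asks for an open disc, so the zero-free
    region is enlarged slightly by compactness. That \<open>G\<close> has no zero on
    \<open>|w| = r\<close> itself is due to the hypothesis \<open>circle\<close>.\<close>
  define B where "B = ball 0 R \<inter> G -` (- {0})"
  have "open B" unfolding B_def
    by (rule continuous_open_preimage[OF holomorphic_on_imp_continuous_on[OF Ghol]]) auto
  moreover have "cball 0 r \<subseteq> B" unfolding B_def using Gnz R by auto
  ultimately obtain \<epsilon> where \<epsilon>: "\<epsilon> > 0" "(\<Union>x\<in>cball 0 r. ball x \<epsilon>) \<subseteq> B"
    using compact_subset_open_imp_ball_epsilon_subset[OF compact_cball] by metis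
  have ballB: "ball 0 (r + \<epsilon>) \<subseteq> B"
  proof
    fix w :: complex assume w: "w \<in> ball 0 (r + \<epsilon>)"
    show "w \<in> B"
    proof (cases "cmod w \<le> r")
      case True then show ?thesis using \<epsilon> by force
    next
      case False
      define w' where "w' = of_real (r / cmod w) * w"
      have w0: "cmod w > 0" using False r by linarith
      have "cmod w' = r" unfolding w'_def norm_mult norm_of_real using w0 r by simp
      moreover have "w' - w = of_real (r / cmod w - 1) * w" by (simp add: w'_def algebra_simps)
      then have "cmod (w' - w) = \<bar>r / cmod w - 1\<bar> * cmod w" by (simp only: norm_mult norm_of_real)
      moreover have "\<bar>r / cmod w - 1\<bar> = 1 - r / cmod w" using False w0 by (simp add: abs_if)
      moreover have "(1 - r / cmod w) * cmod w = cmod w - r" using w0 by (simp add: left_diff_distrib)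
      ultimately have "cmod (w' - w) = cmod w - r" by (simp only:)
      moreover have "cmod w' = r" by fact
      ultimately have "w' \<in> cball 0 r" "w \<in> ball w' \<epsilon>" using w by (auto simp: dist_norm)
      then show ?thesis using \<epsilon> by blast
    qed
  qed
  have "ennreal (cmod (G 0) powr s) \<le>
    (\<integral>\<^sup>+t\<in>{0..1}. ennreal (cmod (G (of_real r * exp (2 * of_real pi * \<i> * of_real t))) powr s) \<partial>lborel)"
  proof (rule circle_powr_mean_ge)
    show "G holomorphic_on ball 0 (r + \<epsilon>)"
      by (rule holomorphic_on_subset[OF Ghol]) (use ballB in \<open>auto simp: B_def\<close>)
    show "G w \<noteq> 0" if "w \<in> ball 0 (r + \<epsilon>)" for w using ballB that by (auto simp: B_def)
  qed (use r \<epsilon> in auto)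
  also have "\<dots> = (\<integral>\<^sup>+t\<in>{0..1}. ennreal (cmod (f (disc_involution z (of_real r * exp (2 * of_real pi * \<i> * of_real t)))) powr s) \<partial>lborel)"
    using r by (subst Gcirc) (auto simp: norm_mult)
  finally have main: "ennreal (cmod (G 0) powr s) \<le> \<dots>" .
  have \<beta>pos: "0 < \<beta> i" if "i \<in> seq_index Z" for i
  proof -
    have "snd Z i \<noteq> z" using zero_sequence_eq_0_iff[OF f nz Z, of z] z fz that by auto
    then show ?thesis unfolding \<beta>_def using disc_involution_eq_0_iff[OF z aD[OF that]] by auto
  qed
  \<comment> \<open>At the centre the reflection replaces the modulus \<open>\<beta> i\<close> of
    the linear factor by \<open>r\<close>; this is the gain in Jensen's formula.\<close>
  have T0: "cmod (T i 0) = max 1 (r / \<beta> i) * cmod (b i)" if i: "i \<in> seq_index Z" for i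
  proof (cases "\<beta> i < r")
    case True
    then have "max 1 (r / \<beta> i) = r / \<beta> i" using \<beta>pos[OF i] by (simp add: max_def field_simps)
    moreover have "cmod (T i 0) = r" using True r by (simp add: T_def power2_eq_square norm_mult norm_divide)
    ultimately show ?thesis using \<beta>pos[OF i] by (simp add: \<beta>b)
  next
    case False
    then have "max 1 (r / \<beta> i) = 1" using \<beta>pos[OF i] by (simp add: max_def field_simps)
    then show ?thesis using False by (simp add: T_def)
  qed
  have "cmod (G 0) = cmod (h z) * (\<Prod>i\<in>I. cmod (c i 0) * cmod (T i 0))"
    by (simp add: G_def norm_mult prod_norm[symmetric])
  also have "(\<Prod>i\<in>I. cmod (c i 0) * cmod (T i 0)) = (\<Prod>i\<in>I. max 1 (r / \<beta> i) * (cmod (c i 0) * cmod (b i)))"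
    by (intro prod.cong refl) (auto simp: I_def T0)
  also have "\<dots> = (\<Prod>i\<in>I. max 1 (r / \<beta> i)) * (\<Prod>i\<in>I. cmod (c i 0) * cmod (b i))" by (rule prod.distrib)
  also have "cmod (h z) * ((\<Prod>i\<in>I. max 1 (r / \<beta> i)) * (\<Prod>i\<in>I. cmod (c i 0) * cmod (b i))) =
      cmod (f z) * (\<Prod>i\<in>I. max 1 (r / \<beta> i))"
    using fG[of 0] R by (simp add: norm_mult prod_norm[symmetric])
  finally have G0: "cmod (G 0) = cmod (f z) * (\<Prod>i\<in>I. max 1 (r / \<beta> i))" .
  have "(\<Prod>i\<in>F. max 1 (r / \<beta> i)) = (\<Prod>i\<in>F \<inter> I. max 1 (r / \<beta> i))"
  proof (rule prod.mono_neutral_right)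
    show "\<forall>i\<in>F - F \<inter> I. max 1 (r / \<beta> i) = 1"
    proof
      fix i assume i: "i \<in> F - F \<inter> I"
      then have "R \<le> \<beta> i" using F by (auto simp: I_def)
      then have "r / \<beta> i \<le> 1" using R r by (simp add: field_simps)
      then show "max 1 (r / \<beta> i) = 1" by (simp add: max_def)
    qed
  qed (use F in auto)
  also have "\<dots> \<le> (\<Prod>i\<in>I. max 1 (r / \<beta> i))"
    by (rule prod_mono2) (use finI in auto)
  finally have "cmod (f z) * (\<Prod>i\<in>F. max 1 (r / \<beta> i)) \<le> cmod (G 0)"
    unfolding G0 by (intro mult_left_mono) auto
  moreover have "0 \<le> cmod (f z) * (\<Prod>i\<in>F. max 1 (r / \<beta> i))" by (intro mult_nonneg_nonneg prod_nonneg) auto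
  ultimately have "(cmod (f z) * (\<Prod>i\<in>F. max 1 (r / \<beta> i))) powr s \<le> cmod (G 0) powr s"
    using s by (intro powr_mono2)
  then show ?thesis using main ennreal_leI order_trans by blast
qed

section \<open>Averaging Jensen's formula over the radii\<close>

lemma nn_integral_exp_density:
  "(\<integral>\<^sup>+x\<in>{0..}. ennreal (4 * pi * exp (- 4 * pi * x)) \<partial>lborel) = 1"
proof -
  have "(\<integral>\<^sup>+x. ennreal (4 * pi * exp (- 4 * pi * x)) * indicator {0..} x \<partial>lborel) = ennreal (0 - (- exp (- 4 * pi * 0)))"
  proof (rule nn_integral_FTC_atLeast)
    show "((\<lambda>x. - exp (- 4 * pi * x)) has_real_derivative 4 * pi * exp (- 4 * pi * x)) (at x)" for x
      by (auto intro!: derivative_eq_intros)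
    have "((\<lambda>x. - exp (- (4 * pi) * x)) \<longlongrightarrow> - 0) at_top"
      by (intro tendsto_minus filterlim_compose[OF exp_at_bot] filterlim_tendsto_neg_mult_at_bot[OF tendsto_const] filterlim_ident) auto
    then show "((\<lambda>x. - exp (- 4 * pi * x)) \<longlongrightarrow> 0) at_top" by simp
  qed auto
  then show ?thesis by simp
qed

text \<open>With \<open>\<beta> = exp (- l)\<close> and \<open>r = exp (- 2 * pi * x)\<close> this
  is the mean of the positive part of \<open>ln (r / \<beta>)\<close> for normalised area. Its value
  \<open>- ln \<beta> - (1 - \<beta>^2) / 2\<close> is the origin of the exponential correction in
  \<open>Berezin_zero_bound\<close>.\<close>

lemma nn_integral_exp_density_log:
  assumes l: "0 \<le> l"
  shows "(\<integral>\<^sup>+x\<in>{0..}. ennreal (4 * pi * exp (- 4 * pi * x) * max 0 (l - 2 * pi * x)) \<partial>lborel) =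
    ennreal (l - (1 - exp (- 2 * l)) / 2)"
proof -
  define b where "b = l / (2 * pi)"
  have b: "0 \<le> b" "2 * pi * b = l" using l by (auto simp: b_def)
  let ?f = "\<lambda>x. 4 * pi * exp (- 4 * pi * x) * (l - 2 * pi * x)"
  let ?F = "\<lambda>x. exp (- 4 * pi * x) / 2 - exp (- 4 * pi * x) * (l - 2 * pi * x)"
  have le: "l - 2 * pi * x \<ge> 0 \<longleftrightarrow> x \<le> b" for x
    using b by (simp add: b_def field_simps)
  have "(\<integral>\<^sup>+x\<in>{0..}. ennreal (4 * pi * exp (- 4 * pi * x) * max 0 (l - 2 * pi * x)) \<partial>lborel) =
      (\<integral>\<^sup>+x. ennreal (?f x) * indicator {0..b} x \<partial>lborel)"
    by (intro nn_integral_cong) (use le in \<open>auto simp: indicator_def max_def\<close>)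
  also have "\<dots> = ennreal (?F b - ?F 0)"
  proof (rule nn_integral_FTC_Icc)
    fix x assume x: "x \<in> {0..b}"
    show "(?F has_real_derivative ?f x) (at x)"
      by (auto intro!: derivative_eq_intros simp: algebra_simps)
    show "0 \<le> ?f x" using le[of x] x by simp
  qed (use b in auto)
  also have "?F b - ?F 0 = l - (1 - exp (- 2 * l)) / 2"
  proof -
    have "- 4 * pi * b = - 2 * l" using b by simp
    then have "exp (- 4 * pi * b) = exp (- 2 * l)" by (simp only:)
    then show ?thesis using b by (simp add: field_simps)
  qed
  finally show ?thesis .
qed

text \<open>
  Jensen's inequality for \<open>exp\<close> and the probability density \<open>4 \<pi> e\<^sup>4\<^sup>\<pi>\<^sup>x\<close>, which is normalised area
  in the variable \<open>r = e\<^sup>2\<^sup>\<pi>\<^sup>x\<close>. The maximum is \<open>ln\<^sup>+ (r / \<beta> i)\<close> for \<open>l i = - ln (\<beta> i)\<close>.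
\<close>

lemma exp_mean_ge:
  fixes l :: "'i \<Rightarrow> real"
  assumes F: "finite F" and l: "\<And>i. i \<in> F \<Longrightarrow> 0 \<le> l i" and s: "0 \<le> s"
  shows "ennreal (exp (s * (\<Sum>i\<in>F. l i - (1 - exp (- 2 * l i)) / 2))) \<le>
    (\<integral>\<^sup>+x\<in>{..<0}. ennreal (4 * pi * exp (4 * pi * x) * exp (s * (\<Sum>i\<in>F. max 0 (2 * pi * x + l i)))) \<partial>lborel)"
proof -
  define m where "m i = l i - (1 - exp (- 2 * l i)) / 2" for i
  define c where "c = s * (\<Sum>i\<in>F. m i)"
  define D where "D x = 4 * pi * exp (- 4 * pi * x)" for x :: real
  define Y where "Y x = s * (\<Sum>i\<in>F. max 0 (l i - 2 * pi * x))" for x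
  have D0: "0 \<le> D x" for x by (simp add: D_def)
  have Y0: "0 \<le> Y x" for x using s by (simp add: Y_def sum_nonneg)
  have [measurable]: "D \<in> borel_measurable borel" "Y \<in> borel_measurable borel"
    unfolding D_def Y_def by measurable
  have m0: "0 \<le> m i" if "i \<in> F" for i
  proof -
    have "1 + (- 2 * l i) \<le> exp (- 2 * l i)" by (rule exp_ge_add_one_self)
    then show ?thesis by (simp add: m_def)
  qed
  have c0: "0 \<le> c" using s m0 by (simp add: c_def sum_nonneg)
  have ID: "(\<integral>\<^sup>+x\<in>{0..}. ennreal (D x) \<partial>lborel) = 1" unfolding D_def by (rule nn_integral_exp_density)
  have IY: "(\<integral>\<^sup>+x\<in>{0..}. ennreal (D x * Y x) \<partial>lborel) = ennreal c"
  proof -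
    have "(\<integral>\<^sup>+x\<in>{0..}. ennreal (D x * Y x) \<partial>lborel) =
        (\<integral>\<^sup>+x. (\<Sum>i\<in>F. ennreal s * (ennreal (D x * max 0 (l i - 2 * pi * x)) * indicator {0..} x)) \<partial>lborel)"
    proof (rule nn_integral_cong)
      fix x
      have "D x * Y x = (\<Sum>i\<in>F. s * (D x * max 0 (l i - 2 * pi * x)))"
        by (simp add: Y_def sum_distrib_left mult_ac)
      then have "ennreal (D x * Y x) = (\<Sum>i\<in>F. ennreal (s * (D x * max 0 (l i - 2 * pi * x))))"
        using s D0 by (simp add: sum_ennreal)
      also have "\<dots> = (\<Sum>i\<in>F. ennreal s * ennreal (D x * max 0 (l i - 2 * pi * x)))"
        using s D0 by (simp add: ennreal_mult)
      finally show "ennreal (D x * Y x) * indicator {0..} x =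
          (\<Sum>i\<in>F. ennreal s * (ennreal (D x * max 0 (l i - 2 * pi * x)) * indicator {0..} x))"
        by (simp add: sum_distrib_right mult.assoc)
    qed
    also have "\<dots> = (\<Sum>i\<in>F. ennreal s * ennreal (m i))"
    proof -
      have "(\<integral>\<^sup>+x\<in>{0..}. ennreal (D x * max 0 (l i - 2 * pi * x)) \<partial>lborel) = ennreal (m i)" if "i \<in> F" for i
        unfolding D_def m_def by (rule nn_integral_exp_density_log[OF l[OF that]])
      then show ?thesis by (subst nn_integral_sum) (auto simp: nn_integral_cmult intro!: sum.cong)
    qed
    also have "\<dots> = ennreal c" using s m0 by (simp add: c_def sum_distrib_left sum_ennreal ennreal_mult[symmetric])
    finally show ?thesis .
  qed
  define J where "J = (\<integral>\<^sup>+x\<in>{0..}. ennreal (D x * exp (Y x)) \<partial>lborel)"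
  \<comment> \<open>The tangent inequality \<open>exp Y \<ge> exp c * (1 + Y - c)\<close> at the
    mean \<open>c\<close> of \<open>Y\<close> is integrated against the density. The negative term
    stays on the other side, since subtraction of extended nonnegative reals truncates.\<close>
  have "ennreal (exp c) + ennreal (exp c) * ennreal c =
      (\<integral>\<^sup>+x. ennreal (exp c) * (ennreal (D x) * indicator {0..} x) + ennreal (exp c) * (ennreal (D x * Y x) * indicator {0..} x) \<partial>lborel)"
    by (subst nn_integral_add) (auto simp: nn_integral_cmult ID IY)
  also have "\<dots> \<le> (\<integral>\<^sup>+x. ennreal (D x * exp (Y x)) * indicator {0..} x + ennreal (exp c * c) * (ennreal (D x) * indicator {0..} x) \<partial>lborel)"
  proof (rule nn_integral_mono)
    fix x
    have "1 + (Y x - c) \<le> exp (Y x - c)" by (rule exp_ge_add_one_self)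
    then have "exp c * (1 + (Y x - c)) \<le> exp c * exp (Y x - c)" by (intro mult_left_mono) auto
    also have "exp c * exp (Y x - c) = exp (Y x)" by (simp flip: exp_add)
    finally have "D x * (exp c + exp c * Y x) \<le> D x * (exp (Y x) + exp c * c)"
      using D0 by (intro mult_left_mono) (auto simp: algebra_simps)
    then have "ennreal (exp c * D x + exp c * (D x * Y x)) \<le> ennreal (D x * exp (Y x) + exp c * c * D x)"
      by (intro ennreal_leI) (simp add: algebra_simps)
    then have "ennreal (exp c) * ennreal (D x) + ennreal (exp c) * ennreal (D x * Y x) \<le>
        ennreal (D x * exp (Y x)) + ennreal (exp c * c) * ennreal (D x)"
      using D0 Y0 c0 by (simp add: ennreal_mult[symmetric] ennreal_plus[symmetric] del: ennreal_plus)
    then show "ennreal (exp c) * (ennreal (D x) * indicator {0..} x) + ennreal (exp c) * (ennreal (D x * Y x) * indicator {0..} x) \<le>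
        ennreal (D x * exp (Y x)) * indicator {0..} x + ennreal (exp c * c) * (ennreal (D x) * indicator {0..} x)"
      by (auto simp: indicator_def)
  qed
  also have "\<dots> = J + ennreal (exp c * c)"
    unfolding J_def by (subst nn_integral_add) (auto simp: nn_integral_cmult ID)
  finally have "ennreal (exp c) + ennreal (exp c * c) \<le> J + ennreal (exp c * c)"
    using c0 by (simp add: ennreal_mult)
  then have "ennreal (exp c * c) + ennreal (exp c) \<le> ennreal (exp c * c) + J" by (simp only: add.commute)
  then have "ennreal (exp c) \<le> J" by (simp only: ennreal_add_left_cancel_le) simp
  also have "J = (\<integral>\<^sup>+x\<in>{..<0}. ennreal (4 * pi * exp (4 * pi * x) * exp (s * (\<Sum>i\<in>F. max 0 (2 * pi * x + l i)))) \<partial>lborel)"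
  proof -
    have "(\<integral>\<^sup>+x\<in>{..<0}. ennreal (4 * pi * exp (4 * pi * x) * exp (s * (\<Sum>i\<in>F. max 0 (2 * pi * x + l i)))) \<partial>lborel) =
        ennreal \<bar>-1\<bar> * (\<integral>\<^sup>+x. ennreal (4 * pi * exp (4 * pi * (0 + (-1) * x)) * exp (s * (\<Sum>i\<in>F. max 0 (2 * pi * (0 + (-1) * x) + l i)))) *
          indicator {..<0} (0 + (-1) * x) \<partial>lborel)"
      by (rule nn_integral_real_affine) auto
    also have "\<dots> = (\<integral>\<^sup>+x\<in>{0<..}. ennreal (D x * exp (Y x)) \<partial>lborel)"
      by (auto simp: D_def Y_def indicator_def intro!: nn_integral_cong)
    also have "\<dots> = J" unfolding J_def
      by (intro nn_integral_cong_AE) (use AE_lborel_singleton[of 0] in \<open>auto simp: indicator_def elim!: eventually_mono\<close>)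
    finally show ?thesis by simp
  qed
  finally show ?thesis unfolding c_def m_def .
qed

lemma one_minus_cnj_mult_disc_involution:
  assumes "1 - cnj z * w \<noteq> 0"
  shows "1 - cnj z * disc_involution z w = (1 - cnj z * z) / (1 - cnj z * w)"
  using assms by (simp add: disc_involution_def field_simps)

text \<open>
  The substitution \<open>w = disc_involution z (exp (2 \<pi> \<zeta>))\<close> passes to polar coordinates about \<open>z\<close> and
  removes the Berezin kernel.
\<close>

theorem Berezin_zero_bound:
  assumes f: "f holomorphic_on \<bbbD>" and Z: "is_zero_sequence_of Z f"
    and z: "cmod z < 1" and fz: "f z \<noteq> 0" and s: "0 < s"
    and F: "finite F" "F \<subseteq> seq_index Z"
  defines "\<beta> \<equiv> \<lambda>i. cmod (disc_involution z (snd Z i))"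
  shows "ennreal (pi * (cmod (f z) * (\<Prod>i\<in>F. exp (- (1 - (\<beta> i)\<^sup>2) / 2) / \<beta> i)) powr s) \<le>
    (\<integral>\<^sup>+w\<in>\<bbbD>. ennreal (cmod (f w) powr s * ((1 - (cmod z)\<^sup>2)\<^sup>2 / cmod (1 - cnj z * w) ^ 4)) \<partial>lborel)"
proof -
  have [measurable]: "\<bbbD> \<in> sets borel" by simp
  \<comment> \<open>Outside the disc \<open>f\<close> is arbitrary; cutting it off makes it Borel
    measurable.\<close>
  define ft where "ft w = indicator \<bbbD> w *\<^sub>R f w" for w
  have [measurable]: "ft \<in> borel_measurable borel"
    unfolding ft_def[abs_def]
    by (rule borel_measurable_continuous_on_indicator) (use f holomorphic_on_imp_continuous_on in auto)
  define Fn where "Fn w = cmod (ft w) powr s * ((1 - (cmod z)\<^sup>2)\<^sup>2 / cmod (1 - cnj z * w) ^ 4)" for w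
  have Fn_meas [measurable]: "Fn \<in> borel_measurable borel"
  proof -
    have [measurable]: "(\<lambda>w. cmod (1 - cnj z * w)) \<in> borel_measurable borel"
      by (intro borel_measurable_continuous_onI continuous_intros)
    show ?thesis unfolding Fn_def[abs_def] by measurable
  qed
  define \<psi> where "\<psi> \<zeta> = disc_involution z (exp (2 * of_real pi * \<zeta>))" for \<zeta>
  \<comment> \<open>The half strip corresponds to one turn around \<open>0\<close>:
    \<open>exp (2 * pi * \<zeta>)\<close> is injective on it, and its image is the disc without one
    radius.\<close>
  define S where "S = {\<zeta>. Re \<zeta> < 0 \<and> 0 < Im \<zeta> \<and> Im \<zeta> < 1}"
  have openS: "open S" unfolding S_def
    by (intro open_Collect_conj open_Collect_less continuous_intros)
  then have [measurable]: "S \<in> sets borel" by simp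
  have w1: "cmod (exp (2 * of_real pi * \<zeta>)) < 1" if "\<zeta> \<in> S" for \<zeta>
    using that by (simp add: S_def mult_pos_neg)
  have der: "(\<psi> has_field_derivative (- (1 - cnj z * z) / (1 - cnj z * exp (2 * of_real pi * \<zeta>))\<^sup>2 *
      (2 * of_real pi * exp (2 * of_real pi * \<zeta>)))) (at \<zeta>)" if "\<zeta> \<in> S" for \<zeta>
  proof -
    have "((\<lambda>\<zeta>. exp (2 * of_real pi * \<zeta>)) has_field_derivative (2 * of_real pi * exp (2 * of_real pi * \<zeta>))) (at \<zeta>)"
      by (auto intro!: derivative_eq_intros)
    from DERIV_chain2[OF disc_involution_has_field_derivative[OF z w1[OF that]] this]
    show ?thesis unfolding \<psi>_def[abs_def] .
  qed
  have hol: "\<psi> holomorphic_on S" using der openS holomorphic_on_open by blast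
  have inj: "inj_on \<psi> S"
  proof (rule inj_onI)
    fix x y assume xy: "x \<in> S" "y \<in> S" "\<psi> x = \<psi> y"
    have "disc_involution z (\<psi> x) = disc_involution z (\<psi> y)" by (simp only: xy(3))
    then have e: "exp (2 * of_real pi * x) = exp (2 * of_real pi * y)"
      by (simp only: \<psi>_def disc_involution_involutive[OF z w1[OF xy(1)]] disc_involution_involutive[OF z w1[OF xy(2)]])
    have "\<bar>Im x - Im y\<bar> < 1" using xy(1,2) unfolding S_def mem_Collect_eq by linarith
    then have "2 * pi * \<bar>Im x - Im y\<bar> < 2 * pi" by simp
    then have "\<bar>Im (2 * of_real pi * x) - Im (2 * of_real pi * y)\<bar> < 2 * pi"
      by (simp add: abs_mult flip: right_diff_distrib)
    from exp_complex_eqI[OF this e] have "2 * of_real pi * x = 2 * of_real pi * y" .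
    then show "x = y" by simp
  qed
  have N: "0 < 1 - (cmod z)\<^sup>2" using z by (simp add: abs_square_less_1)
  have zz: "1 - cnj z * z = of_real (1 - (cmod z)\<^sup>2)"
    using complex_norm_square[of z] by (simp add: mult.commute)
  \<comment> \<open>By \<open>one_minus_cnj_mult_disc_involution\<close> the kernel is the
    reciprocal of the squared modulus of the derivative of the Moebius map, so only the Jacobian
    \<open>4 * pi^2 * exp (4 * pi * Re \<zeta>)\<close> of the exponential remains.\<close>
  have jac: "Fn (\<psi> \<zeta>) * (cmod (deriv \<psi> \<zeta>))\<^sup>2 = 4 * pi\<^sup>2 * exp (4 * pi * Re \<zeta>) * cmod (ft (\<psi> \<zeta>)) powr s"
    if "\<zeta> \<in> S" for \<zeta>
  proof -
    define w where "w = exp (2 * of_real pi * \<zeta>)"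
    define E where "E = cmod (1 - cnj z * w)"
    have nz: "1 - cnj z * w \<noteq> 0" unfolding w_def using one_minus_cnj_mult_nonzero[OF z w1[OF that]] .
    then have E: "0 < E" by (simp add: E_def)
    have "1 - cnj z * \<psi> \<zeta> = (1 - cnj z * z) / (1 - cnj z * w)"
      unfolding \<psi>_def w_def[symmetric] by (rule one_minus_cnj_mult_disc_involution[OF nz])
    then have 1: "cmod (1 - cnj z * \<psi> \<zeta>) = (1 - (cmod z)\<^sup>2) / E"
      unfolding zz using N by (simp add: norm_divide E_def del: of_real_diff)
    have "deriv \<psi> \<zeta> = - (1 - cnj z * z) / (1 - cnj z * w)\<^sup>2 * (2 * of_real pi * w)"
      using DERIV_imp_deriv[OF der[OF that]] by (simp add: w_def)
    then have 2: "cmod (deriv \<psi> \<zeta>) = (1 - (cmod z)\<^sup>2) / E\<^sup>2 * (2 * pi * cmod w)"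
      unfolding zz using N by (simp add: norm_divide norm_mult norm_power E_def del: of_real_diff)
    have cw: "(cmod w)\<^sup>2 = exp (4 * pi * Re \<zeta>)"
      by (simp add: w_def power2_eq_square flip: exp_add)
    have alg: "X * (M\<^sup>2 / (M / e) ^ 4) * (M / e\<^sup>2 * (2 * pi * y))\<^sup>2 = 4 * pi\<^sup>2 * y\<^sup>2 * X"
      if "0 < M" "0 < e" for M e y X :: real
      using that by (simp add: field_simps power2_eq_square eval_nat_numeral)
    show ?thesis unfolding Fn_def 1 2 alg[OF N E] cw by simp
  qed
  define k where "k \<zeta> = ennreal (4 * pi\<^sup>2 * exp (4 * pi * Re \<zeta>) * cmod (ft (\<psi> \<zeta>)) powr s) * indicator S \<zeta>" for \<zeta>
  have [measurable]: "\<psi> \<in> borel_measurable borel"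
  proof -
    have [measurable]: "(\<lambda>\<zeta>. exp (2 * complex_of_real pi * \<zeta>)) \<in> borel_measurable borel"
      by (intro borel_measurable_continuous_onI continuous_intros)
    show ?thesis unfolding \<psi>_def[abs_def] disc_involution_def by measurable
  qed
  have [measurable]: "(\<lambda>\<zeta>. ft (\<psi> \<zeta>)) \<in> borel_measurable borel" by measurable
  have [measurable]: "Re \<in> borel_measurable borel" by (intro borel_measurable_continuous_onI continuous_intros)
  have [measurable]: "k \<in> borel_measurable borel" unfolding k_def[abs_def] by measurable
  define l where "l i = - ln (\<beta> i)" for i
  note aD = zero_sequence_in_disc[OF Z]
  have nz: "\<exists>u\<in>\<bbbD>. f u \<noteq> 0" using z fz by (intro bexI[of _ z]) auto
  have \<beta>: "0 < \<beta> i" "\<beta> i < 1" if "i \<in> F" for i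
  proof -
    have i: "i \<in> seq_index Z" using that F by blast
    show "\<beta> i < 1" unfolding \<beta>_def using cmod_disc_involution_less_1[OF z aD[OF i]] .
    have "snd Z i \<noteq> z" using zero_sequence_eq_0_iff[OF f nz Z, of z] z fz i by auto
    then show "0 < \<beta> i" unfolding \<beta>_def using disc_involution_eq_0_iff[OF z aD[OF i]] by auto
  qed
  have l: "0 \<le> l i" "exp (l i) = 1 / \<beta> i" "exp (- 2 * l i) = (\<beta> i)\<^sup>2" if "i \<in> F" for i
  proof -
    show "0 \<le> l i" using \<beta>[OF that] by (simp add: l_def)
    show "exp (l i) = 1 / \<beta> i" using \<beta>[OF that] by (simp add: l_def exp_minus field_simps)
    have "exp (- 2 * l i) = exp (ln (\<beta> i)) * exp (ln (\<beta> i))" by (simp add: l_def flip: exp_add)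
    then show "exp (- 2 * l i) = (\<beta> i)\<^sup>2" using \<beta>[OF that] by (simp add: power2_eq_square)
  qed
  define q where "q x = ennreal (4 * pi * exp (4 * pi * x) * exp (s * (\<Sum>i\<in>F. max 0 (2 * pi * x + l i))))" for x
  \<comment> \<open>The countably many \<open>x\<close> whose circle of radius
    \<open>exp (2 * pi * x)\<close> passes through a zero are excluded, as
    \<open>circle_with_zeros_ge\<close> demands.\<close>
  define X where "X = {x. \<exists>i\<in>seq_index Z. exp (2 * pi * x) = \<beta> i}"
  have "X \<subseteq> (\<lambda>i. ln (\<beta> i) / (2 * pi)) ` seq_index Z"
  proof
    fix x assume "x \<in> X"
    then obtain i where i: "i \<in> seq_index Z" "exp (2 * pi * x) = \<beta> i" by (auto simp: X_def)
    then have "x = ln (\<beta> i) / (2 * pi)" by (metis ln_exp nonzero_mult_div_cancel_left pi_neq_zero mult_eq_0_iff zero_neq_numeral)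
    then show "x \<in> (\<lambda>i. ln (\<beta> i) / (2 * pi)) ` seq_index Z" using i by blast
  qed
  then have "countable X" by (rule countable_subset) simp
  then have X: "X \<in> null_sets lborel" by (rule countable_imp_null_set_lborel)
  \<comment> \<open>The factor \<open>pi\<close> is the area of the disc, since Lebesgue measure is
    not normalised here: \<open>4 * pi^2 * exp (4 * pi * x)\<close> is \<open>pi\<close> times the
    density in \<open>exp_mean_ge\<close>.\<close>
  have slice: "ennreal (pi * cmod (f z) powr s) * (q x * indicator {..<0} x) \<le> (\<integral>\<^sup>+y. k (Complex x y) \<partial>lborel)"
    if "x \<notin> X" for x
  proof (cases "x < 0")
    case True
    define r where "r = exp (2 * pi * x)"
    have r: "0 < r" "r < 1" using True by (auto simp: r_def mult_pos_neg)
    let ?c = "\<lambda>t. of_real r * exp (2 * of_real pi * \<i> * of_real t)"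
    have kx: "k (Complex x y) = ennreal (4 * pi\<^sup>2 * exp (4 * pi * x)) *
        (ennreal (cmod (f (disc_involution z (?c y))) powr s) * indicator {0<..<1} y)" for y
    proof -
      have "2 * complex_of_real pi * Complex x y = of_real (2 * pi * x) + 2 * of_real pi * \<i> * of_real y"
        by (simp add: complex_eq_iff)
      then have e: "exp (2 * of_real pi * Complex x y) = ?c y"
        by (simp only: exp_add r_def exp_of_real)
      have "?c y \<in> \<bbbD>" using r by (simp add: norm_mult)
      then have "disc_involution z (?c y) \<in> \<bbbD>" using disc_involution_in_disc[OF z] by blast
      then have "ft (\<psi> (Complex x y)) = f (disc_involution z (?c y))" unfolding \<psi>_def e ft_def by simp
      moreover have "indicator S (Complex x y) = (indicator {0<..<1} y :: ennreal)"
        using True by (auto simp: S_def indicator_def)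
      ultimately show ?thesis by (simp add: k_def ennreal_mult mult.assoc)
    qed
    have meas: "(\<lambda>y. ennreal (cmod (f (disc_involution z (?c y))) powr s) * indicator {0<..<1} y) \<in> borel_measurable lborel"
    proof -
      have "continuous_on UNIV (\<lambda>y. f (disc_involution z (?c y)))"
      proof (rule continuous_on_compose2[OF holomorphic_on_imp_continuous_on[OF f]])
        show "continuous_on UNIV (\<lambda>y. disc_involution z (?c y))"
          by (rule continuous_on_compose2[OF holomorphic_on_imp_continuous_on[OF holomorphic_disc_involution[OF z]]])
            (use r in \<open>auto intro!: continuous_intros simp: norm_mult\<close>)
        show "range (\<lambda>y. disc_involution z (?c y)) \<subseteq> \<bbbD>"
          using disc_involution_in_disc[OF z] r by (auto simp: norm_mult)
      qed
      then have [measurable]: "(\<lambda>y. f (disc_involution z (?c y))) \<in> borel_measurable borel"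
        by (rule borel_measurable_continuous_onI)
      show ?thesis by measurable
    qed
    have mx: "max 1 (r / \<beta> i) = exp (max 0 (2 * pi * x + l i))" if "i \<in> F" for i
    proof -
      have "r / \<beta> i = exp (2 * pi * x + l i)" using l(2)[OF that] by (simp add: exp_add r_def)
      then show ?thesis by (simp add: max_def)
    qed
    have "(cmod (f z) * (\<Prod>i\<in>F. max 1 (r / \<beta> i))) powr s = cmod (f z) powr s * exp (s * (\<Sum>i\<in>F. max 0 (2 * pi * x + l i)))"
    proof -
      have "(\<Prod>i\<in>F. max 1 (r / \<beta> i)) = exp (\<Sum>i\<in>F. max 0 (2 * pi * x + l i))"
        using F by (simp add: exp_sum mx)
      then show ?thesis by (simp add: powr_mult exp_powr_real mult.commute)
    qed
    then have "ennreal (pi * cmod (f z) powr s) * q x =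
        ennreal (4 * pi\<^sup>2 * exp (4 * pi * x)) * ennreal ((cmod (f z) * (\<Prod>i\<in>F. max 1 (r / \<beta> i))) powr s)"
      by (simp add: q_def power2_eq_square mult_ac flip: ennreal_mult)
    also have "\<dots> \<le> ennreal (4 * pi\<^sup>2 * exp (4 * pi * x)) *
        (\<integral>\<^sup>+t\<in>{0..1}. ennreal (cmod (f (disc_involution z (?c t))) powr s) \<partial>lborel)"
      unfolding \<beta>_def
    proof (intro mult_left_mono circle_with_zeros_ge[OF f Z z fz r _ F])
      show "cmod (disc_involution z (snd Z i)) \<noteq> r" if "i \<in> seq_index Z" for i
        using \<open>x \<notin> X\<close> that unfolding X_def r_def \<beta>_def by auto
    qed (use s in auto)
    also have "(\<integral>\<^sup>+t\<in>{0..1}. ennreal (cmod (f (disc_involution z (?c t))) powr s) \<partial>lborel) =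
        (\<integral>\<^sup>+t\<in>{0<..<1}. ennreal (cmod (f (disc_involution z (?c t))) powr s) \<partial>lborel)"
    proof (rule nn_integral_cong_AE)
      show "AE t in lborel. ennreal (cmod (f (disc_involution z (?c t))) powr s) * indicator {0..1} t =
          ennreal (cmod (f (disc_involution z (?c t))) powr s) * indicator {0<..<1} t"
        using AE_lborel_singleton[of 0] AE_lborel_singleton[of 1]
        by eventually_elim (auto simp: indicator_def)
    qed
    also have "ennreal (4 * pi\<^sup>2 * exp (4 * pi * x)) * (\<integral>\<^sup>+t\<in>{0<..<1}. ennreal (cmod (f (disc_involution z (?c t))) powr s) \<partial>lborel) =
        (\<integral>\<^sup>+y. k (Complex x y) \<partial>lborel)"
      unfolding kx by (rule nn_integral_cmult[symmetric]) (rule meas)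
    finally show ?thesis using True by simp
  qed simp
  have "(cmod (f z) * (\<Prod>i\<in>F. exp (- (1 - (\<beta> i)\<^sup>2) / 2) / \<beta> i)) powr s =
      cmod (f z) powr s * exp (s * (\<Sum>i\<in>F. l i - (1 - exp (- 2 * l i)) / 2))"
  proof -
    have "exp (- (1 - (\<beta> i)\<^sup>2) / 2) / \<beta> i = exp (l i - (1 - exp (- 2 * l i)) / 2)" if "i \<in> F" for i
    proof -
      have "exp (l i - (1 - exp (- 2 * l i)) / 2) = exp (l i) * exp (- (1 - (\<beta> i)\<^sup>2) / 2)"
        unfolding l(3)[OF that] by (simp flip: exp_add add: diff_divide_distrib)
      then show ?thesis using l(2)[OF that] by simp
    qed
    then have "(\<Prod>i\<in>F. exp (- (1 - (\<beta> i)\<^sup>2) / 2) / \<beta> i) = exp (\<Sum>i\<in>F. l i - (1 - exp (- 2 * l i)) / 2)"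
      using F by (simp only: exp_sum cong: prod.cong)
    then show ?thesis by (simp only: powr_mult exp_powr_real mult.commute)
  qed
  then have "ennreal (pi * (cmod (f z) * (\<Prod>i\<in>F. exp (- (1 - (\<beta> i)\<^sup>2) / 2) / \<beta> i)) powr s) =
      ennreal (pi * cmod (f z) powr s) * ennreal (exp (s * (\<Sum>i\<in>F. l i - (1 - exp (- 2 * l i)) / 2)))"
    by (simp add: mult.assoc flip: ennreal_mult)
  also have "\<dots> \<le> ennreal (pi * cmod (f z) powr s) * (\<integral>\<^sup>+x\<in>{..<0}. q x \<partial>lborel)"
    unfolding q_def using l s F by (intro mult_left_mono exp_mean_ge) auto
  also have "\<dots> = (\<integral>\<^sup>+x. ennreal (pi * cmod (f z) powr s) * (q x * indicator {..<0} x) \<partial>lborel)"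
    by (rule nn_integral_cmult[symmetric]) (simp add: q_def)
  also have "\<dots> \<le> (\<integral>\<^sup>+x. (\<integral>\<^sup>+y. k (Complex x y) \<partial>lborel) \<partial>lborel)"
    by (rule nn_integral_mono_AE) (use AE_not_in[OF X] slice in \<open>auto elim!: eventually_mono\<close>)
  also have "\<dots> = (\<integral>\<^sup>+\<zeta>. k \<zeta> \<partial>lborel)" by (rule nn_integral_Complex[symmetric]) measurable
  also have "\<dots> = (\<integral>\<^sup>+\<zeta>\<in>S. ennreal (Fn (\<psi> \<zeta>) * (cmod (deriv \<psi> \<zeta>))\<^sup>2) \<partial>lborel)"
    unfolding k_def by (intro nn_integral_cong) (auto simp: indicator_def jac)
  also have "\<dots> \<le> (\<integral>\<^sup>+w\<in>\<psi> ` S. ennreal (Fn w) \<partial>lborel)"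
    by (rule nn_integral_conformal_le[OF openS hol inj]) (auto simp: Fn_def)
  also have "\<dots> \<le> (\<integral>\<^sup>+w\<in>\<bbbD>. ennreal (cmod (f w) powr s * ((1 - (cmod z)\<^sup>2)\<^sup>2 / cmod (1 - cnj z * w) ^ 4)) \<partial>lborel)"
  proof (rule nn_integral_mono)
    fix w
    have "\<psi> ` S \<subseteq> \<bbbD>" using disc_involution_in_disc[OF z] w1 by (auto simp: \<psi>_def)
    then show "ennreal (Fn w) * indicator (\<psi> ` S) w \<le>
        ennreal (cmod (f w) powr s * ((1 - (cmod z)\<^sup>2)\<^sup>2 / cmod (1 - cnj z * w) ^ 4)) * indicator \<bbbD> w"
      by (auto simp: indicator_def Fn_def ft_def)
  qed
  finally show ?thesis .
qed

section \<open>The weight classes and the area measure\<close>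

lemma AE_dA_iff: "(AE z in dA. P z) \<longleftrightarrow> (AE z in lborel. z \<in> \<bbbD> \<longrightarrow> P z)"
proof -
  have "null_sets dA = null_sets (lebesgue_on \<bbbD>)"
    using pi_gt_zero by (auto simp: dA_def null_sets_def ennreal_eq_0_iff simp del: pi_gt_zero)
  then have "(AE z in dA. P z) \<longleftrightarrow> (AE z in lebesgue_on \<bbbD>. P z)"
    by (simp add: eventually_ae_filter dA_def space_scale_measure)
  also have "\<dots> \<longleftrightarrow> (AE z in lebesgue. z \<in> \<bbbD> \<longrightarrow> P z)" by (rule AE_restrict_space_iff) simp
  also have "\<dots> \<longleftrightarrow> (AE z in lborel. z \<in> \<bbbD> \<longrightarrow> P z)" by (rule AE_completion_iff)
  finally show ?thesis .
qed

text \<open>A weight is only Lebesgue measurable on the disc. Replacing it by a Borel function equal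
  almost everywhere brings the integrals over to \<open>lborel\<close>, where products and changes
  of variables are handled.\<close>

lemma nn_integral_dA:
  assumes G: "G \<in> borel_measurable borel" and eq: "AE z in lborel. z \<in> \<bbbD> \<longrightarrow> F z = G z"
  shows "(\<integral>\<^sup>+z. F z \<partial>dA) = ennreal (1 / pi) * (\<integral>\<^sup>+z\<in>\<bbbD>. G z \<partial>lborel)"
proof -
  have "(\<integral>\<^sup>+z. F z \<partial>dA) = (\<integral>\<^sup>+z. G z \<partial>dA)"
    by (rule nn_integral_cong_AE) (simp only: AE_dA_iff eq)
  also have "\<dots> = ennreal (1 / pi) * (\<integral>\<^sup>+z. G z \<partial>lebesgue_on \<bbbD>)"
  proof -
    have "G \<in> borel_measurable lebesgue" using G by (simp add: measurable_completion)
    then have "G \<in> borel_measurable (lebesgue_on \<bbbD>)" by (rule measurable_restrict_space1)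
    then show ?thesis unfolding dA_def by (rule nn_integral_scale_measure)
  qed
  also have "(\<integral>\<^sup>+z. G z \<partial>lebesgue_on \<bbbD>) = (\<integral>\<^sup>+z\<in>\<bbbD>. G z \<partial>lborel)"
    by (simp add: nn_integral_restrict_space nn_integral_completion)
  finally show ?thesis .
qed

text \<open>The change on a null set of the disc, and the free choice outside it, provide the
  everywhere positive weight to which Hoelder's inequality above applies.\<close>

lemma weight_borel_version:
  assumes w: "weight \<omega>" and pos: "AE z in dA. 0 < \<omega> z"
  obtains \<omega>' where "\<omega>' \<in> borel_measurable borel" "\<And>z. 0 < \<omega>' z" "AE z in lborel. z \<in> \<bbbD> \<longrightarrow> \<omega> z = \<omega>' z"
proof -
  have "\<omega> \<in> borel_measurable dA" using w by (auto simp: weight_def)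
  then have "\<omega> \<in> borel_measurable (lebesgue_on \<bbbD>)"
    by (simp add: dA_def measurable_cong_sets[OF sets_scale_measure refl])
  then have "(\<lambda>z. indicator \<bbbD> z *\<^sub>R \<omega> z) \<in> borel_measurable lebesgue"
    by (subst (asm) borel_measurable_restrict_space_iff) auto
  then obtain g where g: "g \<in> borel_measurable lborel" "AE z in lborel. indicator \<bbbD> z *\<^sub>R \<omega> z = g z"
    using completion_ex_borel_measurable_real by blast
  define \<omega>' where "\<omega>' z = (if 0 < g z then g z else 1)" for z
  show ?thesis
  proof
    have [measurable]: "g \<in> borel_measurable borel" using g by simp
    show "\<omega>' \<in> borel_measurable borel" unfolding \<omega>'_def[abs_def] by measurable
    show "0 < \<omega>' z" for z by (simp add: \<omega>'_def)
    have "AE z in lborel. z \<in> \<bbbD> \<longrightarrow> 0 < \<omega> z" using pos by (simp only: AE_dA_iff)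
    then show "AE z in lborel. z \<in> \<bbbD> \<longrightarrow> \<omega> z = \<omega>' z"
      using g(2) by eventually_elim (auto simp: \<omega>'_def)
  qed
qed

lemma B_class_imp_Bekolle_weight:
  assumes q: "1 < q" and B: "\<omega> \<in> B_class q"
  obtains \<omega>' K where "Bekolle_weight q K \<omega>'" "AE z in lborel. z \<in> \<bbbD> \<longrightarrow> \<omega> z = \<omega>' z"
proof -
  have w: "weight \<omega>" and pos: "AE z in dA. 0 < \<omega> z" using B by (auto simp: B_class_def)
  obtain \<omega>' where [measurable]: "\<omega>' \<in> borel_measurable borel" and \<omega>': "\<And>z. 0 < \<omega>' z"
    and eq: "AE z in lborel. z \<in> \<bbbD> \<longrightarrow> \<omega> z = \<omega>' z" using weight_borel_version[OF w pos] by blast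
  have [measurable]: "\<bbbD> \<in> sets borel" by simp
  define T where "T S = (\<integral>\<^sup>+z\<in>S. ennreal (\<omega> z * (1 - (cmod z)\<^sup>2) powr (2 * q)) \<partial>dA)
            / ennreal ((measure lebesgue S)\<^sup>2)
        * ennreal_powr
            ((\<integral>\<^sup>+z\<in>S. ennreal (\<omega> z powr (- 1 / (q - 1))) \<partial>dA)
               / ennreal ((measure lebesgue S)\<^sup>2)) (q - 1)" for S
  define k0 where "k0 = (SUP S \<in> Carleson_square ` (\<bbbD> - {0}). T S)"
  have "k0 < \<infinity>" using B unfolding B_class_def k0_def T_def by blast
  then obtain k where k: "k0 = ennreal k" "0 \<le> k" by (cases k0) auto
  \<comment> \<open>\<open>pi powr q\<close> undoes the normalisation of \<open>dA\<close>,
    \<open>16 powr (2 * q)\<close> comes from \<open>|S| \<le> 16 * t^2\<close>, and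
    \<open>k + 1\<close> in place of \<open>k\<close> makes \<open>K\<close> positive.\<close>
  define K where "K = pi powr q * (k + 1) * 16 powr (2 * q)"
  have bound: "(\<integral>\<^sup>+z\<in>polar_square t \<theta>. ennreal (\<omega>' z * (1 - (cmod z)\<^sup>2) powr (2 * q)) \<partial>lborel) *
      ennreal_powr (\<integral>\<^sup>+z\<in>polar_square t \<theta>. ennreal (\<omega>' z powr (- 1 / (q - 1))) \<partial>lborel) (q - 1)
      \<le> ennreal (K * t powr (4 * q))" if t: "0 < t" "t < 1" for t \<theta>
  proof -
    define S where "S = polar_square t \<theta>"
    have [measurable]: "S \<in> sets borel" unfolding S_def using t by simp
    have SD: "S \<subseteq> \<bbbD>" unfolding S_def using polar_square_subset_disc t by blast
    define a where "a = (measure lebesgue S)\<^sup>2"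
    have CS: "S = Carleson_square (of_real (1 - t) * cis \<theta>)"
      unfolding S_def Carleson_square_polar[OF t] ..
    have "of_real (1 - t) * cis \<theta> \<in> \<bbbD> - {0}"
    proof -
      have "cmod (of_real (1 - t) * cis \<theta>) = 1 - t" unfolding norm_mult norm_of_real norm_cis using t by simp
      then show ?thesis using t by auto
    qed
    then have "T S \<le> ennreal k" unfolding k(1)[symmetric] k0_def CS by (intro SUP_upper) blast
    have mS: "0 < measure lebesgue S"
    proof -
      have "ball (of_real (1 - 3 * t / 4) * cis \<theta>) (t / 16) \<subseteq> S"
        using top_half_ball[OF t, of \<theta>] by (auto simp: S_def top_half_def)
      moreover have "S \<in> lmeasurable"
      proof (rule bounded_set_imp_lmeasurable)
        show "bounded S" using SD bounded_ball bounded_subset by blast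
        show "S \<in> sets lebesgue" using \<open>S \<in> sets borel\<close> by simp
      qed
      ultimately have "measure lebesgue (ball (of_real (1 - 3 * t / 4) * cis \<theta>) (t / 16)) \<le> measure lebesgue S"
        by (intro measure_mono_fmeasurable) auto
      moreover have "0 < measure lebesgue (ball (of_real (1 - 3 * t / 4) * cis \<theta>) (t / 16))"
        using t content_ball_gt_0_iff[of "of_real (1 - 3 * t / 4) * cis \<theta>" "t / 16"] by simp
      ultimately show ?thesis by linarith
    qed
    then have a: "0 < a" by (simp add: a_def)
    have "measure lebesgue S \<le> 16 * t\<^sup>2" unfolding S_def by (rule polar_square_measure_le[OF t])
    then have "a \<le> (16 * t\<^sup>2)\<^sup>2" unfolding a_def using mS by (intro power_mono) auto
    also have "\<dots> = (16 powr 2) * (t powr 4)" using t by (simp add: power_mult_distrib)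
    finally have "a powr q \<le> ((16 powr 2) * (t powr 4)) powr q" using a q by (intro powr_mono2) auto
    also have "\<dots> = 16 powr (2 * q) * t powr (4 * q)" by (simp only: powr_mult powr_powr)
    finally have aq: "a powr q \<le> 16 powr (2 * q) * t powr (4 * q)" .
    let ?X = "\<integral>\<^sup>+z\<in>S. ennreal (\<omega>' z * (1 - (cmod z)\<^sup>2) powr (2 * q)) \<partial>lborel"
    let ?Y = "\<integral>\<^sup>+z\<in>S. ennreal (\<omega>' z powr (- 1 / (q - 1))) \<partial>lborel"
    have DS: "(\<integral>\<^sup>+z\<in>\<bbbD>. f z * indicator S z \<partial>lborel) = (\<integral>\<^sup>+z\<in>S. f z \<partial>lborel)" for f :: "complex \<Rightarrow> ennreal"
      using SD by (intro nn_integral_cong) (auto simp: indicator_def)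
    have X: "(\<integral>\<^sup>+z\<in>S. ennreal (\<omega> z * (1 - (cmod z)\<^sup>2) powr (2 * q)) \<partial>dA) = ennreal (1 / pi) * ?X"
      by (subst nn_integral_dA[where G = "\<lambda>z. ennreal (\<omega>' z * (1 - (cmod z)\<^sup>2) powr (2 * q)) * indicator S z"])
        (use eq in \<open>auto simp: DS elim!: eventually_mono\<close>)
    have Y: "(\<integral>\<^sup>+z\<in>S. ennreal (\<omega> z powr (- 1 / (q - 1))) \<partial>dA) = ennreal (1 / pi) * ?Y"
      by (subst nn_integral_dA[where G = "\<lambda>z. ennreal (\<omega>' z powr (- 1 / (q - 1))) * indicator S z"])
        (use eq in \<open>auto simp: DS elim!: eventually_mono\<close>)
    define c where "c = 1 / (pi * a)"
    have c: "0 < c" using a by (simp add: c_def)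
    have div: "ennreal (1 / pi) * Q / ennreal a = ennreal c * Q" for Q
    proof -
      have "ennreal (1 / pi) * Q / ennreal a = (ennreal (1 / pi) * ennreal (1 / a)) * Q"
        using a by (simp add: divide_ennreal_def inverse_ennreal mult_ac inverse_eq_divide)
      also have "ennreal (1 / pi) * ennreal (1 / a) = ennreal c" using a by (simp add: c_def flip: ennreal_mult)
      finally show ?thesis .
    qed
    have "T S = ennreal c * ?X * ennreal_powr (ennreal c * ?Y) (q - 1)"
      unfolding T_def X Y a_def[symmetric] div ..
    also have "\<dots> = (ennreal c * ennreal_powr (ennreal c) (q - 1)) * (?X * ennreal_powr ?Y (q - 1))"
      using q by (simp add: ennreal_powr_mult mult_ac)
    also have "ennreal c * ennreal_powr (ennreal c) (q - 1) = ennreal (c powr q)"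
    proof -
      have "c * c powr (q - 1) = c powr q" using c powr_add[of c 1 "q - 1"] by simp
      then show ?thesis using c by (simp flip: ennreal_mult)
    qed
    finally have "ennreal (c powr q) * (?X * ennreal_powr ?Y (q - 1)) \<le> ennreal k" using \<open>T S \<le> ennreal k\<close> by simp
    then have "ennreal ((1 / c) powr q) * (ennreal (c powr q) * (?X * ennreal_powr ?Y (q - 1))) \<le> ennreal ((1 / c) powr q) * ennreal k"
      by (rule mult_left_mono) simp
    also have "ennreal ((1 / c) powr q) * (ennreal (c powr q) * (?X * ennreal_powr ?Y (q - 1))) = ?X * ennreal_powr ?Y (q - 1)"
    proof -
      have "(1 / c) powr q * c powr q = 1" using c by (simp add: powr_divide)
      then show ?thesis by (simp add: mult.assoc[symmetric] flip: ennreal_mult)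
    qed
    also have "ennreal ((1 / c) powr q) * ennreal k = ennreal (pi powr q * a powr q * k)"
      using k a by (simp add: c_def powr_mult flip: ennreal_mult)
    also have "\<dots> \<le> ennreal (K * t powr (4 * q))"
    proof (rule ennreal_leI)
      have "pi powr q * a powr q * k \<le> pi powr q * (16 powr (2 * q) * t powr (4 * q)) * (k + 1)"
        using aq k by (intro mult_mono) auto
      then show "pi powr q * a powr q * k \<le> K * t powr (4 * q)" by (simp add: K_def mult_ac)
    qed
    finally show ?thesis unfolding S_def .
  qed
  have "Bekolle_weight q K \<omega>'"
  proof
    show "0 < K" using k by (simp add: K_def)
    have "integrable dA \<omega>" using w by (simp add: weight_def)
    then have "(\<integral>\<^sup>+z. ennreal (norm (\<omega> z)) \<partial>dA) < \<infinity>" by (simp add: integrable_iff_bounded)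
    moreover have "(\<integral>\<^sup>+z. ennreal (norm (\<omega> z)) \<partial>dA) = ennreal (1 / pi) * (\<integral>\<^sup>+z\<in>\<bbbD>. ennreal (\<omega>' z) \<partial>lborel)"
      by (rule nn_integral_dA) (use eq \<omega>' in \<open>auto elim!: eventually_mono simp: abs_of_pos\<close>)
    ultimately show "(\<integral>\<^sup>+z\<in>\<bbbD>. ennreal (\<omega>' z) \<partial>lborel) < top"
      using pi_gt_zero by (auto simp: ennreal_mult_less_top ennreal_eq_0_iff simp del: pi_gt_zero)
  qed (use q \<omega>' bound in auto)
  then show ?thesis using eq by (rule that)
qed

text \<open>In this form estimates of the extended-valued \<open>k_fun\<close> reduce to estimates
  of finite real sums.\<close>

lemma k_fun_eq_SUP:
  "k_fun Z z = (SUP F\<in>{F. finite F \<and> F \<subseteq> seq_index Z}. ennreal (\<Sum>i\<in>F. k_term (snd Z i) z))"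
proof -
  have "k_fun Z z = (SUP F\<in>{F. finite F \<and> F \<subseteq> seq_index Z}. ennreal ((cmod z)\<^sup>2 / 2) *
     (\<Sum>i\<in>F. ennreal ((1 - (cmod (snd Z i))\<^sup>2)\<^sup>2 / (cmod (1 - cnj (snd Z i) * z))\<^sup>2)))"
    unfolding k_fun_def by (subst nonneg_infsum_complete) (auto simp: SUP_mult_left_ennreal)
  also have "\<dots> = (SUP F\<in>{F. finite F \<and> F \<subseteq> seq_index Z}. ennreal (\<Sum>i\<in>F. k_term (snd Z i) z))"
  proof (intro SUP_cong refl)
    fix F
    show "ennreal ((cmod z)\<^sup>2 / 2) * (\<Sum>i\<in>F. ennreal ((1 - (cmod (snd Z i))\<^sup>2)\<^sup>2 / (cmod (1 - cnj (snd Z i) * z))\<^sup>2)) =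
        ennreal (\<Sum>i\<in>F. k_term (snd Z i) z)"
      unfolding k_term_def sum_distrib_left[symmetric]
      by (subst ennreal_mult) (simp_all add: sum_ennreal sum_nonneg)
  qed
  finally show ?thesis .
qed

lemma k_term_nonneg: "0 \<le> k_term a z"
  by (simp add: k_term_def)

lemma sum_k_term_le:
  assumes "k_fun Z z \<le> ennreal \<kappa>" "0 \<le> \<kappa>" "finite F" "F \<subseteq> seq_index Z"
  shows "(\<Sum>i\<in>F. k_term (snd Z i) z) \<le> \<kappa>"
proof -
  have "ennreal (\<Sum>i\<in>F. k_term (snd Z i) z) \<le> k_fun Z z"
    unfolding k_fun_eq_SUP using assms by (intro SUP_upper) auto
  then have "ennreal (\<Sum>i\<in>F. k_term (snd Z i) z) \<le> ennreal \<kappa>" using assms(1) by (rule order_trans)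
  then show ?thesis using assms(2) by simp
qed

lemma ereal_exp_le:
  assumes "x \<le> ennreal \<kappa>" "0 \<le> \<kappa>" "0 < p"
  shows "ereal_exp (enn2ereal (ennreal p * x) - ereal h) \<le> ennreal (exp (p * \<kappa> - h))"
proof -
  obtain r where r: "x = ennreal r" "0 \<le> r" using assms by (cases x) (auto simp: top_unique)
  then have "r \<le> \<kappa>" using assms by simp
  have "ennreal p * x = ennreal (p * r)" using r assms by (simp add: ennreal_mult)
  then have "enn2ereal (ennreal p * x) - ereal h = ereal (p * r - h)" using r assms by (simp add: enn2ereal_ennreal)
  then show ?thesis using \<open>r \<le> \<kappa>\<close> assms by (simp add: ereal_exp_def ennreal_leI)
qed

text \<open>An infinite \<open>x\<close> makes the right-hand side infinite, so the bound on
  \<open>y\<close> is asked for finite \<open>x\<close> alone.\<close>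

lemma ereal_exp_ge:
  assumes "0 < p" "x \<noteq> top \<Longrightarrow> y \<le> exp (p * enn2real x - h)"
  shows "ennreal y \<le> ereal_exp (enn2ereal (ennreal p * x) - ereal h)"
proof (cases x)
  case (real r)
  then have "ennreal p * x = ennreal (p * r)" using assms by (simp add: ennreal_mult)
  then have "enn2ereal (ennreal p * x) - ereal h = ereal (p * r - h)" using real assms by (simp add: enn2ereal_ennreal)
  then show ?thesis using assms real by (simp add: ereal_exp_def ennreal_leI)
next
  case top
  then have "ennreal p * x = top" using assms by (simp add: ennreal_mult_top ennreal_eq_0_iff)
  then show ?thesis by (simp add: ereal_exp_def enn2ereal_top)
qed

section \<open>Zero sequences\<close>

lemma zero_product_of_bounded_sums:
  assumes Z: "seq_in Z \<bbbD>" and c: "0 < c"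
    and bound: "\<And>F. finite F \<Longrightarrow> F \<subseteq> seq_index Z \<Longrightarrow> (\<Sum>i\<in>F. c * (1 - (cmod (snd Z i))\<^sup>2)\<^sup>2) \<le> M"
  shows "zero_product (snd Z) (seq_index Z)"
proof
  show "cmod (snd Z n) < 1" if "n \<in> seq_index Z" for n using Z that by (auto simp: seq_in_def)
  show "summable (\<lambda>n. if n \<in> seq_index Z then (1 - (cmod (snd Z n))\<^sup>2)\<^sup>2 else 0)"
  proof (rule summableI_nonneg_bounded)
    fix n
    have "c * (\<Sum>i<n. if i \<in> seq_index Z then (1 - (cmod (snd Z i))\<^sup>2)\<^sup>2 else 0) =
        (\<Sum>i\<in>{..<n} \<inter> seq_index Z. c * (1 - (cmod (snd Z i))\<^sup>2)\<^sup>2)"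
      by (simp add: sum.If_cases sum_distrib_left)
    also have "\<dots> \<le> M" by (rule bound) auto
    finally show "(\<Sum>i<n. if i \<in> seq_index Z then (1 - (cmod (snd Z i))\<^sup>2)\<^sup>2 else 0) \<le> M / c"
      using c by (simp add: pos_le_divide_eq mult.commute)
  qed simp
qed

lemma (in zero_product) cmod_F_le:
  assumes z: "cmod z < 1" and \<kappa>: "\<And>F. finite F \<Longrightarrow> F \<subseteq> I \<Longrightarrow> (\<Sum>i\<in>F. k_term (a i) z) \<le> \<kappa>"
  shows "cmod (F z) \<le> exp \<kappa>"
proof -
  have "(\<lambda>N. cmod (\<Prod>n<N. factor n z)) \<longlonglongrightarrow> cmod (F z)"
    using LIMSEQ_prod[OF z] by (rule tendsto_norm)
  moreover have "cmod (\<Prod>n<N. factor n z) \<le> exp \<kappa>" for N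
  proof -
    have "cmod (\<Prod>n<N. factor n z) = (\<Prod>n<N. cmod (factor n z))" by (simp add: prod_norm)
    also have "\<dots> \<le> (\<Prod>n<N. if n \<in> I then exp (k_term (a n) z) else 1)"
      by (intro prod_mono) (auto simp: factor_def intro: cmod_zero_factor_le[OF a_in z])
    also have "\<dots> = exp (\<Sum>n\<in>{..<N} \<inter> I. k_term (a n) z)"
      by (simp add: prod.If_cases exp_sum)
    also have "\<dots> \<le> exp \<kappa>" using \<kappa>[of "{..<N} \<inter> I"] by simp
    finally show ?thesis .
  qed
  ultimately show ?thesis by (intro LIMSEQ_le_const2) auto
qed

lemma (in zero_product) is_zero_sequence_of_F:
  assumes "seq_index Z = I" "snd Z = a"
  shows "is_zero_sequence_of Z F"
  unfolding is_zero_sequence_of_def seq_in_def using assms a_in finite_occs zorder by auto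

text \<open>
  Where \<open>k\<^sub>Z = \<infinity>\<close> the integrand is infinite, so finiteness of the integral yields a point
  \<open>z \<noteq> 0\<close> with \<open>k\<^sub>Z z < \<infinity>\<close>, which bounds \<open>\<Sum> (1 - |a|\<^sup>2)\<^sup>2\<close>.
\<close>

lemma zero_sequence_of_harmonic_majorant:
  assumes p: "0 < p" and pos: "AE z in dA. 0 < \<omega> z" and Z: "seq_in Z \<bbbD>"
    and h: "h harmonic_on \<bbbD>"
    and fin: "(\<integral>\<^sup>+z. ereal_exp (enn2ereal (ennreal p * k_fun Z z) - ereal (h z)) * ennreal (\<omega> z) \<partial>dA) < \<infinity>"
  shows "Z \<in> zero_sequences p \<omega>"
proof -
  have ex: "\<exists>z\<in>\<bbbD>. z \<noteq> 0 \<and> k_fun Z z \<noteq> top"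
  proof (rule ccontr)
    assume "\<not> ?thesis"
    then have top: "k_fun Z z = top" if "z \<in> \<bbbD>" "z \<noteq> 0" for z using that by blast
    have "AE z in lborel. z \<in> \<bbbD> \<longrightarrow> 0 < \<omega> z" using pos by (simp only: AE_dA_iff)
    then have "AE z in lborel. z \<in> \<bbbD> \<longrightarrow>
        ereal_exp (enn2ereal (ennreal p * k_fun Z z) - ereal (h z)) * ennreal (\<omega> z) = top"
      using AE_lborel_singleton[of 0]
    proof eventually_elim
      case (elim z)
      show ?case
      proof
        assume z: "z \<in> \<bbbD>"
        then have "ennreal p * k_fun Z z = top" using top[of z] elim p by (simp add: ennreal_mult_top ennreal_eq_0_iff)
        then show "ereal_exp (enn2ereal (ennreal p * k_fun Z z) - ereal (h z)) * ennreal (\<omega> z) = top"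
          using elim z by (simp add: ereal_exp_def enn2ereal_top ennreal_top_mult ennreal_eq_0_iff)
      qed
    qed
    then have "(\<integral>\<^sup>+z. ereal_exp (enn2ereal (ennreal p * k_fun Z z) - ereal (h z)) * ennreal (\<omega> z) \<partial>dA) =
        ennreal (1 / pi) * (\<integral>\<^sup>+z\<in>\<bbbD>. top \<partial>(lborel :: complex measure))"
      by (intro nn_integral_dA) auto
    also have "(\<integral>\<^sup>+z\<in>\<bbbD>. top \<partial>(lborel :: complex measure)) = top * emeasure lborel \<bbbD>"
      by (rule nn_integral_cmult_indicator) simp
    also have "\<dots> = top" by (simp add: emeasure_ball unit_ball_vol_2 ennreal_top_mult ennreal_eq_0_iff pi_gt_zero not_le)
    finally show False using fin pi_gt_zero
      by (auto simp: ennreal_mult_top ennreal_eq_0_iff simp del: pi_gt_zero)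
  qed
  then obtain z0 where z0: "z0 \<in> \<bbbD>" "z0 \<noteq> 0" "k_fun Z z0 \<noteq> top" by blast
  have aD: "cmod (snd Z i) < 1" if "i \<in> seq_index Z" for i using Z that by (auto simp: seq_in_def)
  have "zero_product (snd Z) (seq_index Z)"
  proof (rule zero_product_of_bounded_sums[OF Z])
    \<comment> \<open>The constant combines \<open>|z0|^2 / 2\<close> from \<open>k_term\<close>
      with \<open>|1 - cnj a z0|^2 \<le> 4\<close>. It is positive because
      \<open>z0 \<noteq> 0\<close>; at the origin \<open>k_fun Z 0 = 0\<close> for every
      \<open>Z\<close>, which says nothing about \<open>Z\<close>.\<close>
    show "0 < (cmod z0)\<^sup>2 / 8" using z0 by simp
    fix F assume F: "finite F" "F \<subseteq> seq_index Z"
    have "(\<Sum>i\<in>F. (cmod z0)\<^sup>2 / 8 * (1 - (cmod (snd Z i))\<^sup>2)\<^sup>2) \<le> (\<Sum>i\<in>F. k_term (snd Z i) z0)"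
    proof (rule sum_mono)
      fix i assume i: "i \<in> F"
      let ?w = "1 - cnj (snd Z i) * z0"
      have a: "cmod (snd Z i) < 1" using i F aD by blast
      have nz: "?w \<noteq> 0" using one_minus_cnj_mult_nonzero[OF a, of z0] z0 by simp
      have "(cmod ?w)\<^sup>2 \<le> 4" using cmod_one_minus_cnj_mult_sq_le[OF a, of z0] z0 by simp
      then have "(1 - (cmod (snd Z i))\<^sup>2)\<^sup>2 / 4 \<le> (1 - (cmod (snd Z i))\<^sup>2)\<^sup>2 / (cmod ?w)\<^sup>2"
        using nz by (intro divide_left_mono) auto
      then have "(cmod z0)\<^sup>2 / 2 * ((1 - (cmod (snd Z i))\<^sup>2)\<^sup>2 / 4) \<le> (cmod z0)\<^sup>2 / 2 * ((1 - (cmod (snd Z i))\<^sup>2)\<^sup>2 / (cmod ?w)\<^sup>2)"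
        by (intro mult_left_mono) auto
      then show "(cmod z0)\<^sup>2 / 8 * (1 - (cmod (snd Z i))\<^sup>2)\<^sup>2 \<le> k_term (snd Z i) z0" by (simp add: k_term_def)
    qed
    also have "\<dots> \<le> enn2real (k_fun Z z0)"
      using z0 F by (intro sum_k_term_le) (auto simp: less_top)
    finally show "(\<Sum>i\<in>F. (cmod z0)\<^sup>2 / 8 * (1 - (cmod (snd Z i))\<^sup>2)\<^sup>2) \<le> enn2real (k_fun Z z0)" .
  qed
  then interpret P: zero_product "snd Z" "seq_index Z" .
  obtain H where H: "H holomorphic_on \<bbbD>" "\<And>z. z \<in> \<bbbD> \<Longrightarrow> h z = Re (H z)"
    using harmonic_on_imp_Re_holomorphic[OF h convex_ball] by blast
  define E where "E z = exp (- H z / of_real p)" for z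
  have E: "E holomorphic_on \<bbbD>" unfolding E_def using H(1) p by (intro holomorphic_intros) auto
  define f where "f z = P.F z * E z" for z
  have f: "f holomorphic_on \<bbbD>" unfolding f_def using P.holomorphic E by (intro holomorphic_intros)
  have pt: "ennreal (cmod (f z) powr p * \<omega> z) \<le>
      ereal_exp (enn2ereal (ennreal p * k_fun Z z) - ereal (h z)) * ennreal (\<omega> z)" if z: "z \<in> \<bbbD>" "0 < \<omega> z" for z
  proof -
    have Ep: "cmod (E z) powr p = exp (- h z)"
      using p H(2)[OF z(1)] by (simp add: E_def exp_powr_real)
    have "cmod (f z) powr p \<le> exp (p * enn2real (k_fun Z z) - h z)" if fin: "k_fun Z z \<noteq> top"
    proof -
      have "cmod (P.F z) \<le> exp (enn2real (k_fun Z z))"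
        using z fin by (intro P.cmod_F_le sum_k_term_le) (auto simp: less_top)
      then have "cmod (P.F z) powr p \<le> exp (enn2real (k_fun Z z)) powr p" using p by (intro powr_mono2) auto
      then have "cmod (P.F z) powr p * exp (- h z) \<le> exp (enn2real (k_fun Z z)) powr p * exp (- h z)"
        by (intro mult_right_mono) auto
      also have "\<dots> = exp (p * enn2real (k_fun Z z) - h z)"
        by (simp add: exp_powr_real exp_diff exp_minus field_simps)
      finally show ?thesis by (simp add: f_def norm_mult powr_mult Ep)
    qed
    then have "ennreal (cmod (f z) powr p) \<le> ereal_exp (enn2ereal (ennreal p * k_fun Z z) - ereal (h z))"
      by (intro ereal_exp_ge p)
    then show ?thesis using z by (simp add: ennreal_mult mult_right_mono)
  qed
  have "(\<integral>\<^sup>+z. ennreal (cmod (f z) powr p * \<omega> z) \<partial>dA) \<le>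
      (\<integral>\<^sup>+z. ereal_exp (enn2ereal (ennreal p * k_fun Z z) - ereal (h z)) * ennreal (\<omega> z) \<partial>dA)"
  proof (rule nn_integral_mono_AE)
    have "AE z in dA. z \<in> \<bbbD>" by (simp only: AE_dA_iff) simp
    then show "AE z in dA. ennreal (cmod (f z) powr p * \<omega> z) \<le>
        ereal_exp (enn2ereal (ennreal p * k_fun Z z) - ereal (h z)) * ennreal (\<omega> z)"
      using pos by eventually_elim (rule pt)
  qed
  then have "f \<in> weighted_Bergman p \<omega>"
    unfolding weighted_Bergman_def using f fin by (auto intro: order_le_less_trans)
  moreover have "\<exists>z\<in>\<bbbD>. f z \<noteq> 0" using P.not_identically_zero by (auto simp: f_def E_def)
  moreover have "is_zero_sequence_of Z f"
  proof -
    have "zorder f z = zorder P.F z" if z: "z \<in> \<bbbD>" for z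
    proof -
      have ana: "g analytic_on {z}" if "g holomorphic_on \<bbbD>" for g using that z by (metis analytic_at open_ball)
      obtain b where "b \<in> \<bbbD>" "P.F b \<noteq> 0" using P.not_identically_zero by blast
      then have "eventually (\<lambda>w. P.F w \<noteq> 0 \<and> w \<in> \<bbbD>) (at z)"
        by (intro non_zero_neighbour_alt[where \<beta> = b] P.holomorphic z) auto
      then have "eventually (\<lambda>w. P.F w * E w \<noteq> 0) (at z)" by eventually_elim (simp add: E_def)
      then have "zorder f z = zorder P.F z + zorder E z"
        unfolding f_def[abs_def] by (intro zorder_times_analytic ana P.holomorphic E)
      moreover have "zorder E z = 0" by (rule zorder_eq_0I[OF ana[OF E]]) (simp add: E_def)
      ultimately show ?thesis by simp
    qed
    then show ?thesis using P.is_zero_sequence_of_F[of Z] unfolding is_zero_sequence_of_def by auto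
  qed
  ultimately show ?thesis unfolding zero_sequences_def by blast
qed

text \<open>This follows from \<open>- ln b \<ge> 1 - b\<close> and
  \<open>1 - b^2 \<le> 2 * (1 - b)\<close>. It converts the bound on finite products in
  \<open>Berezin_zero_bound\<close> into convergence of \<open>\<Sum> (1 - |a|^2)^2\<close>, which
  must be known before the canonical product can be formed.\<close>

lemma zero_deficit_ge:
  fixes b :: real
  assumes "0 < b" "b < 1"
  shows "(1 - b\<^sup>2)\<^sup>2 / 8 \<le> - ln b - (1 - b\<^sup>2) / 2"
proof -
  have "(1 - b\<^sup>2)\<^sup>2 = (1 - b)\<^sup>2 * (1 + b)\<^sup>2" by (simp add: power2_eq_square algebra_simps)
  also have "\<dots> \<le> (1 - b)\<^sup>2 * 2\<^sup>2" using assms by (intro mult_left_mono power_mono) auto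
  finally have "(1 - b\<^sup>2)\<^sup>2 / 8 \<le> (1 - b)\<^sup>2 / 2" by simp
  also have "\<dots> = (1 - b) - (1 - b\<^sup>2) / 2" by (simp add: power2_eq_square field_simps)
  also have "\<dots> \<le> - ln b - (1 - b\<^sup>2) / 2" using ln_le_minus_one[of b] assms by simp
  finally show ?thesis .
qed

text \<open>An exact identity: the modulus of a partial product falls short of
  \<open>exp (\<Sum> k_term)\<close> by precisely the factors that \<open>Berezin_zero_bound\<close>
  gains.\<close>

lemma (in zero_product) exp_sum_k_term:
  assumes z: "cmod z < 1" and nz: "\<And>n. n \<in> I \<Longrightarrow> a n \<noteq> z"
  shows "exp (\<Sum>n\<in>{..<N} \<inter> I. k_term (a n) z) = cmod (\<Prod>n<N. factor n z) *
    (\<Prod>n\<in>{..<N} \<inter> I. exp (- (1 - (cmod (disc_involution z (a n)))\<^sup>2) / 2) / cmod (disc_involution z (a n)))"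
proof -
  have "cmod (\<Prod>n<N. factor n z) = (\<Prod>n<N. if n \<in> I then cmod (zero_factor (a n) z) else 1)"
    unfolding prod_norm[symmetric] by (intro prod.cong) (auto simp: factor_def)
  also have "\<dots> = (\<Prod>n\<in>{..<N} \<inter> I. cmod (zero_factor (a n) z))" by (simp add: prod.If_cases)
  finally have 1: "cmod (\<Prod>n<N. factor n z) = (\<Prod>n\<in>{..<N} \<inter> I. cmod (zero_factor (a n) z))" .
  have "exp (k_term (a n) z) = cmod (zero_factor (a n) z) *
      (exp (- (1 - (cmod (disc_involution z (a n)))\<^sup>2) / 2) / cmod (disc_involution z (a n)))" if n: "n \<in> I" for n
  proof -
    let ?b = "cmod (disc_involution z (a n))"
    have "?b \<noteq> 0" using disc_involution_eq_0_iff[OF z a_in[OF n]] nz[OF n] by auto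
    moreover have "cmod (zero_factor (a n) z) = ?b * exp (k_term (a n) z + (1 - ?b\<^sup>2) / 2)"
      using cmod_zero_factor[OF a_in[OF n] z] unfolding cmod_disc_involution_commute[of "a n" z] .
    moreover have "exp (k_term (a n) z + (1 - ?b\<^sup>2) / 2) * exp (- (1 - ?b\<^sup>2) / 2) = exp (k_term (a n) z)"
      unfolding exp_add[symmetric] by (simp add: diff_divide_distrib)
    ultimately show ?thesis by simp
  qed
  then show ?thesis unfolding 1 by (simp add: exp_sum flip: prod.distrib)
qed

context Bekolle_weight
begin

text \<open>
  With \<open>f = h\<^sub>0 F\<close> and \<open>h\<^sub>0\<close> zero-free, \<open>exp k\<^sub>Z |h\<^sub>0|\<close> is the increasing limit of the products
  that are controlled by \<open>Berezin_zero_bound\<close> with exponent \<open>p / q\<close>; hence it lies in the weighted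
  space by \<open>Berezin_bounded\<close>.
\<close>

lemma harmonic_majorant_of_zero_sequence:
  assumes p: "0 < p" and f: "f holomorphic_on \<bbbD>" and nz: "\<exists>z\<in>\<bbbD>. f z \<noteq> 0"
    and Z: "is_zero_sequence_of Z f"
    and fin: "(\<integral>\<^sup>+w\<in>\<bbbD>. ennreal (cmod (f w) powr p * \<omega> w) \<partial>lborel) < top"
  obtains h G where "h harmonic_on \<bbbD>" "G \<in> borel_measurable borel"
    "AE z in lborel. z \<in> \<bbbD> \<longrightarrow> ereal_exp (enn2ereal (ennreal p * k_fun Z z) - ereal (h z)) \<le> G z"
    "(\<integral>\<^sup>+z\<in>\<bbbD>. G z * ennreal (\<omega> z) \<partial>lborel) < top"
proof -
  have [measurable]: "\<bbbD> \<in> sets borel" by simp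
  define s where "s = p / q"
  have s: "0 < s" "s * q = p" using p q by (auto simp: s_def)
  define ft where "ft w = indicator \<bbbD> w *\<^sub>R f w" for w
  have [measurable]: "ft \<in> borel_measurable borel"
    unfolding ft_def[abs_def]
    by (rule borel_measurable_continuous_on_indicator) (use f holomorphic_on_imp_continuous_on in auto)
  define g where "g w = ennreal (cmod (ft w) powr s)" for w
  have [measurable]: "g \<in> borel_measurable borel" unfolding g_def[abs_def] by measurable
  have gq: "(\<integral>\<^sup>+w\<in>\<bbbD>. ennreal_powr (g w) q * ennreal (\<omega> w) \<partial>lborel) < top"
  proof -
    have "(\<integral>\<^sup>+w\<in>\<bbbD>. ennreal_powr (g w) q * ennreal (\<omega> w) \<partial>lborel) =
        (\<integral>\<^sup>+w\<in>\<bbbD>. ennreal (cmod (f w) powr p * \<omega> w) \<partial>lborel)"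
      using s by (intro nn_integral_cong) (auto simp: indicator_def g_def ft_def powr_powr ennreal_mult' )
    then show ?thesis using fin by simp
  qed
  \<comment> \<open>Near the circle this is Hoelder's inequality with the dual weight; on
    \<open>|w| \<le> 1/2\<close> the continuous function \<open>f\<close> is bounded.\<close>
  have g1: "(\<integral>\<^sup>+w\<in>\<bbbD>. g w \<partial>lborel) < top"
  proof -
    let ?A = "{z :: complex. 1/2 < cmod z \<and> cmod z < 1}"
    have "open ?A" by (intro open_Collect_conj open_Collect_less continuous_intros)
    then have [measurable]: "?A \<in> sets borel" by simp
    have "compact (f ` cball 0 (1/2))"
      by (intro compact_continuous_image continuous_on_subset[OF holomorphic_on_imp_continuous_on[OF f]]) auto
    then obtain M where M: "\<And>w. cmod w \<le> 1/2 \<Longrightarrow> cmod (f w) \<le> M"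
      by (force dest!: compact_imp_bounded simp: bounded_iff)
    have "(\<integral>\<^sup>+w\<in>\<bbbD>. g w \<partial>lborel) \<le> (\<integral>\<^sup>+w. g w * indicator ?A w + ennreal (M powr s) * indicator (cball 0 (1/2)) w \<partial>lborel)"
    proof (rule nn_integral_mono)
      fix w
      show "g w * indicator \<bbbD> w \<le> g w * indicator ?A w + ennreal (M powr s) * indicator (cball 0 (1/2)) w"
      proof (cases "cmod w \<le> 1/2")
        case True
        have "cmod (f w) powr s \<le> M powr s" using M[OF True] s by (intro powr_mono2) auto
        then show ?thesis using True by (auto simp: g_def ft_def indicator_def intro: ennreal_leI)
      qed (auto simp: indicator_def)
    qed
    also have "\<dots> = (\<integral>\<^sup>+w\<in>?A. g w \<partial>lborel) + ennreal (M powr s) * emeasure lborel (cball 0 (1/2) :: complex set)"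
    proof -
      have "(\<integral>\<^sup>+w. ennreal (M powr s) * indicator (cball 0 (1/2) :: complex set) w \<partial>lborel) =
          ennreal (M powr s) * emeasure lborel (cball 0 (1/2) :: complex set)"
        by (rule nn_integral_cmult_indicator) simp
      moreover have "(\<integral>\<^sup>+w. g w * indicator ?A w + ennreal (M powr s) * indicator (cball 0 (1/2)) w \<partial>lborel) =
          (\<integral>\<^sup>+w\<in>?A. g w \<partial>lborel) + (\<integral>\<^sup>+w. ennreal (M powr s) * indicator (cball 0 (1/2) :: complex set) w \<partial>lborel)"
        by (rule nn_integral_add) (measurable, simp)
      ultimately show ?thesis by (simp only:)
    qed
    also have "\<dots> < top"
    proof -
      have "(\<integral>\<^sup>+w\<in>?A. g w \<partial>lborel) < top" by (rule nn_integral_annulus_fin[OF _ gq]) measurable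
      moreover have "emeasure lborel (cball 0 (1/2) :: complex set) < top"
        using emeasure_bounded_finite[OF bounded_cball] by simp
      ultimately show ?thesis by (simp add: ennreal_mult_less_top)
    qed
    finally show ?thesis .
  qed
  define Bz where "Bz z = ennreal ((1 - (cmod z)\<^sup>2)\<^sup>2) * (\<integral>\<^sup>+w\<in>\<bbbD>. ennreal (1 / cmod (1 - cnj z * w) ^ 4) * g w \<partial>lborel)" for z
  have Bmeas [measurable]: "Bz \<in> borel_measurable borel"
  proof -
    have "(\<lambda>p. cmod (1 - cnj (fst p) * snd p)) \<in> borel_measurable (borel :: (complex \<times> complex) measure)"
      by (intro borel_measurable_continuous_onI continuous_intros)
    then have "(\<lambda>p. cmod (1 - cnj (fst p) * snd p)) \<in> borel_measurable (borel \<Otimes>\<^sub>M (borel :: complex measure))"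
      by (simp only: borel_prod)
    then have [measurable]: "(\<lambda>p. cmod (1 - cnj (fst p) * snd p)) \<in> borel_measurable (borel \<Otimes>\<^sub>M (lborel :: complex measure))"
      by (simp cong: measurable_cong_sets sets_pair_measure_cong)
    have "(\<lambda>p. ennreal (1 / cmod (1 - cnj (fst p) * snd p) ^ 4) * g (snd p) * indicator \<bbbD> (snd p))
        \<in> borel_measurable (borel \<Otimes>\<^sub>M (lborel :: complex measure))" by measurable
    then have [measurable]: "(\<lambda>z. \<integral>\<^sup>+w\<in>\<bbbD>. ennreal (1 / cmod (1 - cnj z * w) ^ 4) * g w \<partial>lborel) \<in> borel_measurable borel"
      by (intro lborel.borel_measurable_nn_integral) (simp add: case_prod_beta')
    have [measurable]: "(\<lambda>z::complex. (1 - (cmod z)\<^sup>2)\<^sup>2) \<in> borel_measurable borel" by measurable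
    show ?thesis unfolding Bz_def[abs_def] by measurable
  qed
  have Bq: "(\<integral>\<^sup>+z\<in>\<bbbD>. ennreal_powr (Bz z) q * ennreal (\<omega> z) \<partial>lborel) < top"
    unfolding Bz_def by (rule Berezin_bounded[OF _ g1 gq]) measurable
  have Bfin: "Bz z < top" if z: "z \<in> \<bbbD>" for z
  proof -
    have "(\<integral>\<^sup>+w\<in>\<bbbD>. ennreal (1 / cmod (1 - cnj z * w) ^ 4) * g w \<partial>lborel) \<le>
        (\<integral>\<^sup>+w. ennreal (1 / (1 - cmod z) ^ 4) * (g w * indicator \<bbbD> w) \<partial>lborel)"
    proof (rule nn_integral_mono)
      fix w
      show "ennreal (1 / cmod (1 - cnj z * w) ^ 4) * g w * indicator \<bbbD> w \<le> ennreal (1 / (1 - cmod z) ^ 4) * (g w * indicator \<bbbD> w)"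
      proof (cases "w \<in> \<bbbD>")
        case True
        have "cmod z * cmod w \<le> cmod z" using True by (simp add: mult_left_le)
        then have "1 - cmod z \<le> 1 - cmod (cnj z * w)" by (simp add: norm_mult)
        also have "\<dots> \<le> cmod (1 - cnj z * w)" using norm_triangle_ineq2[of 1 "cnj z * w"] by simp
        finally have "1 / cmod (1 - cnj z * w) ^ 4 \<le> 1 / (1 - cmod z) ^ 4"
          using z by (intro divide_left_mono power_mono mult_pos_pos zero_less_power) auto
        then show ?thesis using True by (auto intro!: mult_right_mono ennreal_leI)
      qed simp
    qed
    also have "\<dots> = ennreal (1 / (1 - cmod z) ^ 4) * (\<integral>\<^sup>+w\<in>\<bbbD>. g w \<partial>lborel)"
      by (rule nn_integral_cmult) measurable
    also have "\<dots> < top" using g1 by (simp add: ennreal_mult_less_top)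
    finally show ?thesis unfolding Bz_def by (simp add: ennreal_mult_less_top)
  qed
  define \<beta> where "\<beta> z i = cmod (disc_involution z (snd Z i))" for z i
  define Q where "Q z F = (\<Prod>i\<in>F. exp (- (1 - (\<beta> z i)\<^sup>2) / 2) / \<beta> z i)" for z F
  define M where "M z = enn2real (Bz z) powr (1 / s)" for z
  \<comment> \<open>A root of order \<open>s\<close> is taken and \<open>pi \<ge> 1\<close> is
    dropped. The bound \<open>M z\<close> does not depend on the finite set \<open>F\<close>, which
    permits the passage to infinite products below.\<close>
  have prod_le: "cmod (f z) * Q z F \<le> M z" if z: "z \<in> \<bbbD>" and fz: "f z \<noteq> 0" and F: "finite F" "F \<subseteq> seq_index Z" for z F
  proof -
    have [measurable]: "(\<lambda>w. cmod (1 - cnj z * w)) \<in> borel_measurable borel"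
      by (intro borel_measurable_continuous_onI continuous_intros)
    have "ennreal (pi * (cmod (f z) * Q z F) powr s) \<le>
        (\<integral>\<^sup>+w\<in>\<bbbD>. ennreal (cmod (f w) powr s * ((1 - (cmod z)\<^sup>2)\<^sup>2 / cmod (1 - cnj z * w) ^ 4)) \<partial>lborel)"
      unfolding Q_def \<beta>_def using z by (intro Berezin_zero_bound[OF f Z _ fz s(1) F]) simp
    also have "\<dots> = (\<integral>\<^sup>+w. ennreal ((1 - (cmod z)\<^sup>2)\<^sup>2) * (ennreal (1 / cmod (1 - cnj z * w) ^ 4) * g w * indicator \<bbbD> w) \<partial>lborel)"
      by (intro nn_integral_cong) (auto simp: indicator_def g_def ft_def mult.commute simp flip: ennreal_mult)
    also have "\<dots> = Bz z" unfolding Bz_def by (rule nn_integral_cmult) measurable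
    also have "\<dots> = ennreal (enn2real (Bz z))" using Bfin[OF z] by (simp add: less_top)
    finally have "pi * (cmod (f z) * Q z F) powr s \<le> enn2real (Bz z)" by simp
    moreover have "1 * (cmod (f z) * Q z F) powr s \<le> pi * (cmod (f z) * Q z F) powr s"
      using pi_ge_two by (intro mult_right_mono) auto
    ultimately have "(cmod (f z) * Q z F) powr s \<le> enn2real (Bz z)" by linarith
    then have "((cmod (f z) * Q z F) powr s) powr (1 / s) \<le> M z"
      unfolding M_def using s by (intro powr_mono2) auto
    moreover have "0 \<le> cmod (f z) * Q z F" unfolding Q_def \<beta>_def by (intro mult_nonneg_nonneg prod_nonneg) auto
    ultimately show ?thesis using s by (simp add: powr_powr)
  qed
  have Mpos: "0 < M z" if "z \<in> \<bbbD>" "f z \<noteq> 0" for z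
    using prod_le[OF that, of "{}"] that by (simp add: Q_def) (use zero_less_norm_iff less_le_trans in blast)
  note aD = zero_sequence_in_disc[OF Z]
  have \<beta>: "0 < \<beta> z i" "\<beta> z i < 1" if "z \<in> \<bbbD>" "f z \<noteq> 0" "i \<in> seq_index Z" for z i
  proof -
    have "snd Z i \<noteq> z" using zero_sequence_eq_0_iff[OF f nz Z that(1)] that by blast
    then show "0 < \<beta> z i" unfolding \<beta>_def using disc_involution_eq_0_iff[of z "snd Z i"] aD[OF that(3)] that(1) by auto
    show "\<beta> z i < 1" unfolding \<beta>_def using cmod_disc_involution_less_1[of z "snd Z i"] aD[OF that(3)] that(1) by simp
  qed
  have "zero_product (snd Z) (seq_index Z)"
  proof -
    obtain z where z: "z \<in> \<bbbD>" "f z \<noteq> 0" using nz by blast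
    \<comment> \<open>One point \<open>z\<close> that is not a zero is enough. There
      \<open>1 - \<beta>^2 \<ge> N * (1 - |a|^2) / 4\<close>, and \<open>zero_deficit_ge\<close>
      yields the constant \<open>(1/4)^2 / 8 = 1/128\<close>.\<close>
    define N where "N = 1 - (cmod z)\<^sup>2"
    have N: "0 < N" using z by (simp add: N_def abs_square_less_1)
    show ?thesis
    proof (rule zero_product_of_bounded_sums)
      show "seq_in Z \<bbbD>" using Z by (simp add: is_zero_sequence_of_def)
      show "0 < N\<^sup>2 / 128" using N by simp
      fix F assume F: "finite F" "F \<subseteq> seq_index Z"
      have "(\<Sum>i\<in>F. N\<^sup>2 / 128 * (1 - (cmod (snd Z i))\<^sup>2)\<^sup>2) \<le> (\<Sum>i\<in>F. - ln (\<beta> z i) - (1 - (\<beta> z i)\<^sup>2) / 2)"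
      proof (rule sum_mono)
        fix i assume "i \<in> F"
        then have i: "i \<in> seq_index Z" using F by blast
        let ?t = "1 - (cmod (snd Z i))\<^sup>2" and ?w = "1 - cnj z * snd Z i"
        have t: "0 \<le> ?t" using aD[OF i] by (simp add: abs_square_le_1)
        have nzw: "?w \<noteq> 0" using one_minus_cnj_mult_nonzero[of z, OF _ aD[OF i]] z by simp
        have "(cmod ?w)\<^sup>2 \<le> 4" using cmod_one_minus_cnj_mult_sq_le[of z, OF _ aD[OF i]] z by simp
        then have "N * ?t / 4 \<le> N * ?t / (cmod ?w)\<^sup>2"
          using nzw N t by (intro divide_left_mono mult_nonneg_nonneg) auto
        also have "\<dots> = 1 - (\<beta> z i)\<^sup>2"
          unfolding \<beta>_def N_def using one_minus_disc_involution_sq[of z "snd Z i"] z aD[OF i] by simp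
        finally have "(N * ?t / 4)\<^sup>2 \<le> (1 - (\<beta> z i)\<^sup>2)\<^sup>2" using N t by (intro power_mono) auto
        then have "N\<^sup>2 / 128 * ?t\<^sup>2 \<le> (1 - (\<beta> z i)\<^sup>2)\<^sup>2 / 8" by (simp add: power_mult_distrib power_divide)
        also have "\<dots> \<le> - ln (\<beta> z i) - (1 - (\<beta> z i)\<^sup>2) / 2" by (rule zero_deficit_ge[OF \<beta>[OF z i]])
        finally show "N\<^sup>2 / 128 * ?t\<^sup>2 \<le> - ln (\<beta> z i) - (1 - (\<beta> z i)\<^sup>2) / 2" .
      qed
      also have "exp (\<Sum>i\<in>F. - ln (\<beta> z i) - (1 - (\<beta> z i)\<^sup>2) / 2) = Q z F"
      proof -
        have "exp (- ln (\<beta> z i) - (1 - (\<beta> z i)\<^sup>2) / 2) = exp (- (1 - (\<beta> z i)\<^sup>2) / 2) / \<beta> z i" if "i \<in> F" for i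
        proof -
          have b: "0 < \<beta> z i" using \<beta>[OF z] that F by blast
          have "- ln (\<beta> z i) - (1 - (\<beta> z i)\<^sup>2) / 2 = - (1 - (\<beta> z i)\<^sup>2) / 2 - ln (\<beta> z i)"
            by (simp add: field_simps)
          then show ?thesis by (simp only: exp_diff exp_ln[OF b])
        qed
        then show ?thesis unfolding Q_def using F by (simp add: exp_sum)
      qed
      then have "(\<Sum>i\<in>F. - ln (\<beta> z i) - (1 - (\<beta> z i)\<^sup>2) / 2) = ln (Q z F)" by (metis ln_exp)
      also have "\<dots> \<le> ln (M z / cmod (f z))"
      proof -
        have "Q z F \<le> M z / cmod (f z)" using prod_le[OF z F] z by (simp add: field_simps)
        moreover have "0 < Q z F" unfolding Q_def using \<beta>[OF z] F by (intro prod_pos) (auto simp: subset_iff)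
        ultimately show ?thesis by (intro ln_mono; linarith)
      qed
      finally show "(\<Sum>i\<in>F. N\<^sup>2 / 128 * (1 - (cmod (snd Z i))\<^sup>2)\<^sup>2) \<le> ln (M z / cmod (f z))" .
    qed
  qed
  then interpret P: zero_product "snd Z" "seq_index Z" .
  have zP: "P.F z = 0 \<longleftrightarrow> f z = 0" if "z \<in> \<bbbD>" for z
    using P.eq_0_iff[of z] zero_sequence_eq_0_iff[OF f nz Z that] that by auto
  obtain h0 where h0: "h0 holomorphic_on \<bbbD>" "\<And>z. z \<in> \<bbbD> \<Longrightarrow> h0 z \<noteq> 0" "\<And>z. z \<in> \<bbbD> \<Longrightarrow> f z = h0 z * P.F z"
  proof (rule holomorphic_zorder_factorization[OF f open_ball _ P.holomorphic])
    show "zorder P.F z = zorder f z" if "z \<in> \<bbbD>" for z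
      using P.zorder[of z] Z that by (simp add: is_zero_sequence_of_def)
    show "connected \<bbbD>" by simp
    show "P.F z = 0 \<longleftrightarrow> f z = 0" if "z \<in> \<bbbD>" for z by (rule zP[OF that])
  qed blast
  obtain g0 where g0: "g0 holomorphic_on \<bbbD>" "\<And>z. z \<in> \<bbbD> \<Longrightarrow> h0 z = exp (g0 z)"
    using contractible_imp_holomorphic_log[OF h0(1) convex_imp_contractible[OF convex_ball] h0(2)] by metis
  define h where "h z = Re (- of_real p * g0 z)" for z
  have pt: "ereal_exp (enn2ereal (ennreal p * k_fun Z z) - ereal (h z)) \<le> ennreal_powr (Bz z) q"
    if z: "z \<in> \<bbbD>" and fz: "f z \<noteq> 0" for z
  proof -
    have z1: "cmod z < 1" using z by simp
    have nza: "snd Z n \<noteq> z" if "n \<in> seq_index Z" for n using zero_sequence_eq_0_iff[OF f nz Z z] fz that by blast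
    have PFnz: "P.F z \<noteq> 0" using zP[OF z] fz by simp
    define KN where "KN N = (\<Sum>n\<in>{..<N} \<inter> seq_index Z. k_term (snd Z n) z)" for N
    have bd: "exp (KN N) * cmod (f z) \<le> cmod (\<Prod>n<N. P.factor n z) * M z" for N
    proof -
      have "exp (KN N) = cmod (\<Prod>n<N. P.factor n z) * Q z ({..<N} \<inter> seq_index Z)"
        unfolding KN_def Q_def \<beta>_def by (rule P.exp_sum_k_term[OF z1 nza])
      then have "exp (KN N) * cmod (f z) = cmod (\<Prod>n<N. P.factor n z) * (cmod (f z) * Q z ({..<N} \<inter> seq_index Z))"
        by (simp only: mult_ac)
      also have "\<dots> \<le> cmod (\<Prod>n<N. P.factor n z) * M z" by (intro mult_left_mono prod_le z fz) auto
      finally show ?thesis .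
    qed
    \<comment> \<open>\<open>N0\<close> stays fixed while \<open>N\<close> tends to infinity: the
      partial products converge to \<open>P.F z\<close>, which is then divided out, leaving
      \<open>exp (KN N0) * |h0 z| \<le> M z\<close>.\<close>
    have KNb: "KN N0 \<le> ln (M z / cmod (h0 z))" for N0
    proof -
      have "(\<lambda>N. cmod (\<Prod>n<N. P.factor n z) * M z) \<longlonglongrightarrow> cmod (P.F z) * M z"
        by (intro tendsto_intros P.LIMSEQ_prod z1)
      moreover have "exp (KN N0) * cmod (f z) \<le> cmod (\<Prod>n<N. P.factor n z) * M z" if "N0 \<le> N" for N
      proof -
        have "KN N0 \<le> KN N" unfolding KN_def using that by (intro sum_mono2) (auto simp: k_term_nonneg)
        then have "exp (KN N0) * cmod (f z) \<le> exp (KN N) * cmod (f z)" by (intro mult_right_mono) auto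
        then show ?thesis using bd[of N] by linarith
      qed
      ultimately have "exp (KN N0) * cmod (f z) \<le> cmod (P.F z) * M z"
        by (intro LIMSEQ_le_const) auto
      then have "cmod (P.F z) * (exp (KN N0) * cmod (h0 z)) \<le> cmod (P.F z) * M z"
        unfolding h0(3)[OF z] by (simp add: norm_mult mult_ac)
      then have "exp (KN N0) * cmod (h0 z) \<le> M z" using PFnz by simp
      then have "exp (KN N0) \<le> M z / cmod (h0 z)" using h0(2)[OF z] by (simp add: field_simps)
      then have "ln (exp (KN N0)) \<le> ln (M z / cmod (h0 z))" by (intro ln_mono) auto
      then show ?thesis by simp
    qed
    define \<kappa> where "\<kappa> = ln (M z / cmod (h0 z))"
    have \<kappa>0: "0 \<le> \<kappa>" using KNb[of 0] by (simp add: KN_def \<kappa>_def)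
    have "k_fun Z z \<le> ennreal \<kappa>"
      unfolding k_fun_eq_SUP
    proof (rule SUP_least)
      fix F assume "F \<in> {F. finite F \<and> F \<subseteq> seq_index Z}"
      then have F: "finite F" "F \<subseteq> seq_index Z" by auto
      then obtain N where "F \<subseteq> {..<N}" using finite_nat_bounded by blast
      then have "(\<Sum>i\<in>F. k_term (snd Z i) z) \<le> KN N"
        unfolding KN_def using F by (intro sum_mono2) (auto simp: k_term_nonneg)
      then show "ennreal (\<Sum>i\<in>F. k_term (snd Z i) z) \<le> ennreal \<kappa>"
        using KNb[of N] unfolding \<kappa>_def by (intro ennreal_leI) linarith
    qed
    then have "ereal_exp (enn2ereal (ennreal p * k_fun Z z) - ereal (h z)) \<le> ennreal (exp (p * \<kappa> - h z))"
      by (rule ereal_exp_le[OF _ \<kappa>0 p])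
    \<comment> \<open>The choice \<open>h = - p * Re g0\<close> cancels the term
      \<open>- p * ln |h0 z|\<close> in \<open>p * \<kappa>\<close>, so only \<open>M z\<close>
      survives.\<close>
    also have "exp (p * \<kappa> - h z) = M z powr p"
    proof -
      have "ln (cmod (h0 z)) = Re (g0 z)" using g0(2)[OF z] by simp
      then have "p * \<kappa> - h z = p * ln (M z)"
        using Mpos[OF z fz] h0(2)[OF z] by (simp add: \<kappa>_def h_def ln_div algebra_simps)
      then show ?thesis using Mpos[OF z fz] by (simp add: powr_def)
    qed
    also have "M z powr p = enn2real (Bz z) powr q"
    proof -
      have "1 / s * p = q" using s p q by (simp add: s_def)
      then show ?thesis by (simp only: M_def powr_powr)
    qed
    also have "ennreal \<dots> = ennreal_powr (Bz z) q" using Bfin[OF z] by (simp add: ennreal_powr_def)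
    finally show ?thesis .
  qed
  show ?thesis
  \<comment> \<open>A Borel majorant stands in for the integrand with \<open>k_fun\<close>, whose
    own measurability is thereby left open.\<close>
  proof (rule that[of h "\<lambda>z. ennreal_powr (Bz z) q"])
    show "h harmonic_on \<bbbD>"
      unfolding h_def by (intro Re_holomorphic_harmonic_on holomorphic_intros g0) auto
    show "(\<lambda>z. ennreal_powr (Bz z) q) \<in> borel_measurable borel" by measurable
    \<comment> \<open>The estimate \<open>pt\<close> omits only the zeros of \<open>f\<close>, which
      form a countable set.\<close>
    have "countable (snd Z ` seq_index Z)" by simp
    then have "snd Z ` seq_index Z \<in> null_sets lborel" by (rule countable_imp_null_set_lborel)
    then have "AE z in lborel. z \<notin> snd Z ` seq_index Z" by (rule AE_not_in)
    then show "AE z in lborel. z \<in> \<bbbD> \<longrightarrow> ereal_exp (enn2ereal (ennreal p * k_fun Z z) - ereal (h z)) \<le> ennreal_powr (Bz z) q"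
    proof eventually_elim
      case (elim z)
      then show ?case using pt[of z] zero_sequence_eq_0_iff[OF f nz Z, of z] by blast
    qed
    show "(\<integral>\<^sup>+z\<in>\<bbbD>. ennreal_powr (Bz z) q * ennreal (\<omega> z) \<partial>lborel) < top" by (rule Bq)
  qed
qed

end

theorem corollary2:
  fixes p :: real and \<omega> :: "complex \<Rightarrow> real" and Z :: cseq
  assumes "0 < p"
    and "\<omega> \<in> B_infinity"
    and "seq_in Z \<bbbD>"
  shows "Z \<in> zero_sequences p \<omega> \<longleftrightarrow>
    (\<exists>h :: complex \<Rightarrow> real. h harmonic_on \<bbbD> \<and>
       (\<integral>\<^sup>+z. ereal_exp (enn2ereal (ennreal p * k_fun Z z) - ereal (h z)) * ennreal (\<omega> z) \<partial>dA) < \<infinity>)"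
proof
  obtain q where q: "1 < q" "\<omega> \<in> B_class q" using assms(2) by (auto simp: B_infinity_def)
  have pos: "AE z in dA. 0 < \<omega> z" using q(2) by (auto simp: B_class_def)
  {
    assume "\<exists>h. h harmonic_on \<bbbD> \<and>
       (\<integral>\<^sup>+z. ereal_exp (enn2ereal (ennreal p * k_fun Z z) - ereal (h z)) * ennreal (\<omega> z) \<partial>dA) < \<infinity>"
    then show "Z \<in> zero_sequences p \<omega>"
      using zero_sequence_of_harmonic_majorant[OF assms(1) pos assms(3)] by blast
  }
  assume "Z \<in> zero_sequences p \<omega>"
  then obtain f where f: "f \<in> weighted_Bergman p \<omega>" "\<exists>z\<in>\<bbbD>. f z \<noteq> 0" "is_zero_sequence_of Z f"
    by (auto simp: zero_sequences_def)
  then have hol: "f holomorphic_on \<bbbD>" and fin: "(\<integral>\<^sup>+z. ennreal (cmod (f z) powr p * \<omega> z) \<partial>dA) < \<infinity>"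
    by (auto simp: weighted_Bergman_def)
  \<comment> \<open>The estimates concern the Borel representative \<open>\<omega>'\<close>; both
    integrals are transferred through \<open>nn_integral_dA\<close>, since it equals
    \<open>\<omega>\<close> almost everywhere on the disc.\<close>
  obtain \<omega>' K where B: "Bekolle_weight q K \<omega>'" and eq: "AE z in lborel. z \<in> \<bbbD> \<longrightarrow> \<omega> z = \<omega>' z"
    using B_class_imp_Bekolle_weight[OF q] by blast
  interpret Bekolle_weight q K \<omega>' by (rule B)
  have "(\<integral>\<^sup>+w\<in>\<bbbD>. ennreal (cmod (f w) powr p * \<omega>' w) \<partial>lborel) < top"
  proof -
    have "(\<lambda>w. indicator \<bbbD> w *\<^sub>R f w) \<in> borel_measurable borel"
      by (rule borel_measurable_continuous_on_indicator) (use hol holomorphic_on_imp_continuous_on in auto)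
    then have [measurable]: "(\<lambda>w. cmod (indicator \<bbbD> w *\<^sub>R f w)) \<in> borel_measurable borel" by measurable
    have "(\<integral>\<^sup>+z. ennreal (cmod (f z) powr p * \<omega> z) \<partial>dA) =
        ennreal (1 / pi) * (\<integral>\<^sup>+w\<in>\<bbbD>. ennreal (cmod (indicator \<bbbD> w *\<^sub>R f w) powr p * \<omega>' w) \<partial>lborel)"
      by (rule nn_integral_dA, measurable) (use eq in \<open>auto elim!: eventually_mono\<close>)
    also have "(\<integral>\<^sup>+w\<in>\<bbbD>. ennreal (cmod (indicator \<bbbD> w *\<^sub>R f w) powr p * \<omega>' w) \<partial>lborel) =
        (\<integral>\<^sup>+w\<in>\<bbbD>. ennreal (cmod (f w) powr p * \<omega>' w) \<partial>lborel)"
      by (intro nn_integral_cong) (auto simp: indicator_def)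
    finally show ?thesis using fin pi_gt_zero
      by (auto simp: ennreal_mult_less_top ennreal_eq_0_iff simp del: pi_gt_zero)
  qed
  from harmonic_majorant_of_zero_sequence[OF assms(1) hol f(2,3) this]
  obtain h G where h: "h harmonic_on \<bbbD>" and [measurable]: "G \<in> borel_measurable borel"
    and le: "AE z in lborel. z \<in> \<bbbD> \<longrightarrow> ereal_exp (enn2ereal (ennreal p * k_fun Z z) - ereal (h z)) \<le> G z"
    and Gfin: "(\<integral>\<^sup>+z\<in>\<bbbD>. G z * ennreal (\<omega>' z) \<partial>lborel) < top" .
  have "(\<integral>\<^sup>+z. ereal_exp (enn2ereal (ennreal p * k_fun Z z) - ereal (h z)) * ennreal (\<omega> z) \<partial>dA) \<le>
      (\<integral>\<^sup>+z. G z * ennreal (\<omega> z) \<partial>dA)"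
  proof (rule nn_integral_mono_AE)
    have "AE z in dA. ereal_exp (enn2ereal (ennreal p * k_fun Z z) - ereal (h z)) \<le> G z"
      using le by (simp only: AE_dA_iff)
    then show "AE z in dA. ereal_exp (enn2ereal (ennreal p * k_fun Z z) - ereal (h z)) * ennreal (\<omega> z) \<le> G z * ennreal (\<omega> z)"
      by eventually_elim (rule mult_right_mono, auto)
  qed
  also have "\<dots> = ennreal (1 / pi) * (\<integral>\<^sup>+z\<in>\<bbbD>. G z * ennreal (\<omega>' z) \<partial>lborel)"
    by (rule nn_integral_dA, measurable) (use eq in \<open>auto elim!: eventually_mono\<close>)
  also have "\<dots> < \<infinity>" using Gfin by (simp add: ennreal_mult_less_top)
  finally show "\<exists>h. h harmonic_on \<bbbD> \<and>
       (\<integral>\<^sup>+z. ereal_exp (enn2ereal (ennreal p * k_fun Z z) - ereal (h z)) * ennreal (\<omega> z) \<partial>dA) < \<infinity>"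
    using h by blast
qed

end
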